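(* Let $\mathfrak{e}\subset\mathbb{C}$ be a compact, simply connected (but not necessarily connected) set which is regular for potential theory. Let $N\subset\mathbb{C}$ be an open, connected, simply connected set such that $N\cap\partial\mathfrak{e}$ is a continuous arc that divides $N$ into two pieces, $\mathfrak{e}^{\mathrm{int}}\cap N$ and $(\mathbb{C}\setminus\mathfrak{e})\cap N$. For each $n\ge 1$ let $M_n(N)$ be the number of zeros in $N$ (counting multiplicity) of the Chebyshev polynomial $T_n^{(\mathfrak{e})}$. Then either $\liminf_{n\to\infty} M_n(N)/n>0$ or $N\cap\partial\mathfrak{e}$ is an analytic arc.
   Context: For a compact, not finite, set $\mathfrak{e}\subset\mathbb{C}$ and a continuous complex-valued $f$ on $\mathfrak{e}$, $\|f\|_{\mathfrak{e}}=\sup_{z\in\mathfrak{e}}|f(z)|$. The Chebyshev polynomial $T_n=T_n^{(\mathfrak{e})}$ is the unique monic polynomial of degree $n$ minimizing $\|P\|_{\mathfrak{e}}$ over all monic polynomials $P$ of degree $n$. A compact set $\mathfrak{e}$ is called simply connected if $\mathbb{C}\setminus\mathfrak{e}$ is connected ($\mathfrak{e}$ itself need not be connected). $\mathfrak{e}^{\mathrm{int}}$ is the topological interior. Let $G_{\mathfrak{e}}$ be the Green's function, with pole at infinity, of the unbounded component of $\mathbb{C}\setminus\mathfrak{e}$; $\mathfrak{e}$ is regular for potential theory if it has positive logarithmic capacity and $G_{\mathfrak{e}}(z)\to0$ as $z$ approaches any boundary point of this component. "Divides $N$ into two pieces" means that $N\setminus\partial\mathfrak{e}$ has exactly two connected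 components, namely $\mathfrak{e}^{\mathrm{int}}\cap N$ and $(\mathbb{C}\setminus\mathfrak{e})\cap N$. The set $N\cap\partial\mathfrak{e}$ is an analytic arc if near each of its points it is the image of a real interval under an injective analytic map with nonvanishing derivative. *)

theory Defs
  imports
    "HOL-Analysis.Analysis"
    "HOL-Probability.Probability_Measure"
    "HOL-Computational_Algebra.Polynomial"
begin

section \<open>Chebyshev polynomials\<close>

definition sup_norm_on :: "complex set \<Rightarrow> (complex \<Rightarrow> complex) \<Rightarrow> real" where
  "sup_norm_on E f = (SUP z\<in>E. cmod (f z))"

definition is_chebyshev_poly :: "complex set \<Rightarrow> nat \<Rightarrow> complex poly \<Rightarrow> bool" where
  "is_chebyshev_poly E n T \<longleftrightarrow>
     degree T = n \<and> lead_coeff T = 1 \<and>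
     (\<forall>P. degree P = n \<and> lead_coeff P = 1 \<longrightarrow> sup_norm_on E (poly T) \<le> sup_norm_on E (poly P))"

text \<open>The description is proper whenever \<open>E\<close> is compact and infinite.\<close>

definition chebyshev_poly :: "complex set \<Rightarrow> nat \<Rightarrow> complex poly" where
  "chebyshev_poly E n = (THE T. is_chebyshev_poly E n T)"

definition num_chebyshev_zeros :: "complex set \<Rightarrow> complex set \<Rightarrow> nat \<Rightarrow> nat" where
  "num_chebyshev_zeros E N n = size (filter_mset (\<lambda>z. z \<in> N) (proots (chebyshev_poly E n)))"


section \<open>Logarithmic capacity\<close>

text \<open>The value on the diagonal is given explicitly because \<open>ln 0 = 0\<close> in the library.\<close>

definition log_kernel :: "complex \<Rightarrow> complex \<Rightarrow> ereal" where
  "log_kernel z w = (if z = w then \<infinity> else ereal (- ln (dist z w)))"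

text \<open>
  The double integral of \<^const>\<open>log_kernel\<close>, written as the difference of the integrals of
  its positive and negative parts (\<^const>\<open>e2ennreal\<close> sends negative values to \<open>0\<close>).  For
  a compactly supported finite measure the second integral is finite.
\<close>

definition log_energy :: "complex measure \<Rightarrow> ereal" where
  "log_energy \<mu> =
     enn2ereal (\<integral>\<^sup>+ z. \<integral>\<^sup>+ w. e2ennreal (log_kernel z w) \<partial>\<mu> \<partial>\<mu>) -
     enn2ereal (\<integral>\<^sup>+ z. \<integral>\<^sup>+ w. e2ennreal (- log_kernel z w) \<partial>\<mu> \<partial>\<mu>)"

definition compactly_supported_probs :: "complex set \<Rightarrow> complex measure set" where
  "compactly_supported_probs E =
     {\<mu>. prob_space \<mu> \<and> sets \<mu> = sets borel \<and> (\<exists>K\<subseteq>E. compact K \<and> emeasure \<mu> K = 1)}"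

definition robin_constant :: "complex set \<Rightarrow> ereal" where
  "robin_constant E = (INF \<mu>\<in>compactly_supported_probs E. log_energy \<mu>)"

text \<open>The capacity is \<open>exp (- robin_constant E)\<close>, with the usual conventions at infinite values.\<close>

definition log_capacity :: "complex set \<Rightarrow> ennreal" where
  "log_capacity E =
     (case robin_constant E of
        ereal r \<Rightarrow> ennreal (exp (- r))
      | PInfty \<Rightarrow> 0
      | MInfty \<Rightarrow> \<infinity>)"


section \<open>Green's function and regularity\<close>

text \<open>
  Twice continuously differentiable with vanishing Laplacian.  Here \<open>g\<close> is the gradient of
  \<open>h\<close>, as a complex number, and \<open>H z\<close> is the Hessian of \<open>h\<close> at \<open>z\<close>: the columns of the
  Hessian matrix are \<open>H z 1\<close> and \<open>H z \<i>\<close>, so its trace is \<open>Re (H z 1) + Im (H z \<i>)\<close>.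
\<close>

definition harmonic_on :: "(complex \<Rightarrow> real) \<Rightarrow> complex set \<Rightarrow> bool" where
  "harmonic_on h U \<longleftrightarrow> open U \<and>
     (\<exists>(g :: complex \<Rightarrow> complex) (H :: complex \<Rightarrow> complex \<Rightarrow> complex).
        (\<forall>z\<in>U. (h has_derivative (\<lambda>v. g z \<bullet> v)) (at z)) \<and>
        (\<forall>z\<in>U. (g has_derivative H z) (at z)) \<and>
        continuous_on U (\<lambda>z. H z 1) \<and> continuous_on U (\<lambda>z. H z \<i>) \<and>
        (\<forall>z\<in>U. Re (H z 1) + Im (H z \<i>) = 0))"

text \<open>
  For compact \<open>E\<close>, \<^term>\<open>outside E\<close> is the unbounded component of the complement.
  \<open>G\<close> is its Green's function with pole at infinity: harmonic, bounded away from the pole,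
  equal to \<open>ln \<bar>z\<bar> + O(1)\<close> at the pole, and with boundary limit \<open>0\<close> outside a set of
  capacity zero.  If \<open>E\<close> has positive capacity, exactly one function on \<^term>\<open>outside E\<close>
  has these properties; the values of \<open>G\<close> elsewhere are immaterial.
\<close>

definition is_green_function :: "complex set \<Rightarrow> (complex \<Rightarrow> real) \<Rightarrow> bool" where
  "is_green_function E G \<longleftrightarrow>
     harmonic_on G (outside E) \<and>
     (\<forall>r. bounded (G ` (outside E \<inter> cball 0 r))) \<and>
     (\<exists>B. \<forall>\<^sub>F z in at_infinity. \<bar>G z - ln (cmod z)\<bar> \<le> B) \<and>
     log_capacity {\<zeta> \<in> frontier (outside E). \<not> (G \<longlongrightarrow> 0) (at \<zeta> within outside E)} = 0"

definition potential_regular :: "complex set \<Rightarrow> bool" where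
  "potential_regular E \<longleftrightarrow>
     0 < log_capacity E \<and>
     (\<exists>G. is_green_function E G \<and>
          (\<forall>\<zeta>\<in>frontier (outside E). (G \<longlongrightarrow> 0) (at \<zeta> within outside E)))"


section \<open>Arcs\<close>

text \<open>
  An arc without end points: the arcs considered here are relatively closed in an open simply
  connected set and separate it, which excludes end points.
\<close>

definition open_arc :: "complex set \<Rightarrow> bool" where
  "open_arc A \<longleftrightarrow> A homeomorphic {0<..<1::real}"

definition analytic_arc :: "complex set \<Rightarrow> bool" where
  "analytic_arc A \<longleftrightarrow>
     (\<forall>p\<in>A. \<exists>U f a b. open U \<and> p \<in> U \<and> a < b \<and>
        f analytic_on (complex_of_real ` {a<..<b}) \<and>
        inj_on f (complex_of_real ` {a<..<b}) \<and>
        (\<forall>t\<in>{a<..<b}. deriv f (complex_of_real t) \<noteq> 0) \<and>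
        A \<inter> U = f ` complex_of_real ` {a<..<b})"

end

(*
Write t n for the norm of T n on E, D for a small disc in N around a boundary point of E, and
suppose that T n has only o(n) zeros in N for n in some sequence.  The functions
w n = G - ln (\<bar>T n\<bar> / t n) / n are nonnegative and superharmonic off E (Bernstein-Walsh), and
w n tends to 0 at infinity because the Chebyshev constant of E equals its capacity.  Comparison
with explicit harmonic functions propagates this: near every point off E there are points where
w n tends to 0.  Dividing T n / t n by the factors of its o(n) zeros in D and taking n-th roots
gives a normal family on D.  A limit g satisfies \<bar>g\<bar> = exp G off E, \<bar>g\<bar> = 1 on the
boundary of E and \<bar>g\<bar> < 1 in the interior, so inside D the boundary of E is the zero set of
the harmonic function ln \<bar>g\<bar>.  Such a zero set is an analytic arc unless it branches, which a
homeomorphic image of an open interval cannot do.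
The upper bound for the Chebyshev constant needs no equilibrium measure: good polynomials with
zeros on a level curve of G are found greedily by multiplicative weights, the maximum principle
guaranteeing a suitable next zero for any weights.
*)

theory Submission
  imports
    Defs
    "HOL-Complex_Analysis.Complex_Analysis"
    "HOL-Computational_Algebra.Fundamental_Theorem_Algebra"
begin

section \<open>Harmonic functions and a maximum principle\<close>

text \<open>Logarithms are avoided throughout. Every comparison is stated for a product of
  \<open>cmod (poly P z)\<close>, \<open>exp (c * G z)\<close> and real powers of moduli, which is
  locally the modulus of a holomorphic function, so that the maximum modulus principle applies and
  zeros of polynomials cause no singularities. The obstacle is that \<open>w n\<close> is infinite
  at the zeros of \<open>T n\<close>, so smallness at a prescribed point cannot be expected.
  Smallness at points nearby suffices, because after division by the zeros in the disc the
  convergence to g is locally uniform. The division costs a power of the radius of a circle whose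
  exponent is the number of zeros, and n-th roots make this cost vanish. The greedy construction is
  an effective minimax argument: for every probability weight on a finite net of E some point of a
  level curve has small weighted logarithmic distance, and multiplicative weights turn these
  separate answers into one sequence that is good at all points of the net at once.\<close>

lemma symmetric_second_derivative_approx:
  fixes h :: "complex \<Rightarrow> real" and g :: "complex \<Rightarrow> complex"
  assumes h: "\<And>w. w \<in> ball z d \<Longrightarrow> (h has_derivative (\<lambda>v. g w \<bullet> v)) (at w)"
    and lin: "linear H"
    and g: "\<And>w. w \<in> ball z d \<Longrightarrow> cmod (g w - g z - H (w - z)) \<le> e * cmod (w - z)"
    and s: "0 < s" "2 * s < d" and e: "0 \<le> e" and u: "cmod u = 1" and v: "cmod v = 1"
  shows "\<bar>h (z + s *\<^sub>R u + s *\<^sub>R v) - h (z + s *\<^sub>R u) - h (z + s *\<^sub>R v) + h z - s\<^sup>2 * (H v \<bullet> u)\<bar> \<le> 3 * e * s\<^sup>2"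
proof -
  \<comment> \<open>Differencing in direction v first and then applying the mean value theorem in
    direction u leaves one difference of gradients, at points within 2 * s and s of z; hence the
    constant 3.\<close>
  define \<phi> where "\<phi> t = h (z + t *\<^sub>R u + s *\<^sub>R v) - h (z + t *\<^sub>R u)" for t
  have norms: "cmod (t *\<^sub>R u) \<le> s" "cmod (t *\<^sub>R u + s *\<^sub>R v) \<le> 2 * s" if "0 \<le> t" "t \<le> s" for t
    using that u v s norm_triangle_ineq[of "t *\<^sub>R u" "s *\<^sub>R v"] by (auto simp: )
  have inb: "z + t *\<^sub>R u \<in> ball z d" "z + t *\<^sub>R u + s *\<^sub>R v \<in> ball z d" if "0 \<le> t" "t \<le> s" for t
    using norms[OF that] s by (auto simp: dist_norm norm_minus_commute add.assoc add.commute[of "s *\<^sub>R v"] simp del: norm_scaleR)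
  have der: "(\<phi> has_real_derivative (g (z + t *\<^sub>R u + s *\<^sub>R v) - g (z + t *\<^sub>R u)) \<bullet> u) (at t)"
    if "0 \<le> t" "t \<le> s" for t
  proof -
    have "((\<lambda>t. h (z + t *\<^sub>R u + s *\<^sub>R v)) has_derivative (\<lambda>x. g (z + t *\<^sub>R u + s *\<^sub>R v) \<bullet> (x *\<^sub>R u))) (at t)"
      by (rule has_derivative_compose[where f = "\<lambda>t. z + t *\<^sub>R u + s *\<^sub>R v", OF _ h[OF inb(2)[OF that]]])
        (auto intro!: derivative_eq_intros)
    moreover have "((\<lambda>t. h (z + t *\<^sub>R u)) has_derivative (\<lambda>x. g (z + t *\<^sub>R u) \<bullet> (x *\<^sub>R u))) (at t)"
      by (rule has_derivative_compose[where f = "\<lambda>t. z + t *\<^sub>R u", OF _ h[OF inb(1)[OF that]]])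
        (auto intro!: derivative_eq_intros)
    ultimately have "(\<phi> has_derivative (\<lambda>x. g (z + t *\<^sub>R u + s *\<^sub>R v) \<bullet> (x *\<^sub>R u) - g (z + t *\<^sub>R u) \<bullet> (x *\<^sub>R u))) (at t)"
      unfolding \<phi>_def by (rule has_derivative_diff)
    then show ?thesis
      unfolding has_field_derivative_def by (rule has_derivative_eq_rhs) (auto simp: fun_eq_iff algebra_simps inner_diff_left)
  qed
  obtain t where t: "0 < t" "t < s" and eq: "\<phi> s - \<phi> 0 = (s - 0) * ((g (z + t *\<^sub>R u + s *\<^sub>R v) - g (z + t *\<^sub>R u)) \<bullet> u)"
    using MVT2[of 0 s \<phi>, OF s(1) der] by auto
  let ?D = "g (z + t *\<^sub>R u + s *\<^sub>R v) - g (z + t *\<^sub>R u)"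
  have H: "H (t *\<^sub>R u + s *\<^sub>R v) = H (t *\<^sub>R u) + s *\<^sub>R H v"
    using lin by (simp add: linear_add linear_scale)
  have "cmod (g (z + t *\<^sub>R u + s *\<^sub>R v) - g z - H (t *\<^sub>R u + s *\<^sub>R v)) \<le> e * (2 * s)"
    using g[OF inb(2)[of t]] norms(2)[of t] t e mult_left_mono[OF norms(2)[of t], of e]
    by (simp add: add.assoc del: norm_scaleR)
  moreover have "cmod (g (z + t *\<^sub>R u) - g z - H (t *\<^sub>R u)) \<le> e * s"
    using g[OF inb(1)[of t]] norms(1)[of t] t e mult_left_mono[OF norms(1)[of t], of e]
    by (simp add: add.assoc del: norm_scaleR)
  moreover have "?D - s *\<^sub>R H v = (g (z + t *\<^sub>R u + s *\<^sub>R v) - g z - H (t *\<^sub>R u + s *\<^sub>R v)) - (g (z + t *\<^sub>R u) - g z - H (t *\<^sub>R u))"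
    by (simp add: H)
  ultimately have "cmod (?D - s *\<^sub>R H v) \<le> 3 * e * s"
    using norm_triangle_ineq4[of "g (z + t *\<^sub>R u + s *\<^sub>R v) - g z - H (t *\<^sub>R u + s *\<^sub>R v)" "g (z + t *\<^sub>R u) - g z - H (t *\<^sub>R u)"]
    by (simp only:)
  then have "\<bar>(?D - s *\<^sub>R H v) \<bullet> u\<bar> \<le> 3 * e * s"
    using Cauchy_Schwarz_ineq2[of "?D - s *\<^sub>R H v" u] u by simp
  then have "s * \<bar>(?D - s *\<^sub>R H v) \<bullet> u\<bar> \<le> s * (3 * e * s)"
    using s by (intro mult_left_mono) auto
  moreover have "h (z + s *\<^sub>R u + s *\<^sub>R v) - h (z + s *\<^sub>R u) - h (z + s *\<^sub>R v) + h z - s\<^sup>2 * (H v \<bullet> u)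
     = s * ((?D - s *\<^sub>R H v) \<bullet> u)"
    using eq by (simp add: \<phi>_def inner_diff_left algebra_simps power2_eq_square)
  ultimately have "\<bar>h (z + s *\<^sub>R u + s *\<^sub>R v) - h (z + s *\<^sub>R u) - h (z + s *\<^sub>R v) + h z - s\<^sup>2 * (H v \<bullet> u)\<bar>
      \<le> s * (3 * e * s)"
    using s by (simp only: abs_mult)
  then show ?thesis by (simp add: power2_eq_square mult_ac)
qed

text \<open>\<open>harmonic_on\<close> gives the Hessian as the derivative of a gradient field, so
  its symmetry has to be derived. The second difference over the parallelogram with sides
  \<open>s *\<^sub>R u\<close> and \<open>s *\<^sub>R v\<close> is symmetric in u and v, and divided
  by the square of s it is close to both sides of the claim.\<close>

lemma symmetric_second_derivative:
  fixes h :: "complex \<Rightarrow> real" and g :: "complex \<Rightarrow> complex"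
  assumes U: "open U" "z \<in> U"
    and h: "\<And>w. w \<in> U \<Longrightarrow> (h has_derivative (\<lambda>v. g w \<bullet> v)) (at w)"
    and g: "(g has_derivative H) (at z)"
    and u: "cmod u = 1" and v: "cmod v = 1"
  shows "H v \<bullet> u = H u \<bullet> v"
proof -
  have lin: "linear H" using g by (simp add: has_derivative_linear)
  have "\<bar>H v \<bullet> u - H u \<bullet> v\<bar> \<le> e" if "e > 0" for e
  proof -
    define e' where "e' = e / 6"
    have e': "e' > 0" using that by (simp add: e'_def)
    obtain d1 where d1: "d1 > 0" "\<And>w. cmod (w - z) < d1 \<Longrightarrow> cmod (g w - g z - H (w - z)) \<le> e' * cmod (w - z)"
      using g e' unfolding has_derivative_at_alt by blast
    obtain d2 where d2: "d2 > 0" "ball z d2 \<subseteq> U" using U openE by blast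
    define d where "d = min d1 d2"
    have d: "d > 0" using d1 d2 by (simp add: d_def)
    have h': "(h has_derivative (\<lambda>v. g w \<bullet> v)) (at w)" if "w \<in> ball z d" for w
      using h[of w] d2 that by (auto simp: d_def)
    have g': "cmod (g w - g z - H (w - z)) \<le> e' * cmod (w - z)" if "w \<in> ball z d" for w
      using d1(2)[of w] that by (auto simp: d_def dist_norm norm_minus_commute)
    define s where "s = d / 3"
    have s: "0 < s" "2 * s < d" using d by (auto simp: s_def)
    have A: "\<bar>h (z + s *\<^sub>R u + s *\<^sub>R v) - h (z + s *\<^sub>R u) - h (z + s *\<^sub>R v) + h z - s\<^sup>2 * (H v \<bullet> u)\<bar> \<le> 3 * e' * s\<^sup>2"
      by (rule symmetric_second_derivative_approx[OF h' lin g' s _ u v]) (use e' in auto)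
    have B: "\<bar>h (z + s *\<^sub>R v + s *\<^sub>R u) - h (z + s *\<^sub>R v) - h (z + s *\<^sub>R u) + h z - s\<^sup>2 * (H u \<bullet> v)\<bar> \<le> 3 * e' * s\<^sup>2"
      by (rule symmetric_second_derivative_approx[OF h' lin g' s _ v u]) (use e' in auto)
    have "z + s *\<^sub>R u + s *\<^sub>R v = z + s *\<^sub>R v + s *\<^sub>R u" by simp
    then have "\<bar>s\<^sup>2 * (H v \<bullet> u) - s\<^sup>2 * (H u \<bullet> v)\<bar> \<le> 6 * e' * s\<^sup>2"
      using A B unfolding abs_le_iff by (simp only:) linarith
    then have "s\<^sup>2 * \<bar>H v \<bullet> u - H u \<bullet> v\<bar> \<le> s\<^sup>2 * e"
      by (simp add: e'_def abs_mult flip: right_diff_distrib) (simp add: mult.commute)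
    then show ?thesis using s by simp
  qed
  then have "\<bar>H v \<bullet> u - H u \<bullet> v\<bar> \<le> 0" by (meson field_le_epsilon dense_ge)
  then show ?thesis by simp
qed

text \<open>The conjugate of the gradient is holomorphic: symmetry of the Hessian and vanishing of
  its trace are the Cauchy-Riemann equations for it. A primitive on the disc has real part h up to a
  constant.\<close>

lemma harmonic_on_Re_holomorphic:
  assumes "harmonic_on h U" "ball z r \<subseteq> U"
  obtains F where "F holomorphic_on ball z r" "\<And>w. w \<in> ball z r \<Longrightarrow> h w = Re (F w)"
proof (cases "r > 0")
  case False
  then have "ball z r = {}" by simp
  then show ?thesis using that[of "\<lambda>_. 0"] by (metis empty_iff holomorphic_on_empty)
next
  case r: True
  obtain g H where U: "open U" and h: "\<And>z. z \<in> U \<Longrightarrow> (h has_derivative (\<lambda>v. g z \<bullet> v)) (at z)"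
    and g: "\<And>z. z \<in> U \<Longrightarrow> (g has_derivative H z) (at z)"
    and tr: "\<And>z. z \<in> U \<Longrightarrow> Re (H z 1) + Im (H z \<i>) = 0"
    using assms(1) unfolding harmonic_on_def by blast
  have f: "((\<lambda>w. cnj (g w)) has_field_derivative cnj (H w 1)) (at w)" if "w \<in> U" for w
  proof -
    have lin: "linear (H w)" using g[OF that] by (simp add: has_derivative_linear)
    have sym: "Re (H w \<i>) = Im (H w 1)"
      using symmetric_second_derivative[OF U that h g[OF that], of 1 \<i>] by simp
    have "cnj (H w v) = cnj (H w 1) * v" for v
    proof -
      have "v = Re v *\<^sub>R 1 + Im v *\<^sub>R \<i>" by (simp add: complex_eq_iff)
      then have "H w v = Re v *\<^sub>R H w 1 + Im v *\<^sub>R H w \<i>"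
        using lin by (metis linear_add linear_scale)
      moreover have "H w \<i> = Complex (Im (H w 1)) (- Re (H w 1))"
        using sym tr[OF that] by (auto simp: complex_eq_iff)
      ultimately have "H w v = Re v *\<^sub>R H w 1 + Im v *\<^sub>R Complex (Im (H w 1)) (- Re (H w 1))"
        by simp
      then show ?thesis by (simp only: complex_eq_iff) (simp add: algebra_simps)
    qed
    then have "(\<lambda>v. cnj (H w v)) = (*) (cnj (H w 1))" by (rule ext)
    then show ?thesis
      using has_derivative_cnj[OF g[OF that]] by (simp add: has_field_derivative_def)
  qed
  have "(\<lambda>w. cnj (g w)) holomorphic_on ball z r"
    using f assms(2) by (auto simp: holomorphic_on_open)
  then obtain F where F: "\<And>w. w \<in> ball z r \<Longrightarrow> (F has_field_derivative cnj (g w)) (at w within ball z r)"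
    using holomorphic_convex_primitive'[OF convex_ball open_ball] by metis
  have F': "(F has_field_derivative cnj (g w)) (at w)" if "w \<in> ball z r" for w
    using F[OF that] that by (simp add: at_within_open[OF _ open_ball])
  have "((\<lambda>w. h w - Re (F w)) has_derivative (\<lambda>_. 0)) (at w)" if "w \<in> ball z r" for w
  proof -
    have "((\<lambda>w. Re (F w)) has_derivative (\<lambda>v. Re (cnj (g w) * v))) (at w)"
      using F'[OF that] unfolding has_field_derivative_def by (rule has_derivative_Re)
    then have "((\<lambda>w. h w - Re (F w)) has_derivative (\<lambda>v. g w \<bullet> v - Re (cnj (g w) * v))) (at w)"
      using h[of w] that assms(2) by (intro has_derivative_diff) auto
    then show ?thesis by (rule has_derivative_eq_rhs) (auto simp: fun_eq_iff inner_complex_def)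
  qed
  then obtain c where c: "\<And>w. w \<in> ball z r \<Longrightarrow> h w - Re (F w) = c"
    using has_derivative_zero_constant[of "ball z r" "\<lambda>w. h w - Re (F w)"]
    by (metis convex_ball has_derivative_at_withinI)
  show ?thesis
  proof (rule that[of "\<lambda>w. F w + of_real c"])
    show "(\<lambda>w. F w + of_real c) holomorphic_on ball z r"
      using F' by (intro holomorphic_intros) (meson holomorphic_on_open open_ball)
  qed (use c in force)
qed

text \<open>\<open>exp G\<close> is the modulus of a holomorphic function on discs, but in general
  not on the whole complement of E, where the harmonic conjugate of G is multivalued; hence the
  local form. Zeros are allowed, so moduli of polynomials belong to the class, and the class is
  closed under products.\<close>

definition local_modulus :: "(complex \<Rightarrow> real) \<Rightarrow> complex set \<Rightarrow> bool" where
  "local_modulus \<phi> U \<longleftrightarrow>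
     (\<forall>z\<in>U. \<exists>r>0. \<exists>f. f holomorphic_on ball z r \<and> (\<forall>w\<in>ball z r. \<phi> w = cmod (f w)))"

lemma local_modulus_subset: "local_modulus \<phi> U \<Longrightarrow> V \<subseteq> U \<Longrightarrow> local_modulus \<phi> V"
  unfolding local_modulus_def by blast

lemma local_modulus_mult:
  assumes "local_modulus \<phi> U" "local_modulus \<psi> U"
  shows "local_modulus (\<lambda>z. \<phi> z * \<psi> z) U"
  unfolding local_modulus_def
proof
  fix z assume z: "z \<in> U"
  obtain r f where f: "r > 0" "f holomorphic_on ball z r" "\<And>w. w \<in> ball z r \<Longrightarrow> \<phi> w = cmod (f w)"
    using assms(1) z unfolding local_modulus_def by blast
  obtain s g where g: "s > 0" "g holomorphic_on ball z s" "\<And>w. w \<in> ball z s \<Longrightarrow> \<psi> w = cmod (g w)"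
    using assms(2) z unfolding local_modulus_def by blast
  have "(\<lambda>w. f w * g w) holomorphic_on ball z (min r s)"
    by (intro holomorphic_intros holomorphic_on_subset[OF f(2)] holomorphic_on_subset[OF g(2)]) auto
  then show "\<exists>r>0. \<exists>h. h holomorphic_on ball z r \<and> (\<forall>w\<in>ball z r. \<phi> w * \<psi> w = cmod (h w))"
    using f g by (intro exI[of _ "min r s"] conjI exI[of _ "\<lambda>w. f w * g w"]) (auto simp: norm_mult)
qed

lemma local_modulus_norm:
  assumes "f holomorphic_on U" "open U"
  shows "local_modulus (\<lambda>z. cmod (f z)) U"
  unfolding local_modulus_def
proof
  fix z assume "z \<in> U"
  then obtain r where "r > 0" "ball z r \<subseteq> U" using assms(2) open_contains_ball by blast
  then show "\<exists>r>0. \<exists>h. h holomorphic_on ball z r \<and> (\<forall>w\<in>ball z r. cmod (f w) = cmod (h w))"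
    using assms(1) holomorphic_on_subset by blast
qed

lemma local_modulus_norm_powr:
  assumes f: "f holomorphic_on U" "open U" "\<And>z. z \<in> U \<Longrightarrow> f z \<noteq> 0"
  shows "local_modulus (\<lambda>z. cmod (f z) powr c) U"
  unfolding local_modulus_def
proof
  fix z assume "z \<in> U"
  then obtain r where r: "r > 0" "ball z r \<subseteq> U" using f(2) open_contains_ball by blast
  have "f holomorphic_on ball z r" using f r holomorphic_on_subset by blast
  moreover have "simply_connected (ball z r)" by (simp add: convex_imp_simply_connected)
  ultimately obtain l where l: "l holomorphic_on ball z r" "\<And>w. w \<in> ball z r \<Longrightarrow> f w = exp (l w)"
    using simply_connected_eq_holomorphic_log[OF open_ball, of z r] f(3) r(2) by (metis subset_iff)
  have "(\<lambda>w. exp (of_real c * l w)) holomorphic_on ball z r"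
    by (intro holomorphic_intros l)
  moreover have "\<forall>w\<in>ball z r. cmod (f w) powr c = cmod (exp (of_real c * l w))"
    by (simp add: l(2) powr_def)
  ultimately show "\<exists>r>0. \<exists>h. h holomorphic_on ball z r \<and> (\<forall>w\<in>ball z r. cmod (f w) powr c = cmod (h w))"
    using r(1) by blast
qed

lemma local_modulus_exp_harmonic:
  assumes "harmonic_on h U"
  shows "local_modulus (\<lambda>z. exp (c * h z)) U"
  unfolding local_modulus_def
proof
  fix z assume "z \<in> U"
  moreover have "open U" using assms by (simp add: harmonic_on_def)
  ultimately obtain r where r: "r > 0" "ball z r \<subseteq> U" using open_contains_ball by blast
  obtain F where F: "F holomorphic_on ball z r" "\<And>w. w \<in> ball z r \<Longrightarrow> h w = Re (F w)"
    using harmonic_on_Re_holomorphic[OF assms r(2)] by blast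
  show "\<exists>r>0. \<exists>f. f holomorphic_on ball z r \<and> (\<forall>w\<in>ball z r. exp (c * h w) = cmod (f w))"
    using F r by (intro exI[of _ r] conjI exI[of _ "\<lambda>w. exp (of_real c * F w)"] holomorphic_intros) auto
qed

lemma local_modulus_continuous:
  assumes "local_modulus \<phi> U" "open U"
  shows "continuous_on U \<phi>"
proof (rule continuous_at_imp_continuous_on, rule ballI)
  fix z assume "z \<in> U"
  then obtain r f where f: "r > 0" "f holomorphic_on ball z r" "\<And>w. w \<in> ball z r \<Longrightarrow> \<phi> w = cmod (f w)"
    using assms(1) unfolding local_modulus_def by blast
  have "isCont (\<lambda>w. cmod (f w)) z"
    using f(1,2) holomorphic_on_imp_continuous_on[OF f(2)]
    by (intro continuous_intros) (auto simp: continuous_on_eq_continuous_at)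
  then show "isCont \<phi> z"
  proof (subst isCont_cong)
    show "eventually (\<lambda>w. \<phi> w = cmod (f w)) (nhds z)"
      using f by (intro eventually_nhds_in_open[THEN eventually_mono, of "ball z r"]) auto
  qed
qed

lemma local_modulus_max_open:
  assumes lm: "local_modulus \<phi> U" and U: "open U" and m: "\<And>z. z \<in> U \<Longrightarrow> \<phi> z \<le> m"
  shows "open {z\<in>U. \<phi> z = m}"
  unfolding open_contains_ball
proof
  fix z assume z: "z \<in> {z\<in>U. \<phi> z = m}"
  obtain r1 f where f: "r1 > 0" "f holomorphic_on ball z r1" "\<And>w. w \<in> ball z r1 \<Longrightarrow> \<phi> w = cmod (f w)"
    using lm z unfolding local_modulus_def by blast
  obtain r2 where r2: "r2 > 0" "ball z r2 \<subseteq> U" using U z open_contains_ball by blast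
  define r where "r = min r1 r2"
  have r: "r > 0" "ball z r \<subseteq> U" "ball z r \<subseteq> ball z r1" using f r2 by (auto simp: r_def)
  have fc: "f constant_on ball z r"
  proof (rule maximum_modulus_principle[of f "ball z r" "ball z r" z])
    show "f holomorphic_on ball z r" using f r holomorphic_on_subset by blast
    fix w assume w: "w \<in> ball z r"
    then have "\<phi> w \<le> \<phi> z" using m[of w] z r by auto
    moreover have "\<phi> w = cmod (f w)" "\<phi> z = cmod (f z)" using f(1,3) w r by auto
    ultimately show "cmod (f w) \<le> cmod (f z)" by simp
  qed (use r in auto)
  have "\<phi> w = m" if "w \<in> ball z r" for w
  proof -
    have "z \<in> ball z r" using r(1) by simp
    then have "f w = f z"
      using fc that unfolding constant_on_def by metis
    moreover have "w \<in> ball z r1" "z \<in> ball z r1" using that r(3) f(1) by auto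
    then have "\<phi> w = cmod (f w)" "\<phi> z = cmod (f z)" using f(3) by blast+
    ultimately show ?thesis using z by simp
  qed
  then show "\<exists>e>0. ball z e \<subseteq> {z \<in> U. \<phi> z = m}" using r by blast
qed

text \<open>Compactness of superlevel sets is the form in which boundary behaviour, including that
  at infinity, enters, so U may be unbounded and \<phi> need not extend to the boundary. A value
  above M would lead to a maximum, and the set of maximum points would be open, compact and nonempty
  in the plane.\<close>

theorem local_modulus_max_principle:
  assumes lm: "local_modulus \<phi> U" and U: "open U"
    and cpt: "\<And>m. m > M \<Longrightarrow> compact {z\<in>U. \<phi> z \<ge> m}" and z: "z \<in> U"
  shows "\<phi> z \<le> M"
proof (rule ccontr)
  assume "\<not> \<phi> z \<le> M"
  define S where "S = {w\<in>U. \<phi> w \<ge> \<phi> z}"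
  have cont: "continuous_on U \<phi>" using lm U by (rule local_modulus_continuous)
  have S: "compact S" "z \<in> S" "S \<subseteq> U" using cpt[of "\<phi> z"] \<open>\<not> \<phi> z \<le> M\<close> z by (auto simp: S_def)
  then obtain y where y: "y \<in> S" "\<And>w. w \<in> S \<Longrightarrow> \<phi> w \<le> \<phi> y"
    using continuous_attains_sup[of S \<phi>] continuous_on_subset[OF cont] by (metis empty_iff)
  have max: "\<phi> w \<le> \<phi> y" if "w \<in> U" for w
    using y that S by (cases "w \<in> S") (force simp: S_def)+
  have "open {w\<in>U. \<phi> w = \<phi> y}" by (rule local_modulus_max_open[OF lm U max])
  moreover have "{w\<in>U. \<phi> w = \<phi> y} = {w\<in>U. \<phi> w \<ge> \<phi> y}" using max by force
  moreover have "compact {w\<in>U. \<phi> w \<ge> \<phi> y}"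
    using y(1) \<open>\<not> \<phi> z \<le> M\<close> by (intro cpt) (auto simp: S_def)
  moreover have "y \<in> {w\<in>U. \<phi> w \<ge> \<phi> y}" using y S by auto
  ultimately show False
    using compact_open[of "{w\<in>U. \<phi> w \<ge> \<phi> y}"] by auto
qed

text \<open>The way to check the hypothesis of the maximum principle: no sequence in the superlevel
  set can escape to the boundary or to infinity.\<close>

lemma compact_superlevel:
  fixes \<phi> :: "complex \<Rightarrow> real"
  assumes cont: "continuous_on U \<phi>"
    and bdry: "\<And>\<zeta>. \<zeta> \<in> closure U \<Longrightarrow> \<zeta> \<notin> U \<Longrightarrow> eventually (\<lambda>z. \<phi> z < m) (at \<zeta> within U)"
    and inf: "eventually (\<lambda>z. z \<in> U \<longrightarrow> \<phi> z < m) at_infinity"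
  shows "compact {z\<in>U. \<phi> z \<ge> m}"
proof -
  let ?S = "{z\<in>U. \<phi> z \<ge> m}"
  obtain b where b: "\<And>z. cmod z \<ge> b \<Longrightarrow> z \<in> U \<Longrightarrow> \<phi> z < m"
    using inf unfolding eventually_at_infinity by blast
  have "?S \<subseteq> cball 0 b"
    using b by (force simp: not_le[symmetric])
  then have bd: "bounded ?S" using bounded_cball bounded_subset by blast
  have "closed ?S"
    unfolding closed_sequential_limits
  proof (intro allI impI)
    fix x l assume "(\<forall>n. x n \<in> ?S) \<and> x \<longlonglongrightarrow> l"
    then have x: "\<And>n. x n \<in> U" "\<And>n. \<phi> (x n) \<ge> m" "x \<longlonglongrightarrow> l" by auto
    have cl: "l \<in> closure U" using x closure_sequential by blast
    show "l \<in> ?S"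
    proof (cases "l \<in> U")
      case True
      have "(\<lambda>n. \<phi> (x n)) \<longlonglongrightarrow> \<phi> l"
        using continuous_on_tendsto_compose[OF cont x(3) True] x(1) by auto
      then have "\<phi> l \<ge> m" using x(2) by (meson LIMSEQ_le_const)
      then show ?thesis using True by simp
    next
      case False
      have "filterlim x (at l within U) sequentially"
        using x False unfolding filterlim_at by (metis (mono_tags, lifting) eventually_sequentiallyI)
      then have "eventually (\<lambda>n. \<phi> (x n) < m) sequentially"
        using bdry[OF cl False] unfolding filterlim_iff by blast
      then obtain n where "\<phi> (x n) < m" by (auto simp: eventually_sequentially)
      then show ?thesis using x(2)[of n] by simp
    qed
  qed
  with bd show ?thesis by (simp add: compact_eq_bounded_closed)
qed

section \<open>Green's function\<close>

lemma local_modulus_max_bounded: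
  assumes lm: "local_modulus \<phi> V" and V: "open V" and U: "open U" "bounded U" "closure U \<subseteq> V"
    and le: "\<And>z. z \<in> closure U \<Longrightarrow> z \<notin> U \<Longrightarrow> \<phi> z \<le> M" and z: "z \<in> U"
  shows "\<phi> z \<le> M"
proof (rule local_modulus_max_principle[OF local_modulus_subset[OF lm] U(1) _ z])
  show UV: "U \<subseteq> V" using U(3) closure_subset by blast
  fix m assume m: "M < m"
  have cont: "continuous_on V \<phi>" using lm V by (rule local_modulus_continuous)
  show "compact {z\<in>U. \<phi> z \<ge> m}"
  proof (rule compact_superlevel)
    show "continuous_on U \<phi>" using cont UV continuous_on_subset by blast
    show "eventually (\<lambda>z. \<phi> z < m) (at \<zeta> within U)" if "\<zeta> \<in> closure U" "\<zeta> \<notin> U" for \<zeta>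
    proof -
      have "isCont \<phi> \<zeta>" using cont V U(3) that by (meson continuous_on_eq_continuous_at subsetD)
      then have "(\<phi> \<longlongrightarrow> \<phi> \<zeta>) (at \<zeta> within U)"
        using continuous_at_imp_continuous_at_within continuous_within by blast
      then show ?thesis using le[OF that] m by (intro order_tendstoD(2)[of \<phi> "\<phi> \<zeta>"]) auto
    qed
    obtain b where "\<And>z. z \<in> U \<Longrightarrow> cmod z \<le> b" using U(2) bounded_iff by blast
    then show "eventually (\<lambda>z. z \<in> U \<longrightarrow> \<phi> z < m) at_infinity"
      unfolding eventually_at_infinity by (intro exI[of _ "b + 1"]) force
  qed
qed

text \<open>In the comparisons a factor with exponent \<epsilon> is inserted to force decay at
  infinity, where only boundedness is known. Letting \<epsilon> tend to 0 removes it again.\<close>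

lemma le_if_mult_powr_le:
  fixes a c t :: real
  assumes "c > 0" and le: "\<And>\<epsilon>. \<epsilon> > 0 \<Longrightarrow> a * c powr \<epsilon> \<le> t"
  shows "a \<le> t"
proof -
  have "((\<lambda>\<epsilon>. a * c powr \<epsilon>) \<longlongrightarrow> a * c powr 0) (at_right 0)"
    using assms(1) by (intro tendsto_intros) auto
  moreover have "eventually (\<lambda>\<epsilon>. a * c powr \<epsilon> \<le> t) (at_right 0)"
    using le by (simp add: eventually_at_right_less eventually_at_filter)
  ultimately show ?thesis
    using tendsto_upperbound[of "\<lambda>\<epsilon>. a * c powr \<epsilon>" "a * c powr 0" "at_right 0" t] assms(1) by simp
qed

lemma norm_poly_le_power:
  fixes P :: "complex poly"
  assumes "degree P \<le> n"
  obtains C where "C > 0" "\<And>z. cmod z \<ge> 1 \<Longrightarrow> cmod (poly P z) \<le> C * cmod z ^ n"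
proof
  show "(\<Sum>i\<le>degree P. cmod (coeff P i)) + 1 > 0"
    by (smt (verit) norm_ge_zero sum_nonneg)
  fix z :: complex assume z: "cmod z \<ge> 1"
  have "cmod (poly P z) \<le> (\<Sum>i\<le>degree P. cmod (coeff P i) * cmod z ^ i)"
    unfolding poly_altdef by (rule order_trans[OF norm_sum]) (simp add: norm_mult norm_power)
  also have "\<dots> \<le> (\<Sum>i\<le>degree P. cmod (coeff P i) * cmod z ^ n)"
    using z assms by (intro sum_mono mult_left_mono power_increasing) auto
  also have "\<dots> \<le> ((\<Sum>i\<le>degree P. cmod (coeff P i)) + 1) * cmod z ^ n"
    by (simp add: distrib_right flip: sum_distrib_right)
  finally show "cmod (poly P z) \<le> ((\<Sum>i\<le>degree P. cmod (coeff P i)) + 1) * cmod z ^ n" .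
qed

locale regular_green =
  fixes E :: "complex set" and G :: "complex \<Rightarrow> real"
  assumes compact_E: "compact E" and conn: "connected (- E)" and infinite_E: "infinite E"
    and harmonic: "harmonic_on G (- E)"
    and bdry: "\<And>\<zeta>. \<zeta> \<in> frontier E \<Longrightarrow> (G \<longlongrightarrow> 0) (at \<zeta> within - E)"
    and at_inf: "\<exists>B. \<forall>\<^sub>F z in at_infinity. \<bar>G z - ln (cmod z)\<bar> \<le> B"
begin

lemma open_compl: "open (- E)"
  using compact_E by (simp add: compact_imp_closed open_Compl)

lemma G_continuous: "continuous_on (- E) G"
  using harmonic open_compl unfolding harmonic_on_def
  by (meson continuous_at_imp_continuous_on has_derivative_continuous)

lemma G_isCont: "z \<notin> E \<Longrightarrow> isCont G z"
  using G_continuous open_compl continuous_on_eq_continuous_at by blast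

lemma lm_exp_G: "local_modulus (\<lambda>z. exp (c * G z)) (- E)"
  by (rule local_modulus_exp_harmonic[OF harmonic])

lemma bdry_closure: "\<zeta> \<in> closure (- E) \<Longrightarrow> \<zeta> \<notin> - E \<Longrightarrow> (G \<longlongrightarrow> 0) (at \<zeta> within - E)"
  using bdry[of \<zeta>] by (simp add: frontier_closures closure_subset[THEN subsetD])

lemma G_asymp:
  obtains B r where "B > 0" "r \<ge> 1" "\<And>z. cmod z \<ge> r \<Longrightarrow> z \<notin> E \<and> \<bar>G z - ln (cmod z)\<bar> \<le> B"
proof -
  obtain B b where b: "\<And>z. cmod z \<ge> b \<Longrightarrow> \<bar>G z - ln (cmod z)\<bar> \<le> B"
    using at_inf unfolding eventually_at_infinity by blast
  obtain a where a: "\<And>z. z \<in> E \<Longrightarrow> cmod z \<le> a" using compact_E by (meson bounded_iff compact_imp_bounded)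
  show ?thesis
  proof (rule that[of "max B 1" "max 1 (max b (a + 1))"])
    fix z assume z: "cmod z \<ge> max 1 (max b (a + 1))"
    then have "\<bar>G z - ln (cmod z)\<bar> \<le> B" "z \<notin> E" using a[of z] b[of z] by force+
    then show "z \<notin> E \<and> \<bar>G z - ln (cmod z)\<bar> \<le> max B 1" by simp
  qed auto
qed

lemma G_at_top: "filterlim G at_top at_infinity"
proof -
  obtain B r where B: "B > 0" "r \<ge> 1" "\<And>z. cmod z \<ge> r \<Longrightarrow> z \<notin> E \<and> \<bar>G z - ln (cmod z)\<bar> \<le> B"
    using G_asymp by blast
  have "filterlim (\<lambda>z::complex. - B + ln (norm z)) at_top at_infinity"
    by (intro filterlim_tendsto_add_at_top[OF tendsto_const] filterlim_compose[OF ln_at_top] filterlim_norm_at_top)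
  moreover have "eventually (\<lambda>z. - B + ln (norm z) \<le> G z) at_infinity"
    unfolding eventually_at_infinity using B(3) by (intro exI[of _ r]) (force simp: abs_le_iff)
  ultimately show ?thesis by (rule filterlim_at_top_mono)
qed

lemma G_nonneg:
  assumes "z \<notin> E" shows "G z \<ge> 0"
proof -
  have "exp (- 1 * G z) \<le> 1"
  proof (rule local_modulus_max_principle[OF lm_exp_G open_compl])
    fix m :: real assume m: "1 < m"
    show "compact {z \<in> - E. m \<le> exp (- 1 * G z)}"
    proof (rule compact_superlevel)
      show "continuous_on (- E) (\<lambda>z. exp (- 1 * G z))" by (intro continuous_intros G_continuous)
      show "eventually (\<lambda>z. exp (- 1 * G z) < m) (at \<zeta> within - E)" if "\<zeta> \<in> closure (- E)" "\<zeta> \<notin> - E" for \<zeta>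
      proof -
        have "((\<lambda>z. exp (- 1 * G z)) \<longlongrightarrow> exp (- 1 * 0)) (at \<zeta> within - E)"
          by (intro tendsto_intros bdry_closure that)
        then show ?thesis using m by (intro order_tendstoD(2)) auto
      qed
      have "eventually (\<lambda>z. G z > 0) at_infinity" using G_at_top filterlim_at_top_dense by blast
      then show "eventually (\<lambda>z. z \<in> - E \<longrightarrow> exp (- 1 * G z) < m) at_infinity"
      proof eventually_elim
        case (elim z)
        then have "exp (- 1 * G z) < 1" by simp
        then show ?case using m by linarith
      qed
    qed
  qed (use assms in auto)
  then show ?thesis by simp
qed

text \<open>A zero would be a minimum, so the zero set is open and closed in the connected
  complement of E; this contradicts the growth of G at infinity.\<close>

lemma G_pos:
  assumes "z \<notin> E" shows "G z > 0"
proof (rule ccontr)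
  assume "\<not> G z > 0"
  then have z: "G z = 0" using G_nonneg[OF assms] by simp
  let ?T = "{w\<in>- E. exp (- 1 * G w) = 1}"
  have "open ?T"
    using G_nonneg by (intro local_modulus_max_open[OF lm_exp_G open_compl]) auto
  then have "openin (top_of_set (- E)) ?T" by (intro open_subset) auto
  moreover have "closedin (top_of_set (- E)) ?T"
    by (intro continuous_closedin_preimage_constant continuous_intros G_continuous)
  ultimately have "?T = {} \<or> ?T = - E" using conn unfolding connected_clopen by blast
  then have T: "G w = 0" if "w \<notin> E" for w using z assms that by auto
  obtain B r where B: "B > 0" "r \<ge> 1" "\<And>z. cmod z \<ge> r \<Longrightarrow> z \<notin> E \<and> \<bar>G z - ln (cmod z)\<bar> \<le> B"
    using G_asymp by blast
  have "eventually (\<lambda>z. G z > 0) at_infinity" using G_at_top filterlim_at_top_dense by blast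
  then obtain b where b: "\<And>z. cmod z \<ge> b \<Longrightarrow> G z > 0" unfolding eventually_at_infinity by blast
  have "cmod (of_real (max b r)) \<ge> b" "cmod (of_real (max b r)) \<ge> r" by (auto simp: norm_of_real)
  then show False using b T B(3) by (metis less_irrefl)
qed

lemma poly_exp_G_bounded:
  fixes P :: "complex poly"
  assumes "degree P \<le> n"
  obtains C where "C > 0" "\<forall>\<^sub>F z in at_infinity. cmod (poly P z) * exp (- real n * G z) \<le> C"
proof -
  obtain B r where B: "B > 0" "r \<ge> 1" "\<And>z. cmod z \<ge> r \<Longrightarrow> z \<notin> E \<and> \<bar>G z - ln (cmod z)\<bar> \<le> B"
    using G_asymp by blast
  obtain C where C: "C > 0" "\<And>z. cmod z \<ge> 1 \<Longrightarrow> cmod (poly P z) \<le> C * cmod z ^ n"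
    using norm_poly_le_power[OF assms] by blast
  show ?thesis
  proof (rule that)
    show "C * exp (n * B) > 0" using C by simp
    show "\<forall>\<^sub>F z in at_infinity. cmod (poly P z) * exp (- real n * G z) \<le> C * exp (n * B)"
      unfolding eventually_at_infinity
    proof (intro exI[of _ r] allI impI)
      fix z :: complex assume z: "cmod z \<ge> r"
      have "cmod (poly P z) * exp (- real n * G z) \<le> C * cmod z ^ n * exp (- real n * G z)"
        using C(2)[of z] z B(2) by (intro mult_right_mono) auto
      also have "cmod z ^ n = exp (n * ln (cmod z))"
      proof -
        have "cmod z > 0" using z B(2) by linarith
        then show ?thesis by (simp add: exp_of_nat_mult)
      qed
      also have "C * exp (n * ln (cmod z)) * exp (- real n * G z) = C * exp (n * (ln (cmod z) - G z))"
        by (simp add: exp_diff exp_minus field_simps)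
      also have "\<dots> \<le> C * exp (n * B)"
        using C(1) B(3)[OF z] by (intro mult_left_mono) (auto simp: mult_left_mono)
      finally show "cmod (poly P z) * exp (- real n * G z) \<le> C * exp (n * B)" .
    qed
  qed
qed

lemma lm_poly_exp: "local_modulus (\<lambda>z. cmod (poly P z) * exp (c * G z)) (- E)"
  by (intro local_modulus_mult lm_exp_G local_modulus_norm holomorphic_intros open_compl)

lemma exp_G_tendsto_0: "c < 0 \<Longrightarrow> ((\<lambda>z. exp (c * G z)) \<longlongrightarrow> 0) at_infinity"
  by (intro filterlim_compose[OF exp_at_bot] filterlim_tendsto_neg_mult_at_bot[OF tendsto_const] G_at_top)

text \<open>The quotient of \<open>cmod (poly P z)\<close> by \<open>exp (n * G z)\<close> has
  limits at most t on the boundary of E, but is only known to be bounded at infinity. A further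
  factor \<open>exp (- \<epsilon> * G z)\<close> makes it tend to 0 there.\<close>

theorem Bernstein_Walsh:
  fixes P :: "complex poly"
  assumes deg: "degree P \<le> n" and t: "t > 0" and le: "\<And>z. z \<in> E \<Longrightarrow> cmod (poly P z) \<le> t" and z: "z \<notin> E"
  shows "cmod (poly P z) \<le> t * exp (n * G z)"
proof -
  have main: "cmod (poly P z) * exp (- real n * G z) * exp (- G z) powr \<epsilon> \<le> t" if \<epsilon>: "\<epsilon> > 0" for \<epsilon>
  proof -
    have "cmod (poly P z) * exp ((- real n - \<epsilon>) * G z) \<le> t"
    proof (rule local_modulus_max_principle[OF lm_poly_exp open_compl])
      fix m assume m: "t < m"
      show "compact {z \<in> - E. m \<le> cmod (poly P z) * exp ((- real n - \<epsilon>) * G z)}"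
      proof (rule compact_superlevel)
        show "continuous_on (- E) (\<lambda>z. cmod (poly P z) * exp ((- real n - \<epsilon>) * G z))"
          by (intro continuous_intros G_continuous)
        show "eventually (\<lambda>z. cmod (poly P z) * exp ((- real n - \<epsilon>) * G z) < m) (at \<zeta> within - E)"
          if \<zeta>: "\<zeta> \<in> closure (- E)" "\<zeta> \<notin> - E" for \<zeta>
        proof -
          have "((\<lambda>z. cmod (poly P z) * exp ((- real n - \<epsilon>) * G z)) \<longlongrightarrow> cmod (poly P \<zeta>) * exp ((- real n - \<epsilon>) * 0)) (at \<zeta> within - E)"
            by (intro tendsto_intros bdry_closure that)
          moreover have "cmod (poly P \<zeta>) * exp ((- real n - \<epsilon>) * 0) < m" using m le[of \<zeta>] \<zeta> by simp
          ultimately show ?thesis by (rule order_tendstoD(2))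
        qed
        obtain C where C: "C > 0" "\<forall>\<^sub>F z in at_infinity. cmod (poly P z) * exp (- real n * G z) \<le> C"
          by (rule poly_exp_G_bounded[OF deg])
        have "\<forall>\<^sub>F z in at_infinity. exp (- \<epsilon> * G z) < m / C"
          using m t C(1) \<epsilon> by (intro order_tendstoD(2)[OF exp_G_tendsto_0]) auto
        with C(2) show "eventually (\<lambda>z. z \<in> - E \<longrightarrow> cmod (poly P z) * exp ((- real n - \<epsilon>) * G z) < m) at_infinity"
        proof eventually_elim
          case (elim z)
          have "cmod (poly P z) * exp ((- real n - \<epsilon>) * G z) = (cmod (poly P z) * exp (- real n * G z)) * exp (- \<epsilon> * G z)"
            by (simp add: left_diff_distrib exp_diff exp_minus field_simps)
          also have "\<dots> \<le> C * exp (- \<epsilon> * G z)" using elim by (intro mult_right_mono) auto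
          also have "\<dots> < m" using elim C(1) by (simp add: field_simps)
          finally show ?case by simp
        qed
      qed
    qed (use z in auto)
    moreover have "exp ((- real n - \<epsilon>) * G z) = exp (- real n * G z) * exp (- G z) powr \<epsilon>"
      by (simp add: powr_def algebra_simps flip: exp_add)
    ultimately show ?thesis by (simp add: mult.assoc)
  qed
  have "cmod (poly P z) * exp (- real n * G z) \<le> t"
    by (rule le_if_mult_powr_le[OF _ main]) auto
  then show ?thesis by (simp add: exp_minus field_simps)
qed

end

section \<open>Comparison functions\<close>

text \<open>For R > 0 this quotient has modulus 1 on the circle of radius R about 0, and the
  logarithm of its modulus is the Green's function of the exterior of that circle with pole at 2 *
  R. The limit says that this Green's function equals ln 2 at infinity.\<close>

lemma ratio_tendsto_2:
  "((\<lambda>z. (2 * z - of_real R) / (z - of_real (2 * R))) \<longlongrightarrow> (2::complex)) at_infinity"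
proof -
  have "filterlim (\<lambda>z::complex. - of_real (2 * R) + z) at_infinity at_infinity"
    by (intro tendsto_add_filterlim_at_infinity[OF tendsto_const] filterlim_ident)
  then have "((\<lambda>z::complex. 2 + of_real (3 * R) / (- of_real (2 * R) + z)) \<longlongrightarrow> 2 + 0) at_infinity"
    by (intro tendsto_add tendsto_divide_0[OF tendsto_const] tendsto_const)
  moreover have "\<forall>\<^sub>F z::complex in at_infinity. 2 + of_real (3 * R) / (- of_real (2 * R) + z) = (2 * z - of_real R) / (z - of_real (2 * R))"
    using eventually_not_equal_at_infinity[of "of_real (2 * R) :: complex"]
    by eventually_elim (simp add: field_simps)
  ultimately show ?thesis by (simp add: tendsto_cong)
qed

context regular_green
begin

text \<open>In terms of \<open>w = G - ln (cmod (poly P z) / t) / n\<close>: Bernstein-Walsh gives w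
  at least 0 on the outer circle, the hypothesis gives w at least \<delta> on the inner one, and the
  logarithmic term is the harmonic function on the annulus with boundary values 0 and
  \<delta>.\<close>

lemma annulus_comparison:
  fixes P :: "complex poly"
  assumes deg: "degree P \<le> n" and t: "t > 0" and le: "\<And>z. z \<in> E \<Longrightarrow> cmod (poly P z) \<le> t"
    and R: "cball b R \<subseteq> - E" and s: "0 < s" "s < R"
    and small: "\<And>z. dist b z = s \<Longrightarrow> cmod (poly P z) \<le> t * exp (n * (G z - \<delta>))"
    and z: "s < dist b z" "dist b z < R"
  shows "cmod (poly P z) \<le> t * exp (n * (G z - \<delta> * ln (R / dist b z) / ln (R / s)))"
proof -
  \<comment> \<open>With this exponent the last factor of \<open>\<phi>\<close> is
    \<open>exp (n * \<delta>)\<close> on the inner circle and 1 on the outer one.\<close>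
  define c where "c = n * \<delta> / ln (R / s)"
  have lnpos: "ln (R / s) > 0" using s by simp
  define \<phi> where "\<phi> z = (cmod (poly P z) * exp (- real n * G z)) * cmod (of_real R / (z - b)) powr c" for z
  define U where "U = ball b R - cball b s"
  define V where "V = - E - {b}"
  have V: "open V" unfolding V_def using open_compl by (intro open_Diff) auto
  have lm: "local_modulus \<phi> V"
    unfolding \<phi>_def
  proof (rule local_modulus_mult)
    show "local_modulus (\<lambda>z. cmod (poly P z) * exp (- real n * G z)) V"
      by (rule local_modulus_subset[OF lm_poly_exp]) (auto simp: V_def)
    show "local_modulus (\<lambda>z. cmod (of_real R / (z - b)) powr c) V"
      by (rule local_modulus_norm_powr[OF _ V]) (use s in \<open>auto simp: V_def intro!: holomorphic_intros\<close>)
  qed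
  have cl: "closure U \<subseteq> {z. s \<le> dist b z \<and> dist b z \<le> R}"
  proof (rule closure_minimal)
    show "closed {z. s \<le> dist b z \<and> dist b z \<le> R}"
      by (intro closed_Collect_conj closed_Collect_le continuous_intros)
  qed (auto simp: U_def)
  have \<phi>_eq: "\<phi> z = cmod (poly P z) * exp (- real n * G z) * exp (c * ln (R / dist b z))" if "s \<le> dist b z" for z
  proof -
    have "dist b z > 0" using s that by linarith
    moreover have "cmod (of_real R / (z - b)) = R / dist b z"
      using s by (simp add: norm_divide dist_norm norm_minus_commute)
    ultimately show ?thesis using s by (simp add: \<phi>_def powr_def)
  qed
  have "\<phi> z \<le> t"
  proof (rule local_modulus_max_bounded[OF lm V])
    show "open U" unfolding U_def by (intro open_Diff) auto
    show "bounded U" unfolding U_def by (rule bounded_subset[OF bounded_ball]) auto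
    show "closure U \<subseteq> V" using cl R s by (fastforce simp: V_def)
    show "z \<in> U" using z by (auto simp: U_def)
    fix w assume w: "w \<in> closure U" "w \<notin> U"
    then have ws: "s \<le> dist b w" "dist b w \<le> R" using cl by auto
    have "w \<in> cball b R" using ws by simp
    then have wE: "w \<notin> E" using R by blast
    from ws w(2) consider "dist b w = s" | "dist b w = R" by (auto simp: U_def)
    then show "\<phi> w \<le> t"
    proof cases
      case 1
      have "\<phi> w \<le> t * exp (n * (G w - \<delta>)) * exp (- real n * G w) * exp (c * ln (R / s))"
        unfolding \<phi>_eq[OF ws(1)] using small[OF 1] by (simp add: 1 mult_right_mono)
      also have "\<dots> = t"
        using lnpos by (simp add: c_def mult.assoc right_diff_distrib flip: exp_add)
      finally show ?thesis .
    next
      case 2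
      have "\<phi> w = cmod (poly P w) * exp (- real n * G w)" unfolding \<phi>_eq[OF ws(1)] using 2 s by simp
      also have "\<dots> \<le> t * exp (n * G w) * exp (- real n * G w)"
        by (intro mult_right_mono Bernstein_Walsh[OF deg t le wE]) auto
      also have "\<dots> = t" by (simp add: mult.assoc flip: exp_add)
      finally show ?thesis .
    qed
  qed
  then have "cmod (poly P z) * exp (- real n * G z + c * ln (R / dist b z)) \<le> t"
    using \<phi>_eq[OF less_imp_le[OF z(1)]] by (simp only: exp_add mult.assoc)
  then have "cmod (poly P z) * exp (- real n * G z + c * ln (R / dist b z)) * exp (- (- real n * G z + c * ln (R / dist b z)))
      \<le> t * exp (- (- real n * G z + c * ln (R / dist b z)))"
    by (rule mult_right_mono) simp
  then show ?thesis
    by (simp add: mult.assoc c_def right_diff_distrib mult.left_commute flip: exp_add)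
qed

text \<open>The counterpart of \<open>annulus_comparison\<close> that reaches infinity: a gap
  \<delta> on a small circle around 2 * R is carried along the Green's function of the exterior of
  \<open>cball 0 R\<close> with pole at 2 * R.\<close>

lemma exterior_comparison:
  fixes P :: "complex poly"
  assumes deg: "degree P \<le> n" and t: "t > 0" and le: "\<And>z. z \<in> E \<Longrightarrow> cmod (poly P z) \<le> t"
    and R: "E \<subseteq> ball 0 R" and s: "0 < s" "s < R" and \<delta>: "\<delta> \<ge> 0"
    and small: "\<And>z. dist (of_real (2 * R)) z = s \<Longrightarrow> cmod (poly P z) \<le> t * exp (n * (G z - \<delta>))"
    and z: "cmod z > R" "dist (of_real (2 * R)) z > s"
  shows "cmod (poly P z) * exp (- real n * G z)
    * cmod ((2 * z - of_real R) / (z - of_real (2 * R))) powr (n * \<delta> / ln (5 * R / s)) \<le> t"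
proof -
  define c where "c = n * \<delta> / ln (5 * R / s)"
  have Rpos: "R > 0" using s by simp
  have lnpos: "ln (5 * R / s) > 0" using s by simp
  have c: "c \<ge> 0" using lnpos \<delta> by (simp add: c_def)
  define \<psi> where "\<psi> z = cmod (poly P z) * exp (- real n * G z)
    * cmod ((2 * z - of_real R) / (z - of_real (2 * R))) powr c" for z
  define U :: "complex set" where "U = - cball 0 R - cball (of_real (2 * R)) s"
  define V where "V = - E - {0, of_real (2 * R), of_real (R / 2)}"
  have V: "open V" unfolding V_def using open_compl by (intro open_Diff) auto
  have U: "open U" unfolding U_def by (intro open_Diff) (auto simp: closed_Compl)
  have UV: "closure U \<subseteq> {z. R \<le> cmod z \<and> s \<le> dist (of_real (2 * R)) z}"
  proof (rule closure_minimal)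
    show "closed {z::complex. R \<le> cmod z \<and> s \<le> dist (of_real (2 * R)) z}"
      by (intro closed_Collect_conj closed_Collect_le continuous_intros)
  qed (auto simp: U_def)
  have inV: "w \<in> V" if "w \<in> closure U" for w
  proof -
    have w: "R \<le> cmod w" "s \<le> dist (of_real (2 * R)) w" using UV that by auto
    have "w \<notin> E" using w R by force
    moreover have "w \<noteq> of_real (R / 2)"
      using w(1) Rpos by (metis abs_of_pos field_sum_of_halves half_gt_zero less_add_same_cancel1 not_le norm_of_real)
    ultimately show ?thesis using w Rpos s by (auto simp: V_def)
  qed
  have "\<psi> z * (R / cmod z) powr \<epsilon> \<le> t" if \<epsilon>: "\<epsilon> > 0" for \<epsilon>
  proof -
    \<comment> \<open>The added factor forces decay at infinity and is at most 1 on
      \<open>closure U\<close>.\<close>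
    define \<phi> where "\<phi> z = \<psi> z * cmod (of_real R / z) powr \<epsilon>" for z
    have lm: "local_modulus \<phi> V"
      unfolding \<phi>_def \<psi>_def
    proof (intro local_modulus_mult local_modulus_norm_powr[OF _ V])
      show "local_modulus (\<lambda>z. cmod (poly P z)) V"
        by (intro local_modulus_norm holomorphic_intros V)
      show "local_modulus (\<lambda>z. exp (- real n * G z)) V"
        by (rule local_modulus_subset[OF lm_exp_G]) (auto simp: V_def)
      show "(\<lambda>z. (2 * z - complex_of_real R) / (z - complex_of_real (2 * R))) holomorphic_on V"
        "(\<lambda>z. complex_of_real R / z) holomorphic_on V"
        by (auto simp: V_def intro!: holomorphic_intros)
      show "(2 * z - complex_of_real R) / (z - complex_of_real (2 * R)) \<noteq> 0" if "z \<in> V" for z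
        using that by (auto simp: V_def mult.commute)
      show "complex_of_real R / z \<noteq> 0" if "z \<in> V" for z
        using that Rpos by (auto simp: V_def)
    qed
    have cont: "continuous_on V \<phi>" using lm V by (rule local_modulus_continuous)
    have "\<phi> z \<le> t"
    proof (rule local_modulus_max_principle[OF local_modulus_subset[OF lm] U])
      show "U \<subseteq> V" using inV closure_subset by blast
      show "z \<in> U" using z by (auto simp: U_def)
      fix m assume m: "t < m"
      show "compact {z \<in> U. m \<le> \<phi> z}"
      proof (rule compact_superlevel)
        show "continuous_on U \<phi>" using cont inV closure_subset by (meson continuous_on_subset subset_iff)
        show "eventually (\<lambda>z. \<phi> z < m) (at w within U)" if w: "w \<in> closure U" "w \<notin> U" for w
        proof -
          have wV: "w \<in> V" using inV w by blast
          then have wE: "w \<notin> E" by (auto simp: V_def)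
          have ws: "R \<le> cmod w" "s \<le> dist (of_real (2 * R)) w" using UV w by auto
          have w0: "cmod w > 0" using ws Rpos by linarith
          have eps: "cmod (of_real R / w) powr \<epsilon> \<le> 1"
            using ws w0 Rpos \<epsilon> by (intro powr_le1) (auto simp: norm_divide)
          have "\<psi> w \<le> t"
          proof -
            from w(2) ws consider "cmod w = R" | "dist (of_real (2 * R)) w = s" by (auto simp: U_def)
            then show ?thesis
            proof cases
              case 1
              have "cmod (2 * w - of_real R) ^ 2 = cmod (w - of_real (2 * R)) ^ 2"
                using 1 unfolding cmod_power2 by (auto simp: cmod_def power2_eq_square algebra_simps)
              then have eq: "cmod (2 * w - of_real R) = cmod (w - of_real (2 * R))"
                by (simp add: power2_eq_iff_nonneg)
              have "w - of_real (2 * R) \<noteq> 0" using wV by (auto simp: V_def)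
              then have "\<psi> w = cmod (poly P w) * exp (- real n * G w)"
                using eq by (simp add: \<psi>_def norm_divide)
              also have "\<dots> \<le> t * exp (n * G w) * exp (- real n * G w)"
                by (intro mult_right_mono Bernstein_Walsh[OF deg t le wE]) auto
              also have "\<dots> = t" by (simp add: mult.assoc flip: exp_add)
              finally show ?thesis .
            next
              case 2
              have s': "cmod (w - of_real (2 * R)) = s" using 2 by (simp add: dist_norm norm_minus_commute)
              \<comment> \<open>This bounds the numerator by \<open>2 * s + 3 * R\<close>, hence by
                \<open>5 * R\<close>, which is the origin of the constant in c.\<close>
              have "2 * w - of_real R = 2 * (w - of_real (2 * R)) + of_real (3 * R)" by simp
              then have "cmod (2 * w - of_real R) \<le> cmod (2 * (w - of_real (2 * R))) + cmod (of_real (3 * R))"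
                by (metis norm_triangle_ineq)
              also have "\<dots> = 2 * s + 3 * R" using s' Rpos by (simp only: norm_mult norm_of_real) simp
              finally have "cmod (2 * w - of_real R) \<le> 2 * s + 3 * R" .
              then have "cmod ((2 * w - of_real R) / (w - of_real (2 * R))) \<le> 5 * R / s"
                using s s' by (simp add: norm_divide divide_right_mono)
              then have "cmod ((2 * w - of_real R) / (w - of_real (2 * R))) powr c \<le> (5 * R / s) powr c"
                using c by (intro powr_mono2) auto
              also have "\<dots> = exp (n * \<delta>)"
                using s lnpos by (simp add: powr_def c_def)
              finally have "\<psi> w \<le> t * exp (n * (G w - \<delta>)) * exp (- real n * G w) * exp (n * \<delta>)"
                unfolding \<psi>_def using small[OF 2] t by (intro mult_mono) auto
              also have "\<dots> = t" by (simp add: mult.assoc right_diff_distrib flip: exp_add)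
              finally show ?thesis .
            qed
          qed
          moreover have "\<psi> w \<ge> 0" by (simp add: \<psi>_def)
          ultimately have "\<phi> w \<le> t"
            unfolding \<phi>_def using mult_mono[OF \<open>\<psi> w \<le> t\<close> eps] t by simp
          moreover have "isCont \<phi> w" using cont V wV by (meson continuous_on_eq_continuous_at)
          then have "(\<phi> \<longlongrightarrow> \<phi> w) (at w within U)"
            using continuous_at_imp_continuous_at_within continuous_within by blast
          ultimately show ?thesis using m by (intro order_tendstoD(2)[of \<phi> "\<phi> w"]) auto
        qed
        obtain C where C: "C > 0" "\<forall>\<^sub>F z in at_infinity. cmod (poly P z) * exp (- real n * G z) \<le> C"
          by (rule poly_exp_G_bounded[OF deg])
        have "((\<lambda>z. (2 * z - of_real R) / (z - of_real (2 * R))) \<longlongrightarrow> (2::complex)) at_infinity"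
          by (rule ratio_tendsto_2)
        then have "((\<lambda>z. cmod ((2 * z - of_real R) / (z - of_real (2 * R)))) \<longlongrightarrow> cmod 2) at_infinity"
          by (rule tendsto_norm)
        then have ev1: "\<forall>\<^sub>F z in at_infinity. cmod ((2 * z - of_real R) / (z - of_real (2 * R))) < 3"
          by (rule order_tendstoD(2)) simp
        have "((\<lambda>z::complex. R / cmod z) \<longlongrightarrow> 0) at_infinity"
          by (intro real_tendsto_divide_at_top[OF tendsto_const] filterlim_norm_at_top)
        then have "((\<lambda>z::complex. (R / cmod z) powr \<epsilon>) \<longlongrightarrow> 0) at_infinity"
          using \<epsilon> Rpos by (intro tendsto_zero_powrI[where b=\<epsilon>] always_eventually) auto
        then have ev2: "\<forall>\<^sub>F z::complex in at_infinity. (R / cmod z) powr \<epsilon> < m / (C * 3 powr c)"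
          using C(1) m t by (intro order_tendstoD(2)) auto
        show "\<forall>\<^sub>F z in at_infinity. z \<in> U \<longrightarrow> \<phi> z < m"
          using C(2) ev1 ev2
        proof eventually_elim
          case (elim z)
          have "\<psi> z \<le> C * 3 powr c"
            unfolding \<psi>_def using elim c C(1) by (intro mult_mono powr_mono2) auto
          then have "\<phi> z \<le> C * 3 powr c * (R / cmod z) powr \<epsilon>"
            unfolding \<phi>_def using Rpos C(1) by (intro mult_mono) (auto simp: norm_divide)
          also have "\<dots> < m" using elim(3) C(1) by (simp add: field_simps)
          finally show ?case by simp
        qed
      qed
    qed
    then show ?thesis using Rpos by (simp add: \<phi>_def norm_divide)
  qed
  moreover have "R / cmod z > 0" using Rpos z(1) by (intro divide_pos_pos) linarith+
  ultimately have "\<psi> z \<le> t" using le_if_mult_powr_le[of "R / cmod z" "\<psi> z" t] by blast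
  then show ?thesis by (simp add: \<psi>_def c_def)
qed

end

section \<open>Asymptotically extremal polynomials\<close>

lemma monic_poly_ratio_tendsto_1:
  fixes P :: "complex poly"
  assumes "degree P = n" "lead_coeff P = 1"
  shows "((\<lambda>z. cmod (poly P z) / cmod z ^ n) \<longlongrightarrow> 1) at_infinity"
proof (cases "n = 0")
  case True
  then obtain c where "P = [:c:]" using assms by (metis degree_eq_zeroE)
  then show ?thesis using assms True by simp
next
  case False
  define Q where "Q = P - monom 1 n"
  have "degree Q \<le> n"
    unfolding Q_def using assms by (intro degree_diff_le) (auto simp: degree_monom_le)
  moreover have "coeff Q n = 0" using assms by (simp add: Q_def)
  ultimately have "degree Q < n"
    using False by (metis coeff_0_degree_minus_1 diff_less eq_zero_or_degree_less gr0I le_neq_implies_less zero_less_one leading_coeff_0_iff degree_0)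
  then have dQ: "degree Q \<le> n - 1" by simp
  obtain C where C: "C > 0" "\<And>z. cmod z \<ge> 1 \<Longrightarrow> cmod (poly Q z) \<le> C * cmod z ^ (n - 1)"
    using norm_poly_le_power[OF dQ] by blast
  have P: "poly P z = poly Q z + z ^ n" for z by (simp add: Q_def poly_monom)
  have "((\<lambda>z. poly Q z / z ^ n) \<longlongrightarrow> 0) at_infinity"
  proof (rule Lim_null_comparison)
    show "((\<lambda>z::complex. C / cmod z) \<longlongrightarrow> 0) at_infinity"
      by (intro real_tendsto_divide_at_top[OF tendsto_const] filterlim_norm_at_top)
    show "\<forall>\<^sub>F z in at_infinity. cmod (poly Q z / z ^ n) \<le> C / cmod z"
      unfolding eventually_at_infinity
    proof (intro exI[of _ 1] allI impI)
      fix z :: complex assume z: "1 \<le> cmod z"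
      then have "cmod z > 0" by linarith
      moreover have "cmod z ^ n = cmod z * cmod z ^ (n - 1)" using False by (simp flip: power_Suc)
      ultimately show "cmod (poly Q z / z ^ n) \<le> C / cmod z"
        using C(2)[OF z] by (simp add: norm_divide norm_power field_simps)
    qed
  qed
  then have "((\<lambda>z. cmod (poly Q z / z ^ n + 1)) \<longlongrightarrow> cmod (0 + 1)) at_infinity"
    by (intro tendsto_intros)
  moreover have "\<forall>\<^sub>F z in at_infinity. cmod (poly Q z / z ^ n + 1) = cmod (poly P z) / cmod z ^ n"
    using eventually_not_equal_at_infinity[of "0::complex"]
  proof eventually_elim
    case (elim z)
    then have "poly Q z / z ^ n + 1 = poly P z / z ^ n" by (simp add: P field_simps)
    then show ?case by (simp add: norm_divide norm_power)
  qed
  ultimately show ?thesis by (simp add: tendsto_cong)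
qed

context regular_green
begin

text \<open>Let z tend to infinity in \<open>exterior_comparison\<close>: P behaves like the n-th
  power of z, the quotient has modulus close to 2, and \<open>ln (cmod z) - G z\<close> exceeds
  \<kappa>. A gap near 2 * R thus lifts the lower bound \<kappa> for \<open>ln t / n\<close> by an
  amount that depends on neither n nor P.\<close>

lemma exterior_comparison_at_infinity:
  fixes P :: "complex poly"
  assumes deg: "degree P = n" "lead_coeff P = 1" and n: "n > 0"
    and t: "t > 0" and le: "\<And>z. z \<in> E \<Longrightarrow> cmod (poly P z) \<le> t"
    and R: "E \<subseteq> ball 0 R" and s: "0 < s" "s < R" and \<delta>: "\<delta> \<ge> 0"
    and small: "\<And>z. dist (of_real (2 * R)) z = s \<Longrightarrow> cmod (poly P z) \<le> t * exp (n * (G z - \<delta>))"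
    and \<kappa>: "\<forall>\<^sub>F z in at_infinity. \<kappa> < ln (cmod z) - G z"
  shows "\<kappa> + \<delta> / ln (5 * R / s) * ln 2 \<le> ln t / n"
proof -
  define c where "c = \<delta> / ln (5 * R / s)"
  let ?q = "\<lambda>z. cmod ((2 * z - of_real R) / (z - of_real (2 * R)))"
  have q: "(?q \<longlongrightarrow> cmod 2) at_infinity"
    by (intro tendsto_norm ratio_tendsto_2)
  have r: "((\<lambda>z. cmod (poly P z) / cmod z ^ n) \<longlongrightarrow> 1) at_infinity"
    by (rule monic_poly_ratio_tendsto_1[OF deg])
  have "((\<lambda>z. n * \<kappa> + ln (cmod (poly P z) / cmod z ^ n) + n * c * ln (?q z))
      \<longlongrightarrow> n * \<kappa> + ln 1 + n * c * ln (cmod 2)) at_infinity"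
    by (intro tendsto_intros r q) auto
  moreover have "\<forall>\<^sub>F z in at_infinity. n * \<kappa> + ln (cmod (poly P z) / cmod z ^ n) + n * c * ln (?q z) \<le> ln t"
  proof -
    have 1: "\<forall>\<^sub>F z in at_infinity. 0 < cmod (poly P z) / cmod z ^ n"
      by (rule order_tendstoD(1)[OF r]) simp
    have 2: "\<forall>\<^sub>F z in at_infinity. 0 < ?q z"
      by (rule order_tendstoD(1)[OF q]) simp
    have 3: "\<forall>\<^sub>F z::complex in at_infinity. cmod z > 4 * R"
      using filterlim_norm_at_top filterlim_at_top_dense by blast
    show ?thesis
      using \<kappa> 1 2 3
    proof eventually_elim
      case (elim z)
      have Rpos: "R > 0" using s by simp
      have d: "dist (of_real (2 * R)) z > s"
        using elim(4) s norm_triangle_ineq2[of z "of_real (2 * R)"] Rpos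
        by (simp add: dist_norm norm_minus_commute del: of_real_mult)
      have pz: "cmod (poly P z) > 0" "cmod z > 0"
        using elim(2,4) Rpos by (auto simp: zero_less_divide_iff)
      have "cmod (poly P z) * exp (- real n * G z) * ?q z powr (n * \<delta> / ln (5 * R / s)) \<le> t"
        using elim Rpos by (intro exterior_comparison[OF _ t le R s \<delta> small _ d]) (auto simp: deg)
      then have "ln (cmod (poly P z) * exp (- real n * G z) * ?q z powr (n * c)) \<le> ln t"
        using pz elim(3) t by (subst ln_le_cancel_iff) (auto simp: c_def)
      moreover have "ln (cmod (poly P z) * exp (- real n * G z) * ?q z powr (n * c))
          = ln (cmod (poly P z)) - n * G z + n * c * ln (?q z)"
        using pz elim(3) by (simp add: ln_mult)
      moreover have "ln (cmod (poly P z) / cmod z ^ n) = ln (cmod (poly P z)) - n * ln (cmod z)"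
        using pz by (simp add: ln_div ln_realpow)
      moreover have "n * \<kappa> \<le> n * (ln (cmod z) - G z)"
        using elim(1) by (intro mult_left_mono) auto
      ultimately show ?case by (simp add: right_diff_distrib)
    qed
  qed
  ultimately have "n * \<kappa> + ln 1 + n * c * ln (cmod 2) \<le> ln t"
    by (rule tendsto_upperbound) (rule trivial_limit_at_infinity)
  then have "n * (\<kappa> + c * ln 2) \<le> ln t" by (simp add: algebra_simps)
  then show ?thesis using n by (simp add: c_def pos_le_divide_eq mult.commute)
qed

end

text \<open>\<open>\<kappa>\<close> plays the role of the logarithm of the capacity of \<open>E\<close>.\<close>

locale asymptotically_extremal = regular_green +
  fixes T :: "nat \<Rightarrow> complex poly" and t :: "nat \<Rightarrow> real" and \<kappa> :: real
  assumes T_deg: "degree (T n) = n" and T_monic: "lead_coeff (T n) = 1"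
    and t_pos: "t n > 0" and T_le: "z \<in> E \<Longrightarrow> cmod (poly (T n) z) \<le> t n"
    and \<kappa>_le: "\<eta> > 0 \<Longrightarrow> \<forall>\<^sub>F z in at_infinity. \<kappa> - \<eta> < ln (cmod z) - G z"
    and t_asymp: "\<eta> > 0 \<Longrightarrow> \<forall>\<^sub>F n in sequentially. ln (t n) / n < \<kappa> + \<eta>"
begin

text \<open>Says that \<open>w n\<close> becomes small at points close to z; at z itself this may
  fail because of zeros of \<open>T n\<close>. One \<epsilon> serves as radius and as gap, so the
  negation is a gap on a whole ball for infinitely many n, which is what the comparison lemmas take
  as input.\<close>

definition near_maximal :: "complex \<Rightarrow> bool" where
  "near_maximal z \<longleftrightarrow> (\<forall>\<epsilon>>0. \<forall>\<^sub>F n in sequentially.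
     \<exists>y\<in>ball z \<epsilon>. cmod (poly (T n) y) > t n * exp (n * (G y - \<epsilon>)))"

lemma not_near_maximal:
  "\<not> near_maximal z \<longleftrightarrow> (\<exists>\<epsilon>>0. \<exists>\<^sub>F n in sequentially.
     \<forall>y\<in>ball z \<epsilon>. cmod (poly (T n) y) \<le> t n * exp (n * (G y - \<epsilon>)))"
  unfolding near_maximal_def frequently_def by (auto simp: not_le)

lemma near_maximal_far:
  assumes R: "E \<subseteq> ball 0 R" "R > 0"
  shows "near_maximal (of_real (2 * R))"
proof (rule ccontr)
  assume "\<not> near_maximal (of_real (2 * R))"
  then obtain \<epsilon> where \<epsilon>: "\<epsilon> > 0"
    and fr: "\<exists>\<^sub>F n in sequentially. \<forall>y\<in>ball (of_real (2 * R)) \<epsilon>. cmod (poly (T n) y) \<le> t n * exp (n * (G y - \<epsilon>))"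
    unfolding not_near_maximal by blast
  define s where "s = min \<epsilon> R / 2"
  have s: "0 < s" "s < R" "s < \<epsilon>" using \<epsilon> R by (auto simp: s_def)
  \<comment> \<open>The lift provided by \<open>exterior_comparison_at_infinity\<close>. Using
    \<open>\<kappa>_le\<close> and \<open>t_asymp\<close> with half of it each leaves no room for a
    gap.\<close>
  define \<eta> where "\<eta> = \<epsilon> / ln (5 * R / s) * ln 2"
  have \<eta>: "\<eta> > 0" using \<epsilon> s by (auto simp: \<eta>_def)
  have ev: "\<forall>\<^sub>F n in sequentially. n > 0 \<and> ln (t n) / n < \<kappa> + \<eta> / 2"
    using t_asymp[of "\<eta> / 2"] \<eta> eventually_gt_at_top[of 0] by (auto intro: eventually_conj)
  obtain n where n: "n > 0" "ln (t n) / n < \<kappa> + \<eta> / 2"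
    and sm: "\<forall>y\<in>ball (of_real (2 * R)) \<epsilon>. cmod (poly (T n) y) \<le> t n * exp (n * (G y - \<epsilon>))"
    using frequently_ex[OF frequently_eventually_conj[OF fr ev]] by blast
  have "(\<kappa> - \<eta> / 2) + \<epsilon> / ln (5 * R / s) * ln 2 \<le> ln (t n) / n"
    by (rule exterior_comparison_at_infinity[OF T_deg T_monic n(1) t_pos T_le R(1) s(1,2) _ _ \<kappa>_le])
      (use \<epsilon> \<eta> sm s in auto)
  then show False using n(2) by (simp add: \<eta>_def)
qed

text \<open>By contraposition: a gap on a ball around b spreads over an annulus centred at b to a
  smaller gap on a ball around a. The bound R1 / 3 leaves room for such an annulus that contains a
  and stays in the complement of E.\<close>

lemma near_maximal_nearby:
  assumes a: "near_maximal a" and R1: "cball a R1 \<subseteq> - E" and ab: "dist a b < R1 / 3"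
  shows "near_maximal b"
proof (rule ccontr)
  assume nb: "\<not> near_maximal b"
  then obtain \<epsilon> where \<epsilon>: "\<epsilon> > 0"
    and fr: "\<exists>\<^sub>F n in sequentially. \<forall>y\<in>ball b \<epsilon>. cmod (poly (T n) y) \<le> t n * exp (n * (G y - \<epsilon>))"
    unfolding not_near_maximal by blast
  define d where "d = dist a b"
  have d: "d > 0" using nb a by (auto simp: d_def)
  have R1pos: "R1 > 0" using ab zero_le_dist[of a b] by linarith
  define R where "R = 2 * R1 / 3"
  define s where "s = min \<epsilon> d / 2"
  have s: "0 < s" "s < \<epsilon>" "s \<le> d / 2" "s < R" "d < R / 2" using \<epsilon> d ab R1pos by (auto simp: s_def R_def d_def min_def)
  have "cball b R \<subseteq> cball a R1" using ab by (simp add: R_def cball_subset_cball_iff dist_commute)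
  then have bR: "cball b R \<subseteq> - E" using R1 by blast
  \<comment> \<open>Points within d / 2 of a have distance between s and 3 * R / 4 from b, so the
    logarithm in \<open>annulus_comparison\<close> is at least \<open>ln (4 / 3)\<close>.\<close>
  define \<eta> where "\<eta> = min (d / 2) (\<epsilon> * ln (4 / 3) / ln (R / s))"
  have lnpos: "ln (R / s) > 0" using s by simp
  have \<eta>: "\<eta> > 0" using d \<epsilon> lnpos by (simp add: \<eta>_def)
  have imp: "\<forall>y\<in>ball a \<eta>. cmod (poly (T n) y) \<le> t n * exp (n * (G y - \<eta>))"
    if n: "\<forall>y\<in>ball b \<epsilon>. cmod (poly (T n) y) \<le> t n * exp (n * (G y - \<epsilon>))" for n
  proof
    fix y assume "y \<in> ball a \<eta>"
    then have y: "dist a y < d / 2" by (simp add: \<eta>_def)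
    have y1: "s < dist b y" using y s dist_triangle[of a b y] by (simp add: d_def dist_commute)
    have y2: "dist b y < 3 * R / 4" using y s dist_triangle[of b y a] by (simp add: d_def dist_commute)
    have "cmod (poly (T n) y) \<le> t n * exp (n * (G y - \<epsilon> * ln (R / dist b y) / ln (R / s)))"
      by (rule annulus_comparison[OF _ t_pos T_le bR s(1,4)]) (use n s y1 y2 in \<open>auto simp: T_deg\<close>)
    also have "\<dots> \<le> t n * exp (n * (G y - \<eta>))"
    proof -
      have "dist b y > 0" using y1 s(1) by linarith
      then have "4 / 3 \<le> R / dist b y" using y2 by (simp add: field_simps)
      then have "ln (4 / 3) \<le> ln (R / dist b y)" by (intro ln_mono) auto
      then have "\<epsilon> * ln (4 / 3) / ln (R / s) \<le> \<epsilon> * ln (R / dist b y) / ln (R / s)"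
        using \<epsilon> lnpos by (intro divide_right_mono mult_left_mono) auto
      then have "\<eta> \<le> \<epsilon> * ln (R / dist b y) / ln (R / s)" unfolding \<eta>_def by linarith
      then show ?thesis using t_pos[of n] by (simp add: mult_left_mono)
    qed
    finally show "cmod (poly (T n) y) \<le> t n * exp (n * (G y - \<eta>))" .
  qed
  then have "\<exists>\<^sub>F n in sequentially. \<forall>y\<in>ball a \<eta>. cmod (poly (T n) y) \<le> t n * exp (n * (G y - \<eta>))"
    by (intro frequently_mono[OF _ fr] allI impI)
  then show False using a \<eta> not_near_maximal by blast
qed

lemma not_near_maximal_nearby:
  assumes \<epsilon>: "\<epsilon> > 0" and fr: "\<exists>\<^sub>F n in sequentially. \<forall>y\<in>ball z \<epsilon>. cmod (poly (T n) y) \<le> t n * exp (n * (G y - \<epsilon>))"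
    and w: "w \<in> ball z (\<epsilon> / 2)"
  shows "\<not> near_maximal w"
  unfolding not_near_maximal
proof (intro exI[of _ "\<epsilon> / 2"] conjI)
  have sub: "ball w (\<epsilon> / 2) \<subseteq> ball z \<epsilon>" using w by (simp add: ball_subset_ball_iff dist_commute)
  show "\<exists>\<^sub>F n in sequentially. \<forall>y\<in>ball w (\<epsilon> / 2). cmod (poly (T n) y) \<le> t n * exp (n * (G y - \<epsilon> / 2))"
    using fr
  proof (rule frequently_mono[rotated], intro allI impI ballI)
    fix n y assume n: "\<forall>y\<in>ball z \<epsilon>. cmod (poly (T n) y) \<le> t n * exp (n * (G y - \<epsilon>))" and y: "y \<in> ball w (\<epsilon> / 2)"
    have "cmod (poly (T n) y) \<le> t n * exp (n * (G y - \<epsilon>))" using n y sub by blast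
    also have "\<dots> \<le> t n * exp (n * (G y - \<epsilon> / 2))"
      using t_pos[of n] \<epsilon> by (simp add: mult_left_mono)
    finally show "cmod (poly (T n) y) \<le> t n * exp (n * (G y - \<epsilon> / 2))" .
  qed
qed (use \<epsilon> in simp)

text \<open>Near maximality and its failure are both open conditions in the connected complement of
  E, and the former holds at a far point.\<close>

theorem near_maximal_outside:
  assumes "z \<notin> E" shows "near_maximal z"
proof (rule ccontr)
  assume z: "\<not> near_maximal z"
  define A where "A = {z\<in>- E. near_maximal z}"
  define B where "B = {z\<in>- E. \<not> near_maximal z}"
  have "open A"
    unfolding open_contains_ball
  proof
    fix a assume "a \<in> A"
    then have a: "a \<in> - E" "near_maximal a" by (auto simp: A_def)
    then obtain R1 where R1: "R1 > 0" "cball a R1 \<subseteq> - E" using open_compl open_contains_cball by blast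
    have "b \<in> A" if "b \<in> ball a (R1 / 3)" for b
    proof -
      have "b \<in> cball a R1" using that R1(1) by auto
      then show ?thesis using near_maximal_nearby[OF a(2) R1(2), of b] R1(2) that unfolding A_def by auto
    qed
    then show "\<exists>e>0. ball a e \<subseteq> A" using R1 by (intro exI[of _ "R1 / 3"]) auto
  qed
  moreover have "open B"
    unfolding open_contains_ball
  proof
    fix a assume a: "a \<in> B"
    then obtain \<epsilon> where \<epsilon>: "\<epsilon> > 0" "\<exists>\<^sub>F n in sequentially. \<forall>y\<in>ball a \<epsilon>. cmod (poly (T n) y) \<le> t n * exp (n * (G y - \<epsilon>))"
      unfolding B_def using not_near_maximal by auto
    obtain r where r: "r > 0" "ball a r \<subseteq> - E" using a open_compl open_contains_ball unfolding B_def by blast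
    have "ball a (min r (\<epsilon> / 2)) \<subseteq> B"
      using not_near_maximal_nearby[OF \<epsilon>] r by (auto simp: B_def)
    then show "\<exists>e>0. ball a e \<subseteq> B" using r \<epsilon> by (intro exI[of _ "min r (\<epsilon> / 2)"]) auto
  qed
  ultimately have "A \<inter> - E = {} \<or> B \<inter> - E = {}"
    using conn by (intro connectedD) (auto simp: A_def B_def)
  moreover have "z \<in> B" using z assms by (simp add: B_def)
  ultimately have "A = {}" by (auto simp: A_def B_def)
  moreover obtain R where R: "R > 0" "E \<subseteq> ball 0 R"
    using compact_E bounded_subset_ballD[of E 0] compact_imp_bounded by blast
  then have "of_real (2 * R) \<in> A"
    using near_maximal_far[OF R(2,1)] R by (auto simp: A_def simp del: of_real_mult)
  ultimately show False by blast
qed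

end

section \<open>Existence and uniqueness of Chebyshev polynomials\<close>

lemma sup_norm_on_upper:
  assumes "compact E" "continuous_on E f" "z \<in> E"
  shows "cmod (f z) \<le> sup_norm_on E f"
proof -
  have "bounded ((\<lambda>z. cmod (f z)) ` E)"
    using assms by (intro compact_imp_bounded compact_continuous_image continuous_intros)
  then show ?thesis unfolding sup_norm_on_def
    using assms(3) by (intro cSUP_upper bounded_imp_bdd_above)
qed

lemma sup_norm_on_least: "E \<noteq> {} \<Longrightarrow> (\<And>z. z \<in> E \<Longrightarrow> cmod (f z) \<le> M) \<Longrightarrow> sup_norm_on E f \<le> M"
  unfolding sup_norm_on_def by (rule cSUP_least)

lemma monic_poly_roots:
  fixes P :: "complex poly"
  assumes "degree P = n" "lead_coeff P = 1"
  obtains r where "P = (\<Prod>i<n. [:- r i, 1:])"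
proof -
  obtain xs where xs: "mset xs = proots P" using ex_mset by blast
  have len: "length xs = n" using size_proots_complex[of P] assms xs by (metis size_mset)
  have "P = prod_mset (image_mset (\<lambda>x. [:- x, 1:]) (mset xs))"
    using complex_poly_decompose_multiset[of P] assms xs by simp
  also have "\<dots> = prod_list (map (\<lambda>x. [:- x, 1:]) xs)"
    by (metis mset_map prod_mset_prod_list)
  also have "\<dots> = (\<Prod>i<n. [:- (xs ! i), 1:])"
    by (subst prod.list_conv_set_nth) (simp add: len atLeast0LessThan)
  finally show ?thesis by (rule that)
qed

lemma prod_linear_degree:
  "degree (\<Prod>i<n. [:- r i, 1::complex:]) = n" "lead_coeff (\<Prod>i<n. [:- r i, 1::complex:]) = 1"
proof -
  show "degree (\<Prod>i<n. [:- r i, 1::complex:]) = n"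
    by (subst degree_prod_sum_eq) auto
  show "lead_coeff (\<Prod>i<n. [:- r i, 1::complex:]) = 1"
    by (simp only: lead_coeff_prod) simp
qed

text \<open>Compactness is sought for the roots: a root of modulus above 2 * R is farther from every
  point of E than 0 is, so replacing it by 0 does not increase the norm, and a minimizing sequence
  can be taken with bounded roots.\<close>

lemma chebyshev_poly_exists:
  assumes E: "compact E" "E \<noteq> {}"
  shows "\<exists>T. is_chebyshev_poly E n T"
proof -
  define m where "m = (INF P\<in>{P. degree P = n \<and> lead_coeff P = 1}. sup_norm_on E (poly P))"
  let ?M = "{P :: complex poly. degree P = n \<and> lead_coeff P = 1}"
  have cont: "continuous_on E (poly P)" for P :: "complex poly" by (intro continuous_intros)
  obtain z0 where z0: "z0 \<in> E" using E by blast
  have "sup_norm_on E (poly P) \<ge> 0" for P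
    using sup_norm_on_upper[OF E(1) cont z0, of P] norm_ge_zero order_trans by blast
  then have bdd: "bdd_below ((\<lambda>P. sup_norm_on E (poly P)) ` ?M)" by (intro bdd_belowI2[of _ 0])
  have ne: "?M \<noteq> {}" by (auto intro: exI[of _ "monom 1 n"] simp: degree_monom_eq)
  have m_le: "m \<le> sup_norm_on E (poly P)" if "P \<in> ?M" for P
    unfolding m_def using bdd that by (rule cINF_lower)
  obtain R where R: "R > 0" "\<And>z. z \<in> E \<Longrightarrow> cmod z \<le> R"
    using E compact_imp_bounded bounded_pos by metis
  \<comment> \<open>The product bound stands under the quantifier over i, hence says nothing for n =
    0; that degree is settled separately.\<close>
  have "\<exists>r. \<forall>i<n. cmod (r i) \<le> 2 * R \<and> (\<forall>z\<in>E. (\<Prod>i<n. cmod (z - r i)) \<le> m + 1 / Suc k)" for k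
  proof -
    have "m < m + 1 / Suc k" by simp
    then obtain P where P: "P \<in> ?M" "sup_norm_on E (poly P) < m + 1 / Suc k"
      unfolding m_def using cINF_less_iff[OF ne bdd] by blast
    then obtain r where r: "P = (\<Prod>i<n. [:- r i, 1:])" using monic_poly_roots[of P n] by blast
    define r' where "r' i = (if cmod (r i) \<le> 2 * R then r i else 0)" for i
    have "(\<Prod>i<n. cmod (z - r' i)) \<le> m + 1 / Suc k" if z: "z \<in> E" for z
    proof -
      have "(\<Prod>i<n. cmod (z - r' i)) \<le> (\<Prod>i<n. cmod (z - r i))"
      proof (intro prod_mono conjI)
        fix i
        show "cmod (z - r' i) \<le> cmod (z - r i)"
          using R(2)[OF z] norm_triangle_ineq2[of "r i" z] by (auto simp: r'_def norm_minus_commute)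
      qed auto
      also have "\<dots> = cmod (poly P z)" by (simp add: r poly_prod prod_norm)
      also have "\<dots> \<le> sup_norm_on E (poly P)" by (rule sup_norm_on_upper[OF E(1) cont z])
      finally show ?thesis using P(2) by simp
    qed
    then show ?thesis using R(1) by (intro exI[of _ r']) (auto simp: r'_def)
  qed
  then obtain r where r: "\<And>k i. i < n \<Longrightarrow> cmod (r k i) \<le> 2 * R"
    and rm: "\<And>k z. n > 0 \<Longrightarrow> z \<in> E \<Longrightarrow> (\<Prod>i<n. cmod (z - r k i)) \<le> m + 1 / Suc k" by metis
  obtain s where s: "strict_mono s" "\<And>i. i \<in> {..<n} \<Longrightarrow> \<exists>l. (\<lambda>k. r (s k) i) \<longlonglongrightarrow> l"
    using function_convergent_subsequence[of "{..<n}" r "2 * R"] r by auto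
  then obtain l where l: "\<And>i. i < n \<Longrightarrow> (\<lambda>k. r (s k) i) \<longlonglongrightarrow> l i" by (metis lessThan_iff)
  define T where "T = (\<Prod>i<n. [:- l i, 1:])"
  have T: "degree T = n" "lead_coeff T = 1" unfolding T_def by (rule prod_linear_degree)+
  show ?thesis
  proof (cases "n = 0")
    case True
    have "P = T" if "degree P = n \<and> lead_coeff P = 1" for P
      using that T True by (metis degree_eq_zeroE lead_coeff_pCons(2))
    then show ?thesis using T unfolding is_chebyshev_poly_def by (metis order_refl)
  next
    case False
    have "cmod (poly T z) \<le> m" if z: "z \<in> E" for z
    proof -
      have "(\<lambda>k. \<Prod>i<n. cmod (z - r (s k) i)) \<longlonglongrightarrow> (\<Prod>i<n. cmod (z - l i))"
        by (intro tendsto_intros l) auto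
      moreover have "(\<lambda>k. m + 1 / Suc (s k)) \<longlonglongrightarrow> m + 0"
        by (intro tendsto_intros LIMSEQ_subseq_LIMSEQ[OF lim_1_over_n[THEN LIMSEQ_Suc] s(1), unfolded o_def])
      ultimately have "(\<Prod>i<n. cmod (z - l i)) \<le> m + 0"
        using rm[OF _ z] False by (intro LIMSEQ_le[where X = "\<lambda>k. \<Prod>i<n. cmod (z - r (s k) i)"]) auto
      then show ?thesis by (simp add: T_def poly_prod prod_norm)
    qed
    then have "sup_norm_on E (poly T) \<le> m" by (rule sup_norm_on_least[OF E(2)])
    then have "is_chebyshev_poly E n T"
      unfolding is_chebyshev_poly_def using T m_le by force
    then show ?thesis by blast
  qed
qed

section \<open>Extreme points and uniqueness\<close>

lemma poly_interpolation_exists: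
  fixes f :: "'a::field \<Rightarrow> 'a"
  assumes "finite X"
  shows "\<exists>q. degree q \<le> card X - 1 \<and> (\<forall>x\<in>X. poly q x = f x)"
  using assms
proof induction
  case empty
  show ?case by (intro exI[of _ 0]) auto
next
  case (insert a X)
  then obtain q where q: "degree q \<le> card X - 1" "\<forall>x\<in>X. poly q x = f x" by blast
  define w where "w = (\<Prod>x\<in>X. [:- x, 1:])"
  have w: "poly w a \<noteq> 0" "degree w = card X" "\<And>x. x \<in> X \<Longrightarrow> poly w x = 0"
    using insert by (auto simp: w_def poly_prod degree_prod_sum_eq)
  define q' where "q' = q + smult ((f a - poly q a) / poly w a) w"
  have "degree q' \<le> card X"
    unfolding q'_def using q(1) w(2) by (intro degree_add_le order.trans[OF degree_smult_le]) auto
  moreover have "\<forall>x\<in>insert a X. poly q' x = f x"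
    using w q(2) by (auto simp: q'_def)
  ultimately show ?case using insert by (intro exI[of _ q']) auto
qed

text \<open>With at most n extreme points, some q of degree below n agrees with T at all of them,
  and subtracting a small multiple of q lowers the norm while T stays monic. This is the variational
  argument of Kolmogorov's criterion.\<close>

lemma chebyshev_poly_extreme_points:
  assumes E: "compact E" "infinite E" and T: "is_chebyshev_poly E n T" and n: "n > 0"
    and X: "X = {z\<in>E. cmod (poly T z) = sup_norm_on E (poly T)}" "finite X"
  shows "card X > n"
proof (rule ccontr)
  assume "\<not> card X > n"
  then have card: "card X \<le> n" by simp
  define t where "t = sup_norm_on E (poly T)"
  have cont: "continuous_on E (poly P)" for P :: "complex poly" by (intro continuous_intros)
  have le: "cmod (poly T z) \<le> t" if "z \<in> E" for z
    unfolding t_def by (rule sup_norm_on_upper[OF E(1) cont that])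
  have deg: "degree T = n" "lead_coeff T = 1" using T by (auto simp: is_chebyshev_poly_def)
  have tpos: "t > 0"
  proof (rule ccontr)
    assume "\<not> t > 0"
    then have "cmod (poly T z) \<le> 0" if "z \<in> E" for z using le[OF that] by linarith
    then have "E \<subseteq> {z. poly T z = 0}" by auto
    moreover have "T \<noteq> 0" using deg n by auto
    ultimately show False using E(2) poly_roots_finite finite_subset by blast
  qed
  obtain q where q: "degree q \<le> card X - 1" "\<And>x. x \<in> X \<Longrightarrow> poly q x = poly T x"
    using poly_interpolation_exists[OF X(2), of "poly T"] by blast
  have dq: "degree q < n" using q(1) card n by linarith
  obtain B where B: "B > 0" "\<And>z. z \<in> E \<Longrightarrow> cmod (poly q z) \<le> B"
    using compact_imp_bounded[OF compact_continuous_image[OF cont E(1), of q]] unfolding bounded_pos by auto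
  \<comment> \<open>On K the values of q and T are poorly aligned, so K avoids the extreme points
    and T stays uniformly below t there. Off K, subtracting a multiple of q decreases the modulus to
    first order.\<close>
  define K where "K = {z\<in>E. Re (poly q z * cnj (poly T z)) \<le> t\<^sup>2 / 2}"
  have "compact K"
  proof -
    have "K = E \<inter> {z. Re (poly q z * cnj (poly T z)) \<le> t\<^sup>2 / 2}" by (auto simp: K_def)
    then show ?thesis
      using E(1) by (auto intro!: compact_Int_closed closed_Collect_le continuous_intros)
  qed
  have Kless: "cmod (poly T z) < t" if "z \<in> K" for z
  proof (rule ccontr)
    assume "\<not> cmod (poly T z) < t"
    then have "cmod (poly T z) = t" "z \<in> E" using le[of z] that by (auto simp: K_def)
    then have "z \<in> X" by (simp add: X t_def)
    then have "poly q z * cnj (poly T z) = of_real (t\<^sup>2)"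
      using q(2) \<open>cmod (poly T z) = t\<close> by (simp add: complex_norm_square[symmetric])
    then have "Re (poly q z * cnj (poly T z)) = t\<^sup>2" by (metis Re_complex_of_real)
    moreover have "Re (poly q z * cnj (poly T z)) \<le> t\<^sup>2 / 2" using that unfolding K_def by blast
    moreover have "t\<^sup>2 > 0" using tpos by simp
    ultimately show False by linarith
  qed
  obtain t1 where t1: "t1 < t" "\<And>z. z \<in> K \<Longrightarrow> cmod (poly T z) \<le> t1"
  proof (cases "K = {}")
    case True
    then show ?thesis using that[of 0] tpos by auto
  next
    case False
    have "continuous_on K (\<lambda>z. cmod (poly T z))" by (intro continuous_intros)
    then obtain x where "x \<in> K" "\<And>z. z \<in> K \<Longrightarrow> cmod (poly T z) \<le> cmod (poly T x)"
      using continuous_attains_sup[OF \<open>compact K\<close> False] by blast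
    then show ?thesis using that Kless by blast
  qed
  \<comment> \<open>The first bound keeps the perturbation on K within half of t - t1; the second
    makes the quadratic term of the squared modulus at most half of the linear gain off K.\<close>
  define \<epsilon> where "\<epsilon> = min ((t - t1) / (2 * B)) (t\<^sup>2 / (2 * B\<^sup>2))"
  have \<epsilon>: "\<epsilon> > 0" using t1 B tpos by (simp add: \<epsilon>_def)
  have \<epsilon>1: "\<epsilon> * B \<le> (t - t1) / 2"
  proof -
    have "\<epsilon> * B \<le> (t - t1) / (2 * B) * B" using B(1) by (intro mult_right_mono) (auto simp: \<epsilon>_def)
    then show ?thesis using B(1) by simp
  qed
  have \<epsilon>2: "\<epsilon> * B\<^sup>2 \<le> t\<^sup>2 / 2"
  proof -
    have "\<epsilon> * B\<^sup>2 \<le> t\<^sup>2 / (2 * B\<^sup>2) * B\<^sup>2" by (intro mult_right_mono) (auto simp: \<epsilon>_def)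
    then show ?thesis using B(1) by simp
  qed
  define S where "S = T - smult \<epsilon> q"
  have "degree S = n" "lead_coeff S = 1"
  proof -
    have "degree (smult \<epsilon> q) < degree T" using dq deg by (simp add: degree_smult_le le_less_trans)
    then have "degree S = degree T" unfolding S_def diff_conv_add_uminus
      by (subst degree_add_eq_left) auto
    then show 1: "degree S = n" using deg by simp
    have "coeff q n = 0" using dq by (simp add: coeff_eq_0)
    then show "lead_coeff S = 1" using deg 1 by (simp add: S_def)
  qed
  then have "t \<le> sup_norm_on E (poly S)"
    using T unfolding is_chebyshev_poly_def t_def by blast
  moreover have "sup_norm_on E (poly S) \<le> max ((t + t1) / 2) (sqrt (t\<^sup>2 - \<epsilon> * t\<^sup>2 / 2))"
  proof (rule sup_norm_on_least)
    show "E \<noteq> {}" using E(2) by auto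
    fix z assume z: "z \<in> E"
    show "cmod (poly S z) \<le> max ((t + t1) / 2) (sqrt (t\<^sup>2 - \<epsilon> * t\<^sup>2 / 2))"
    proof (cases "z \<in> K")
      case True
      have "cmod (poly S z) \<le> cmod (poly T z) + cmod (of_real \<epsilon> * poly q z)"
        unfolding S_def using norm_triangle_ineq4[of "poly T z" "of_real \<epsilon> * poly q z"] by simp
      also have "\<dots> \<le> t1 + \<epsilon> * B"
        using t1(2)[OF True] B(2)[OF z] \<epsilon> by (intro add_mono) (auto simp: norm_mult)
      also have "\<dots> \<le> (t + t1) / 2" using \<epsilon>1 by (simp add: field_simps)
      finally show ?thesis by (rule max.coboundedI1)
    next
      case False
      then have re: "Re (poly q z * cnj (poly T z)) > t\<^sup>2 / 2" using z by (simp add: K_def)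
      have "(cmod (poly S z))\<^sup>2 = (cmod (poly T z))\<^sup>2 - 2 * \<epsilon> * Re (poly q z * cnj (poly T z)) + \<epsilon> * (\<epsilon> * (cmod (poly q z))\<^sup>2)"
        unfolding S_def cmod_power2 by (simp add: power2_eq_square algebra_simps)
      also have "\<dots> \<le> t\<^sup>2 - 2 * \<epsilon> * (t\<^sup>2 / 2) + \<epsilon> * (\<epsilon> * B\<^sup>2)"
        using le[OF z] B(2)[OF z] re \<epsilon> by (intro add_mono diff_mono mult_left_mono power_mono) auto
      also have "\<dots> \<le> t\<^sup>2 - 2 * \<epsilon> * (t\<^sup>2 / 2) + \<epsilon> * (t\<^sup>2 / 2)"
        using \<epsilon>2 \<epsilon> by (intro add_mono mult_left_mono) auto
      also have "\<dots> = t\<^sup>2 - \<epsilon> * t\<^sup>2 / 2" by simp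
      finally have "cmod (poly S z) \<le> sqrt (t\<^sup>2 - \<epsilon> * t\<^sup>2 / 2)" by (rule real_le_rsqrt)
      then show ?thesis by simp
    qed
  qed
  moreover have "sqrt (t\<^sup>2 - \<epsilon> * t\<^sup>2 / 2) < t"
    using \<epsilon> tpos by (intro real_less_lsqrt) auto
  ultimately show False using t1(1) unfolding max_def by (auto split: if_splits)
qed

text \<open>The mean of two minimizers is a minimizer, and where its modulus equals t the
  parallelogram law forces P and Q to agree. There are at least n + 1 such points, too many for
  distinct polynomials of degree n.\<close>

theorem chebyshev_poly_unique:
  assumes E: "compact E" "infinite E" and P: "is_chebyshev_poly E n P" and Q: "is_chebyshev_poly E n Q"
  shows "P = Q"
proof (cases "n = 0")
  case True
  then show ?thesis using P Q unfolding is_chebyshev_poly_def by (metis degree_eq_zeroE lead_coeff_pCons(2))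
next
  case False
  define t where "t = sup_norm_on E (poly P)"
  have deg: "degree P = n" "lead_coeff P = 1" "degree Q = n" "lead_coeff Q = 1"
    using P Q by (auto simp: is_chebyshev_poly_def)
  have tQ: "sup_norm_on E (poly Q) = t"
    unfolding t_def using P Q unfolding is_chebyshev_poly_def by (intro order_antisym) blast+
  have cont: "continuous_on E (poly P)" for P :: "complex poly" by (intro continuous_intros)
  have le: "cmod (poly P z) \<le> t" "cmod (poly Q z) \<le> t" if "z \<in> E" for z
    using sup_norm_on_upper[OF E(1) cont that, of P] sup_norm_on_upper[OF E(1) cont that, of Q] tQ
    by (auto simp: t_def)
  define S where "S = smult (1 / 2) (P + Q)"
  have cS: "coeff S n = 1" using deg by (simp add: S_def)
  have "degree S \<le> n" unfolding S_def using deg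
    by (intro order.trans[OF degree_smult_le] degree_add_le) auto
  then have dS: "degree S = n" using cS by (metis le_antisym le_degree one_neq_zero)
  have Sle: "sup_norm_on E (poly S) \<le> t"
  proof (rule sup_norm_on_least)
    show "E \<noteq> {}" using E(2) by auto
    fix z assume z: "z \<in> E"
    show "cmod (poly S z) \<le> t"
      using norm_triangle_ineq[of "poly P z" "poly Q z"] le[OF z] by (simp add: S_def norm_mult norm_divide)
  qed
  then have S: "is_chebyshev_poly E n S"
    using P dS cS unfolding is_chebyshev_poly_def t_def by (metis order_trans)
  then have St: "sup_norm_on E (poly S) = t"
    using Sle P dS cS unfolding is_chebyshev_poly_def t_def by (intro order_antisym) blast+
  define X where "X = {z\<in>E. cmod (poly S z) = sup_norm_on E (poly S)}"
  obtain Y where Y: "Y \<subseteq> X" "card Y = Suc n" "finite Y"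
  proof (cases "finite X")
    case True
    then have "card X > n" using chebyshev_poly_extreme_points[OF E S _ X_def] False by simp
    then show ?thesis using obtain_subset_with_card_n[of "Suc n" X] that by (metis Suc_leI)
  next
    case False
    then show ?thesis using infinite_arbitrarily_large[of X "Suc n"] that by blast
  qed
  have eq: "poly P z = poly Q z" if "z \<in> Y" for z
  proof -
    have z: "z \<in> E" "cmod (poly S z) = t" using that Y St by (auto simp: X_def)
    have "2 * poly S z = poly P z + poly Q z" by (simp add: S_def)
    then have "cmod (poly P z + poly Q z) = 2 * t" using z(2) by (metis norm_mult norm_numeral)
    moreover have "(cmod (poly P z - poly Q z))\<^sup>2 + (cmod (poly P z + poly Q z))\<^sup>2
        = 2 * (cmod (poly P z))\<^sup>2 + 2 * (cmod (poly Q z))\<^sup>2"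
      unfolding cmod_power2 by (simp add: power2_eq_square algebra_simps)
    moreover have "(cmod (poly P z))\<^sup>2 \<le> t\<^sup>2" "(cmod (poly Q z))\<^sup>2 \<le> t\<^sup>2"
      using le[OF z(1)] by (auto intro: power_mono)
    ultimately have "(cmod (poly P z - poly Q z))\<^sup>2 \<le> 0" by (simp only: power_mult_distrib power2_eq_square[of "2::real"])
    then show ?thesis by simp
  qed
  show "P = Q"
    by (rule poly_eqI_degree[of Y]) (use eq Y deg in auto)
qed

corollary is_chebyshev_poly_chebyshev_poly:
  assumes "compact E" "infinite E"
  shows "is_chebyshev_poly E n (chebyshev_poly E n)"
proof -
  have "E \<noteq> {}" using assms(2) by auto
  then have "\<exists>!T. is_chebyshev_poly E n T"
    using chebyshev_poly_exists[OF assms(1)] chebyshev_poly_unique[OF assms] by blast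
  then show ?thesis unfolding chebyshev_poly_def by (rule theI')
qed

section \<open>Monic polynomials of nearly minimal norm\<close>

lemma local_modulus_prod:
  assumes "finite Z" "open U" "\<And>x. x \<in> Z \<Longrightarrow> local_modulus (\<phi> x) U"
  shows "local_modulus (\<lambda>z. \<Prod>x\<in>Z. \<phi> x z) U"
  using assms(1,3)
proof induction
  case empty
  have "local_modulus (\<lambda>z. cmod ((\<lambda>_. 1) z)) U" by (intro local_modulus_norm assms) auto
  then show ?case by simp
next
  case (insert x Z)
  then show ?case by (simp add: local_modulus_mult)
qed

text \<open>The second-order estimate behind multiplicative weights. Multiplying by 1 - u reduces it
  to \<open>u\<^sup>2 * (1 - 2 * u)\<close> being nonnegative.\<close>

lemma exp_le_quadratic:
  fixes u :: real
  assumes "\<bar>u\<bar> \<le> 1 / 2"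
  shows "exp u \<le> 1 + u + 2 * u\<^sup>2"
proof -
  have "1 - u \<le> exp (- u)" using exp_ge_add_one_self[of "- u"] by simp
  then have "exp u * (1 - u) \<le> exp u * exp (- u)" by (intro mult_left_mono) auto
  also have "\<dots> = 1" by (simp flip: exp_add)
  also have "1 \<le> (1 + u + 2 * u\<^sup>2) * (1 - u)"
  proof -
    have "u\<^sup>2 * (1 - 2 * u) \<ge> 0" using assms by (intro mult_nonneg_nonneg) auto
    then show ?thesis by (simp add: algebra_simps power2_eq_square)
  qed
  finally show ?thesis using assms by (simp add: mult_le_cancel_right)
qed

context regular_green
begin

text \<open>\<kappa> is the lower limit of \<open>ln (cmod z) - G z\<close> at infinity. The
  eventual lower bound serves the comparison at infinity, the frequent upper bound the construction
  of small monic polynomials.\<close>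

lemma log_capacity_constant_exists:
  obtains \<kappa> where "\<And>\<eta>. \<eta> > 0 \<Longrightarrow> \<forall>\<^sub>F z in at_infinity. \<kappa> - \<eta> < ln (cmod z) - G z"
    "\<And>\<eta>. \<eta> > 0 \<Longrightarrow> \<exists>\<^sub>F z in at_infinity. ln (cmod z) - G z < \<kappa> + \<eta>"
proof -
  obtain B r where B: "B > 0" "r \<ge> 1" "\<And>z. cmod z \<ge> r \<Longrightarrow> z \<notin> E \<and> \<bar>G z - ln (cmod z)\<bar> \<le> B"
    using G_asymp by blast
  let ?f = "\<lambda>z. ln (cmod z) - G z"
  let ?S = "{x. \<forall>\<^sub>F z in at_infinity. x < ?f z}"
  have "\<forall>\<^sub>F z in at_infinity. - B - 1 < ?f z"
    unfolding eventually_at_infinity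
  proof (intro exI allI impI)
    fix z assume "r \<le> cmod z"
    then show "- B - 1 < ?f z" using B(3)[of z] by linarith
  qed
  then have ne: "?S \<noteq> {}" by blast
  have evB: "\<forall>\<^sub>F z in at_infinity. ?f z \<le> B"
    unfolding eventually_at_infinity
  proof (intro exI allI impI)
    fix z assume "r \<le> cmod z"
    then show "?f z \<le> B" using B(3)[of z] by linarith
  qed
  have bd: "x \<le> B" if "x \<in> ?S" for x
  proof -
    have "\<forall>\<^sub>F z in (at_infinity :: complex filter). x < B"
      using evB that unfolding mem_Collect_eq by eventually_elim linarith
    then show ?thesis by (simp add: eventually_const trivial_limit_at_infinity)
  qed
  then have bdd: "bdd_above ?S" by (rule bdd_aboveI)
  show ?thesis
  proof (rule that[of "Sup ?S"])
    fix \<eta> :: real assume \<eta>: "\<eta> > 0"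
    then obtain x where x: "x \<in> ?S" "Sup ?S - \<eta> < x"
      using less_cSup_iff[OF ne bdd, of "Sup ?S - \<eta>"] by auto
    then show "\<forall>\<^sub>F z in at_infinity. Sup ?S - \<eta> < ?f z"
      unfolding mem_Collect_eq by (auto elim!: eventually_mono)
    show "\<exists>\<^sub>F z in at_infinity. ?f z < Sup ?S + \<eta>"
    proof (rule ccontr)
      assume "\<not> ?thesis"
      then have "\<forall>\<^sub>F z in at_infinity. \<not> ?f z < Sup ?S + \<eta>" by (simp add: frequently_def)
      then have "\<forall>\<^sub>F z in at_infinity. Sup ?S + \<eta> / 2 < ?f z"
        by eventually_elim (use \<eta> in linarith)
      then have "Sup ?S + \<eta> / 2 \<le> Sup ?S" using bdd by (intro cSup_upper) auto
      then show False using \<eta> by simp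
    qed
  qed
qed

section \<open>Level curves of G and greedily chosen zeros\<close>

definition level :: "real \<Rightarrow> complex set" where
  "level \<eta> = {w\<in>- E. G w = \<eta>}"

lemma compact_level:
  assumes "\<eta> > 0" shows "compact (level \<eta>)"
proof -
  \<comment> \<open>As a superlevel set of \<open>- \<bar>G w - \<eta>\<bar>\<close> the level set
    falls under the compactness criterion: G is near 0 at the boundary and large at
    infinity.\<close>
  have "compact {w\<in>- E. - \<bar>G w - \<eta>\<bar> \<ge> 0}"
  proof (rule compact_superlevel)
    show "continuous_on (- E) (\<lambda>w. - \<bar>G w - \<eta>\<bar>)" by (intro continuous_intros G_continuous)
    show "\<forall>\<^sub>F z in at \<zeta> within - E. - \<bar>G z - \<eta>\<bar> < 0" if \<zeta>: "\<zeta> \<in> closure (- E)" "\<zeta> \<notin> - E" for \<zeta>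
      using order_tendstoD(2)[OF bdry_closure[OF \<zeta>] assms] by eventually_elim auto
    have "\<forall>\<^sub>F z in at_infinity. \<eta> < G z" using G_at_top filterlim_at_top_dense by blast
    then show "\<forall>\<^sub>F z in at_infinity. z \<in> - E \<longrightarrow> - \<bar>G z - \<eta>\<bar> < 0" by eventually_elim auto
  qed
  moreover have "{w\<in>- E. - \<bar>G w - \<eta>\<bar> \<ge> 0} = level \<eta>" by (auto simp: level_def)
  ultimately show ?thesis by simp
qed

text \<open>If the potential of \<open>\<sigma>\<close> were at least \<open>\<kappa> + 2 * \<eta>\<close> on the level set, the maximum principle
  would push it above \<open>G + \<kappa> + \<eta>\<close> up to infinity.\<close>

lemma weighted_log_distance_small:
  assumes \<eta>: "\<eta> > 0" and Z: "finite Z" "Z \<subseteq> E" and \<sigma>: "\<And>x. x \<in> Z \<Longrightarrow> \<sigma> x \<ge> 0" "sum \<sigma> Z = 1"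
    and \<kappa>: "\<And>\<eta>. \<eta> > 0 \<Longrightarrow> \<exists>\<^sub>F z in at_infinity. ln (cmod z) - G z < \<kappa> + \<eta>"
  obtains w where "w \<in> level \<eta>" "(\<Sum>x\<in>Z. \<sigma> x * ln (dist x w)) < \<kappa> + 2 * \<eta>"
proof (rule ccontr)
  assume "\<not> thesis"
  then have ge: "(\<Sum>x\<in>Z. \<sigma> x * ln (dist x w)) \<ge> \<kappa> + 2 * \<eta>" if "w \<in> level \<eta>" for w
    using that \<open>\<And>w. w \<in> level \<eta> \<Longrightarrow> (\<Sum>x\<in>Z. \<sigma> x * ln (dist x w)) < \<kappa> + 2 * \<eta> \<Longrightarrow> thesis\<close> not_le by blast
  \<comment> \<open>The exponential of G minus the potential of \<sigma>. It stays bounded at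
    infinity because \<sigma> has total mass 1.\<close>
  define \<psi> where "\<psi> w = exp (1 * G w) * (\<Prod>x\<in>Z. cmod (w - x) powr (- \<sigma> x))" for w
  define U where "U = {w\<in>- E. G w > \<eta>}"
  have U: "open U"
  proof -
    have "U = - E \<inter> G -` {\<eta><..}" by (auto simp: U_def)
    then show ?thesis using continuous_open_preimage[OF G_continuous open_compl, of "{\<eta><..}"] by simp
  qed
  have lm\<psi>: "local_modulus \<psi> (- E)"
    unfolding \<psi>_def using Z
    by (intro local_modulus_mult lm_exp_G local_modulus_prod open_compl local_modulus_norm_powr) (auto intro!: holomorphic_intros)
  obtain B r where B: "B > 0" "r \<ge> 1" "\<And>z. cmod z \<ge> r \<Longrightarrow> z \<notin> E \<and> \<bar>G z - ln (cmod z)\<bar> \<le> B"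
    using G_asymp by blast
  obtain D where D: "D > 0" "\<And>z. z \<in> E \<Longrightarrow> cmod z \<le> D"
    using compact_E compact_imp_bounded bounded_pos by metis
  have prod_const: "(\<Prod>x\<in>Z. y powr (- \<sigma> x)) = 1 / y" if "y > 0" for y :: real
  proof -
    have "(\<Prod>x\<in>Z. y powr (- \<sigma> x)) = y powr (\<Sum>x\<in>Z. - \<sigma> x)" using that Z by (simp add: powr_sum)
    also have "(\<Sum>x\<in>Z. - \<sigma> x) = - 1" using \<sigma>(2) by (simp add: sum_negf)
    finally show ?thesis using that by (simp add: powr_minus_divide)
  qed
  have \<psi>_exp: "\<psi> w = exp (G w - (\<Sum>x\<in>Z. \<sigma> x * ln (dist x w)))" if "w \<notin> E" for w
  proof -
    have "cmod (w - x) powr (- \<sigma> x) = exp (- (\<sigma> x * ln (dist x w)))" if "x \<in> Z" for x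
      using Z that \<open>w \<notin> E\<close> by (auto simp: powr_def dist_norm norm_minus_commute)
    then have "\<psi> w = exp (G w) * exp (\<Sum>x\<in>Z. - (\<sigma> x * ln (dist x w)))"
      using Z by (simp add: \<psi>_def exp_sum)
    then show ?thesis by (simp add: sum_negf exp_diff exp_minus field_simps)
  qed
  have le: "\<psi> w \<le> exp (- \<kappa> - \<eta>)" if w: "w \<in> U" for w
  proof -
    have wE: "w \<notin> E" using w by (simp add: U_def)
    have "\<psi> w * exp (- G w) powr \<epsilon> \<le> exp (- \<kappa> - \<eta>)" if \<epsilon>: "\<epsilon> > 0" for \<epsilon>
    proof -
      define \<phi> where "\<phi> z = \<psi> z * exp (- \<epsilon> * G z)" for z
      have lm: "local_modulus \<phi> (- E)" unfolding \<phi>_def by (intro local_modulus_mult lm\<psi> lm_exp_G)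
      have cont: "continuous_on (- E) \<phi>" using lm open_compl by (rule local_modulus_continuous)
      have "\<phi> w \<le> exp (- \<kappa> - \<eta>)"
      proof (rule local_modulus_max_principle[OF local_modulus_subset[OF lm] U _ w])
        show "U \<subseteq> - E" by (auto simp: U_def)
        fix m assume m: "exp (- \<kappa> - \<eta>) < m"
        have mpos: "m > 0" using m exp_gt_zero order_less_trans by blast
        show "compact {z \<in> U. m \<le> \<phi> z}"
        proof (rule compact_superlevel)
          show "continuous_on U \<phi>" using cont by (rule continuous_on_subset) (auto simp: U_def)
          show "\<forall>\<^sub>F z in at \<zeta> within U. \<phi> z < m" if \<zeta>: "\<zeta> \<in> closure U" "\<zeta> \<notin> U" for \<zeta>
          proof (cases "\<zeta> \<in> E")
            case True
            \<comment> \<open>G is below \<eta> near E, so U stays away from E and the claim holds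
              vacuously at such a point.\<close>
            have UE: "U \<subseteq> - E" by (auto simp: U_def)
            then have "\<zeta> \<in> closure (- E)" using \<zeta>(1) closure_mono by blast
            then have "(G \<longlongrightarrow> 0) (at \<zeta> within U)"
              using True by (intro tendsto_within_subset[OF bdry_closure UE]) auto
            then have "\<forall>\<^sub>F z in at \<zeta> within U. G z < \<eta>" using \<eta> by (rule order_tendstoD(2))
            moreover have "\<forall>\<^sub>F z in at \<zeta> within U. z \<in> U" by (simp add: eventually_at_filter)
            ultimately show ?thesis by eventually_elim (auto simp: U_def)
          next
            case False
            have "isCont G \<zeta>" using False by (rule G_isCont)
            then have "(G \<longlongrightarrow> G \<zeta>) (at \<zeta> within U)"
              using continuous_at_imp_continuous_at_within continuous_within by blast
            moreover have "\<forall>\<^sub>F z in at \<zeta> within U. \<eta> \<le> G z" by (auto simp: eventually_at_filter U_def)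
            moreover have "at \<zeta> within U \<noteq> bot"
              using \<zeta> by (simp add: trivial_limit_within islimpt_in_closure)
            ultimately have "\<eta> \<le> G \<zeta>" using tendsto_lowerbound by blast
            then have "G \<zeta> = \<eta>" using \<zeta>(2) False by (auto simp: U_def)
            then have "\<zeta> \<in> level \<eta>" using False by (simp add: level_def)
            then have "\<psi> \<zeta> \<le> exp (- \<kappa> - \<eta>)"
              using ge[of \<zeta>] \<open>G \<zeta> = \<eta>\<close> by (simp add: \<psi>_exp[OF False])
            moreover have "exp (- \<epsilon> * G \<zeta>) \<le> 1" using \<epsilon> \<eta> \<open>G \<zeta> = \<eta>\<close> by simp
            ultimately have "\<phi> \<zeta> \<le> exp (- \<kappa> - \<eta>) * 1" unfolding \<phi>_def by (intro mult_mono) auto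
            moreover have "isCont \<phi> \<zeta>" using cont open_compl False by (meson ComplI continuous_on_eq_continuous_at)
            then have "(\<phi> \<longlongrightarrow> \<phi> \<zeta>) (at \<zeta> within U)"
              using continuous_at_imp_continuous_at_within continuous_within by blast
            ultimately show ?thesis using m by (intro order_tendstoD(2)[of \<phi> "\<phi> \<zeta>"]) auto
          qed
          have ev1: "\<forall>\<^sub>F z in at_infinity. exp (- \<epsilon> * G z) < m / (2 * exp B)"
            using mpos \<epsilon> by (intro order_tendstoD(2)[OF exp_G_tendsto_0]) auto
          have ev2: "\<forall>\<^sub>F z::complex in at_infinity. cmod z \<ge> max r (2 * D)"
            unfolding eventually_at_infinity by blast
          show "\<forall>\<^sub>F z in at_infinity. z \<in> U \<longrightarrow> \<phi> z < m"
            using ev1 ev2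
          proof eventually_elim
            case (elim z)
            have z0: "cmod z > 0" using elim(2) B(2) by auto
            have "(\<Prod>x\<in>Z. cmod (z - x) powr (- \<sigma> x)) \<le> (\<Prod>x\<in>Z. (cmod z / 2) powr (- \<sigma> x))"
            proof (intro prod_mono conjI)
              fix x assume x: "x \<in> Z"
              have "cmod x \<le> D" using x Z D by blast
              then have "cmod z / 2 \<le> cmod (z - x)"
                using norm_triangle_ineq2[of z x] elim(2) by simp
              then show "cmod (z - x) powr (- \<sigma> x) \<le> (cmod z / 2) powr (- \<sigma> x)"
                using z0 \<sigma>(1)[OF x] by (intro powr_mono2') auto
            qed auto
            also have "\<dots> = 2 / cmod z" using z0 by (subst prod_const) auto
            finally have "\<psi> z \<le> exp (G z) * (2 / cmod z)" unfolding \<psi>_def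
              by (intro mult_mono) (auto intro: prod_nonneg)
            also have "\<dots> \<le> exp (ln (cmod z) + B) * (2 / cmod z)"
              using B(3)[of z] elim(2) by (intro mult_right_mono) auto
            also have "\<dots> = 2 * exp B" using z0 by (simp add: exp_add)
            finally have "\<phi> z \<le> 2 * exp B * exp (- \<epsilon> * G z)" unfolding \<phi>_def by (intro mult_right_mono) auto
            also have "\<dots> < m" using elim(1) by (simp add: field_simps)
            finally show ?case by simp
          qed
        qed
      qed
      then show ?thesis by (simp add: \<phi>_def powr_def)
    qed
    then show ?thesis by (rule le_if_mult_powr_le[rotated]) auto
  qed
  \<comment> \<open>It remains to turn the bound on \<psi> into \<open>ln (cmod z) - G z\<close>
    being at least \<open>\<kappa> + \<eta> / 2\<close> near infinity, which the choice of \<kappa>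
    excludes. Each \<open>cmod (z - x)\<close> is at most \<open>cmod z + D\<close>, and the
    resulting error \<open>ln (1 + D / cmod z)\<close> is eventually below \<eta> / 2.\<close>
  have "((\<lambda>z::complex. ln (1 + D / cmod z)) \<longlongrightarrow> ln (1 + 0)) at_infinity"
    by (intro tendsto_intros real_tendsto_divide_at_top[OF tendsto_const] filterlim_norm_at_top) auto
  then have ev1: "\<forall>\<^sub>F z::complex in at_infinity. ln (1 + D / cmod z) < \<eta> / 2"
    using \<eta> by (intro order_tendstoD(2)) auto
  have ev2: "\<forall>\<^sub>F z::complex in at_infinity. cmod z \<ge> r" unfolding eventually_at_infinity by blast
  have ev3: "\<forall>\<^sub>F z in at_infinity. \<eta> < G z" using G_at_top filterlim_at_top_dense by blast
  have "\<forall>\<^sub>F z in at_infinity. \<not> ln (cmod z) - G z < \<kappa> + \<eta> / 2"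
    using ev1 ev2 ev3
  proof eventually_elim
    case (elim z)
    have z: "cmod z > 0" "z \<notin> E" "z \<in> U" using elim(2,3) B(2) B(3)[of z] by (auto simp: U_def)
    have zD: "cmod z + D > 0" using z(1) D(1) by linarith
    have "1 / (cmod z + D) = (\<Prod>x\<in>Z. (cmod z + D) powr (- \<sigma> x))" using zD by (subst prod_const) auto
    also have "\<dots> \<le> (\<Prod>x\<in>Z. cmod (z - x) powr (- \<sigma> x))"
    proof (intro prod_mono conjI)
      fix x assume x: "x \<in> Z"
      have "cmod x \<le> D" using x Z D by blast
      then have "cmod (z - x) \<le> cmod z + D" using norm_triangle_ineq4[of z x] by simp
      moreover have "cmod (z - x) > 0" using x Z z by auto
      ultimately show "(cmod z + D) powr (- \<sigma> x) \<le> cmod (z - x) powr (- \<sigma> x)"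
        using \<sigma>(1)[OF x] by (intro powr_mono2') auto
    qed auto
    finally have "exp (G z) * (1 / (cmod z + D)) \<le> \<psi> z" unfolding \<psi>_def using zD
      by (intro mult_mono) (auto intro: prod_nonneg)
    also have "\<dots> \<le> exp (- \<kappa> - \<eta>)" by (rule le[OF z(3)])
    finally have "exp (G z) \<le> exp (- \<kappa> - \<eta>) * (cmod z + D)"
      using zD by (simp add: field_simps)
    then have "G z \<le> ln (exp (- \<kappa> - \<eta>) * (cmod z + D))"
      using zD by (subst ln_ge_iff) auto
    also have "\<dots> = - \<kappa> - \<eta> + ln (cmod z + D)" using zD by (simp add: ln_mult)
    also have "cmod z + D = cmod z * (1 + D / cmod z)" using z(1) by (simp add: distrib_left)
    also have "ln (cmod z * (1 + D / cmod z)) = ln (cmod z) + ln (1 + D / cmod z)"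
    proof (rule ln_mult_pos)
      show "1 + D / cmod z > 0" using z(1) D(1) by (simp add: add_pos_pos)
    qed (rule z(1))
    finally show ?case using elim(1) by simp
  qed
  then show False using \<kappa>[of "\<eta> / 2"] \<eta> by (simp add: frequently_def)
qed

text \<open>Multiplicative weights: the next zero is chosen to decrease the potential weighted by the
  current values \<open>\<bar>P x\<bar> powr \<beta>\<close>.\<close>

lemma greedy_poly_on_finite:
  assumes \<eta>: "\<eta> > 0" and Z: "finite Z" "Z \<noteq> {}" "Z \<subseteq> E"
    and \<kappa>: "\<And>\<eta>. \<eta> > 0 \<Longrightarrow> \<exists>\<^sub>F z in at_infinity. ln (cmod z) - G z < \<kappa> + \<eta>"
    and c: "c = \<kappa> + 2 * \<eta>"
    and B: "\<And>x w. x \<in> Z \<Longrightarrow> w \<in> level \<eta> \<Longrightarrow> \<bar>ln (dist x w) - c\<bar> \<le> B"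
    and \<beta>: "\<beta> > 0" "\<beta> * B \<le> 1 / 2"
  shows "\<exists>r :: nat \<Rightarrow> complex. (\<forall>i. r i \<in> level \<eta>) \<and>
    (\<forall>n. (\<Sum>x\<in>Z. (\<Prod>i<n. dist x (r i)) powr \<beta>) \<le> card Z * exp (n * (\<beta> * c + 2 * (\<beta> * B)\<^sup>2)))"
proof -
  have B0: "B \<ge> 0"
  proof -
    obtain x where x: "x \<in> Z" using Z by blast
    obtain w where "w \<in> level \<eta>"
      by (rule weighted_log_distance_small[OF \<eta>, of "{x}" "\<lambda>_. 1" \<kappa>]) (use x Z \<kappa> in auto)
    then show ?thesis using B[OF x] by force
  qed
  \<comment> \<open>One round: w makes the mean of \<open>ln (dist x w)\<close> with weights a less
    than c, so the linear terms of \<open>exp (u x)\<close> have a nonpositive weighted sum, and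
    only the quadratic error \<open>2 * (\<beta> * B)\<^sup>2\<close> survives.\<close>
  have step: "\<exists>w\<in>level \<eta>. (\<Sum>x\<in>Z. a x * dist x w powr \<beta>) \<le> (\<Sum>x\<in>Z. a x) * exp (\<beta> * c + 2 * (\<beta> * B)\<^sup>2)"
    if a: "\<And>x. x \<in> Z \<Longrightarrow> a x > 0" for a
  proof -
    define A where "A = sum a Z"
    have A: "A > 0" unfolding A_def using Z a by (intro sum_pos) auto
    obtain w where w: "w \<in> level \<eta>" "(\<Sum>x\<in>Z. (a x / A) * ln (dist x w)) < c"
    proof (rule weighted_log_distance_small[OF \<eta> Z(1,3) _ _ \<kappa>])
      show "0 \<le> a x / A" if "x \<in> Z" for x using a[OF that] A by simp
      show "(\<Sum>x\<in>Z. a x / A) = 1" using A by (simp add: A_def flip: sum_divide_distrib)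
    qed (use c in auto)
    have "(\<Sum>x\<in>Z. (a x / A) * ln (dist x w)) = (\<Sum>x\<in>Z. a x * ln (dist x w)) / A"
      by (simp add: sum_divide_distrib)
    then have less: "(\<Sum>x\<in>Z. a x * ln (dist x w)) < c * A" using w(2) A by (simp only: pos_divide_less_eq)
    have dpos: "dist x w > 0" if "x \<in> Z" for x using that Z w(1) by (auto simp: level_def)
    define u where "u x = \<beta> * (ln (dist x w) - c)" for x
    have u: "\<bar>u x\<bar> \<le> \<beta> * B" if "x \<in> Z" for x
      using B[OF that w(1)] \<beta> by (simp add: u_def abs_mult)
    have "(\<Sum>x\<in>Z. a x * dist x w powr \<beta>) = exp (\<beta> * c) * (\<Sum>x\<in>Z. a x * exp (u x))"
      unfolding sum_distrib_left
    proof (rule sum.cong[OF refl])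
      fix x assume "x \<in> Z"
      then have "dist x w powr \<beta> = exp (\<beta> * c) * exp (u x)"
        using dpos[of x] by (simp add: powr_def u_def algebra_simps flip: exp_add)
      then show "a x * dist x w powr \<beta> = exp (\<beta> * c) * (a x * exp (u x))" by simp
    qed
    also have "\<dots> \<le> exp (\<beta> * c) * (\<Sum>x\<in>Z. a x * (1 + u x + 2 * (\<beta> * B)\<^sup>2))"
    proof (intro mult_left_mono sum_mono)
      fix x assume x: "x \<in> Z"
      have "(u x)\<^sup>2 \<le> (\<beta> * B)\<^sup>2" using power_mono[OF u[OF x], of 2] by simp
      then show "exp (u x) \<le> 1 + u x + 2 * (\<beta> * B)\<^sup>2"
        using exp_le_quadratic[of "u x"] u[OF x] \<beta> by linarith
    qed (use a in \<open>auto intro: less_imp_le\<close>)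
    also have "(\<Sum>x\<in>Z. a x * (1 + u x + 2 * (\<beta> * B)\<^sup>2))
        = A * (1 + 2 * (\<beta> * B)\<^sup>2) + \<beta> * ((\<Sum>x\<in>Z. a x * ln (dist x w)) - c * A)"
    proof -
      have "(\<Sum>x\<in>Z. a x * (1 + u x + 2 * (\<beta> * B)\<^sup>2))
          = (\<Sum>x\<in>Z. a x * (1 + 2 * (\<beta> * B)\<^sup>2) + (\<beta> * (a x * ln (dist x w)) - \<beta> * (c * a x)))"
        by (intro sum.cong) (auto simp: u_def algebra_simps)
      also have "\<dots> = A * (1 + 2 * (\<beta> * B)\<^sup>2) + (\<beta> * (\<Sum>x\<in>Z. a x * ln (dist x w)) - \<beta> * (c * A))"
        unfolding A_def by (simp add: sum.distrib sum_subtractf sum_distrib_left sum_distrib_right)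
      finally show ?thesis by (simp add: right_diff_distrib)
    qed
    also have "\<dots> \<le> A * (1 + 2 * (\<beta> * B)\<^sup>2)"
      using less \<beta> by (simp add: mult_nonneg_nonpos)
    also have "\<dots> \<le> A * exp (2 * (\<beta> * B)\<^sup>2)"
      using A by (intro mult_left_mono exp_ge_add_one_self) auto
    finally show ?thesis using w(1) by (auto simp: A_def exp_add mult_ac)
  qed
  \<comment> \<open>The weights depend on all zeros chosen so far, so the choice is a function of
    the list of previous zeros.\<close>
  define nxt where "nxt ws = (SOME w. w \<in> level \<eta> \<and>
     (\<Sum>x\<in>Z. (\<Prod>v\<leftarrow>ws. dist x v) powr \<beta> * dist x w powr \<beta>)
       \<le> (\<Sum>x\<in>Z. (\<Prod>v\<leftarrow>ws. dist x v) powr \<beta>) * exp (\<beta> * c + 2 * (\<beta> * B)\<^sup>2))" for ws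
  define W where "W = rec_nat [] (\<lambda>_ ws. ws @ [nxt ws])"
  have W0: "W 0 = []" and WS: "W (Suc n) = W n @ [nxt (W n)]" for n by (auto simp: W_def)
  have pos: "(\<Prod>v\<leftarrow>ws. dist x v) > 0" if "x \<in> Z" "set ws \<subseteq> level \<eta>" for x ws
  proof -
    have "x \<in> E" using that Z by blast
    then show ?thesis using that(2) by (induction ws) (auto simp: level_def intro!: mult_pos_pos)
  qed
  have nxt: "nxt ws \<in> level \<eta> \<and> (\<Sum>x\<in>Z. (\<Prod>v\<leftarrow>ws. dist x v) powr \<beta> * dist x (nxt ws) powr \<beta>)
       \<le> (\<Sum>x\<in>Z. (\<Prod>v\<leftarrow>ws. dist x v) powr \<beta>) * exp (\<beta> * c + 2 * (\<beta> * B)\<^sup>2)"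
    if "set ws \<subseteq> level \<eta>" for ws
    unfolding nxt_def
  proof (rule someI_ex)
    have "(\<Prod>v\<leftarrow>ws. dist x v) powr \<beta> > 0" if "x \<in> Z" for x
      using pos[OF that \<open>set ws \<subseteq> level \<eta>\<close>] by (metis less_irrefl powr_gt_zero)
    from step[OF this] show "\<exists>w. w \<in> level \<eta> \<and> (\<Sum>x\<in>Z. (\<Prod>v\<leftarrow>ws. dist x v) powr \<beta> * dist x w powr \<beta>)
       \<le> (\<Sum>x\<in>Z. (\<Prod>v\<leftarrow>ws. dist x v) powr \<beta>) * exp (\<beta> * c + 2 * (\<beta> * B)\<^sup>2)"
      unfolding Bex_def .
  qed
  have WL: "set (W n) \<subseteq> level \<eta>" for n
    by (induction n) (auto simp: W0 WS nxt)
  define r where "r n = nxt (W n)" for n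
  have Wprod: "(\<Prod>v\<leftarrow>W n. dist x v) = (\<Prod>i<n. dist x (r i))" for n x
    by (induction n) (auto simp: W0 WS r_def)
  have "(\<Sum>x\<in>Z. (\<Prod>i<n. dist x (r i)) powr \<beta>) \<le> card Z * exp (n * (\<beta> * c + 2 * (\<beta> * B)\<^sup>2))" for n
  proof (induction n)
    case (Suc n)
    have "(\<Sum>x\<in>Z. (\<Prod>i<Suc n. dist x (r i)) powr \<beta>) = (\<Sum>x\<in>Z. (\<Prod>v\<leftarrow>W n. dist x v) powr \<beta> * dist x (nxt (W n)) powr \<beta>)"
      by (simp add: Wprod powr_mult prod_nonneg r_def)
    also have "\<dots> \<le> (\<Sum>x\<in>Z. (\<Prod>v\<leftarrow>W n. dist x v) powr \<beta>) * exp (\<beta> * c + 2 * (\<beta> * B)\<^sup>2)"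
      using nxt[OF WL] by blast
    also have "\<dots> \<le> card Z * exp (n * (\<beta> * c + 2 * (\<beta> * B)\<^sup>2)) * exp (\<beta> * c + 2 * (\<beta> * B)\<^sup>2)"
      using Suc by (intro mult_right_mono) (auto simp: Wprod)
    also have "\<dots> = card Z * exp (Suc n * (\<beta> * c + 2 * (\<beta> * B)\<^sup>2))"
      by (simp add: exp_add distrib_right mult_ac)
    finally show ?case .
  qed simp
  moreover have "r i \<in> level \<eta>" for i using nxt[OF WL] by (simp add: r_def)
  ultimately show ?thesis by blast
qed

text \<open>The excess 4 * \<eta> consists of 2 * \<eta> from the weighted distance bound, \<eta>
  from the quadratic error of the weights and \<eta> from passing from a finite net to all of E. The
  points r do not depend on n, and C absorbs the size of the net.\<close>

theorem small_monic_polys: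
  assumes \<eta>: "\<eta> > 0"
    and \<kappa>: "\<And>\<eta>. \<eta> > 0 \<Longrightarrow> \<exists>\<^sub>F z in at_infinity. ln (cmod z) - G z < \<kappa> + \<eta>"
  obtains C and r :: "nat \<Rightarrow> complex" where "C > 0" "\<And>n z. z \<in> E \<Longrightarrow> (\<Prod>i<n. cmod (z - r i)) \<le> C * exp (n * (\<kappa> + 4 * \<eta>))"
proof -
  have Ene: "E \<noteq> {}" using infinite_E by auto
  have cl: "compact (level \<eta>)" using \<eta> by (rule compact_level)
  have disj: "E \<inter> level \<eta> = {}" by (auto simp: level_def)
  obtain d where d: "d > 0" "\<And>x w. x \<in> E \<Longrightarrow> w \<in> level \<eta> \<Longrightarrow> d \<le> dist x w"
    using separate_compact_closed[OF compact_E compact_imp_closed[OF cl] disj] by blast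
  obtain D where D: "\<And>x w. x \<in> E \<Longrightarrow> w \<in> level \<eta> \<Longrightarrow> dist x w \<le> D"
  proof -
    obtain D1 D2 where "\<And>x. x \<in> E \<Longrightarrow> cmod x \<le> D1" "\<And>x. x \<in> level \<eta> \<Longrightarrow> cmod x \<le> D2"
      using compact_imp_bounded[OF compact_E] compact_imp_bounded[OF cl] unfolding bounded_iff by blast
    then have "dist x w \<le> D1 + D2" if "x \<in> E" "w \<in> level \<eta>" for x w
      using that norm_triangle_ineq4[of x w] by (simp add: dist_norm) (meson add_mono order_trans)
    then show ?thesis by (rule that)
  qed
  \<comment> \<open>The mesh is \<eta> times a lower bound for the distance between E and the level
    set, so passing to a net point changes each factor by at most \<open>1 + \<eta>\<close>, hence
    by at most \<open>exp \<eta>\<close>.\<close>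
  define \<rho> where "\<rho> = d * \<eta>"
  have \<rho>: "\<rho> > 0" using d \<eta> by (simp add: \<rho>_def)
  obtain Z where Z: "finite Z" "Z \<subseteq> E" "E \<subseteq> (\<Union>x\<in>Z. ball x \<rho>)"
    by (rule compactE_image[OF compact_E, of E "\<lambda>x. ball x \<rho>"]) (use \<rho> in auto)
  have Zne: "Z \<noteq> {}" using Z Ene by auto
  define c where "c = \<kappa> + 2 * \<eta>"
  define B where "B = \<bar>ln d\<bar> + \<bar>ln D\<bar> + \<bar>c\<bar> + 1"
  have Bpos: "B > 0" by (simp add: B_def)
  have B: "\<bar>ln (dist x w) - c\<bar> \<le> B" if "x \<in> Z" "w \<in> level \<eta>" for x w
  proof -
    have "d \<le> dist x w" "dist x w \<le> D" using d(2)[of x w] D[of x w] that Z by auto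
    moreover from this have "ln d \<le> ln (dist x w)" "ln (dist x w) \<le> ln D" using d(1) by (auto intro!: ln_mono)
    ultimately show ?thesis unfolding B_def by linarith
  qed
  \<comment> \<open>The first bound is the smallness that \<open>exp_le_quadratic\<close> requires;
    the second makes the quadratic error at most \<open>\<beta> * \<eta>\<close>, which becomes
    \<eta> after raising to the power \<open>1 / \<beta>\<close>.\<close>
  define \<beta> where "\<beta> = min (1 / (2 * B)) (\<eta> / (2 * B\<^sup>2))"
  have \<beta>: "\<beta> > 0" using Bpos \<eta> by (simp add: \<beta>_def)
  have \<beta>1: "\<beta> * B \<le> 1 / 2"
  proof -
    have "\<beta> * B \<le> 1 / (2 * B) * B" using Bpos by (intro mult_right_mono) (auto simp: \<beta>_def)
    then show ?thesis using Bpos by simp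
  qed
  have \<beta>2: "2 * (\<beta> * B)\<^sup>2 \<le> \<beta> * \<eta>"
  proof -
    have "\<beta> * (2 * B\<^sup>2) \<le> \<eta> / (2 * B\<^sup>2) * (2 * B\<^sup>2)" using Bpos by (intro mult_right_mono) (auto simp: \<beta>_def)
    then have "\<beta> * (2 * B\<^sup>2) \<le> \<eta>" using Bpos by simp
    then have "\<beta> * (\<beta> * (2 * B\<^sup>2)) \<le> \<beta> * \<eta>" using \<beta> by (intro mult_left_mono) auto
    then show ?thesis by (simp add: power2_eq_square mult_ac)
  qed
  have "\<exists>r :: nat \<Rightarrow> complex. (\<forall>i. r i \<in> level \<eta>) \<and>
      (\<forall>n. (\<Sum>x\<in>Z. (\<Prod>i<n. dist x (r i)) powr \<beta>) \<le> card Z * exp (n * (\<beta> * c + 2 * (\<beta> * B)\<^sup>2)))"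
    by (rule greedy_poly_on_finite[OF \<eta> Z(1) Zne Z(2) _ c_def _ \<beta> \<beta>1]) (fact \<kappa> B)+
  then obtain r :: "nat \<Rightarrow> complex" where r: "\<And>i. r i \<in> level \<eta>"
    "\<And>n. (\<Sum>x\<in>Z. (\<Prod>i<n. dist x (r i)) powr \<beta>) \<le> card Z * exp (n * (\<beta> * c + 2 * (\<beta> * B)\<^sup>2))"
    by blast
  define C where "C = real (card Z) powr (1 / \<beta>)"
  have cardZ: "card Z > 0" using Z Zne by (simp add: card_gt_0_iff)
  \<comment> \<open>A single term is bounded by the whole sum; raising to the power
    \<open>1 / \<beta>\<close> turns the number of net points into C.\<close>
  have onZ: "(\<Prod>i<n. dist x (r i)) \<le> C * exp (n * (c + \<eta>))" if x: "x \<in> Z" for n x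
  proof -
    have "(\<Prod>i<n. dist x (r i)) powr \<beta> \<le> (\<Sum>x\<in>Z. (\<Prod>i<n. dist x (r i)) powr \<beta>)"
      using Z x by (intro member_le_sum) auto
    also have "\<dots> \<le> card Z * exp (n * (\<beta> * c + 2 * (\<beta> * B)\<^sup>2))" by (rule r)
    also have "\<dots> \<le> card Z * exp (n * (\<beta> * c + \<beta> * \<eta>))"
      using \<beta>2 by (intro mult_left_mono) (auto intro!: mult_left_mono)
    finally have "((\<Prod>i<n. dist x (r i)) powr \<beta>) powr (1 / \<beta>) \<le> (card Z * exp (n * (\<beta> * c + \<beta> * \<eta>))) powr (1 / \<beta>)"
      using \<beta> by (intro powr_mono2) auto
    moreover have "((\<Prod>i<n. dist x (r i)) powr \<beta>) powr (1 / \<beta>) = (\<Prod>i<n. dist x (r i))"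
      using \<beta> by (simp add: powr_powr prod_nonneg)
    moreover have "(card Z * exp (n * (\<beta> * c + \<beta> * \<eta>))) powr (1 / \<beta>) = C * exp (n * (c + \<eta>))"
      using \<beta> by (simp add: powr_mult C_def powr_def[of "exp _"] field_simps)
    ultimately show ?thesis by simp
  qed
  show ?thesis
  proof (rule that[of C r])
    show "C > 0" using cardZ by (simp add: C_def)
    fix n z assume z: "z \<in> E"
    then obtain x where x: "x \<in> Z" "dist x z < \<rho>" using Z(3) by auto
    have "(\<Prod>i<n. cmod (z - r i)) \<le> (\<Prod>i<n. dist x (r i) * exp \<eta>)"
    proof (intro prod_mono conjI)
      fix i
      have "cmod (z - r i) \<le> dist x (r i) + \<rho>"
        using dist_triangle[of z "r i" x] x(2) by (simp add: dist_norm norm_minus_commute)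
      also have "\<dots> \<le> dist x (r i) + dist x (r i) * \<eta>"
        using d(2)[of x "r i"] x(1) Z r(1) \<eta> by (auto simp: \<rho>_def)
      also have "\<dots> = dist x (r i) * (1 + \<eta>)" by (simp add: algebra_simps)
      also have "\<dots> \<le> dist x (r i) * exp \<eta>" by (intro mult_left_mono exp_ge_add_one_self) auto
      finally show "cmod (z - r i) \<le> dist x (r i) * exp \<eta>" .
    qed auto
    also have "\<dots> = (\<Prod>i<n. dist x (r i)) * exp (n * \<eta>)" by (simp add: prod.distrib exp_of_nat_mult)
    also have "\<dots> \<le> C * exp (n * (c + \<eta>)) * exp (n * \<eta>)" by (intro mult_right_mono onZ x) auto
    also have "\<dots> = C * exp (n * (\<kappa> + 4 * \<eta>))"
      by (simp add: c_def mult.assoc algebra_simps flip: exp_add)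
    finally show "(\<Prod>i<n. cmod (z - r i)) \<le> C * exp (n * (\<kappa> + 4 * \<eta>))" .
  qed
qed

end

section \<open>Level curves of harmonic functions\<close>

lemma connected_real_contains_between:
  fixes S :: "real set"
  assumes "connected S" "a \<in> S" "b \<in> S" "a \<le> x" "x \<le> b"
  shows "x \<in> S"
  using assms connected_iff_interval by blast

text \<open>In the parameter of the arc each branch becomes an interval containing the parameter of
  p and more. Two of three such intervals extend to the same side, hence overlap in more than that
  point.\<close>

lemma open_arc_no_three_branches:
  fixes A :: "'a::topological_space set"
  assumes A: "A homeomorphic {0<..<1::real}"
    and S: "\<And>k. k < 3 \<Longrightarrow> connected (S k) \<and> S k \<subseteq> A \<and> p \<in> S k \<and> S k \<noteq> {p}"
    and disj: "\<And>j k. j < k \<Longrightarrow> k < (3::nat) \<Longrightarrow> S j \<inter> S k \<subseteq> {p}"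
  shows False
proof -
  obtain f g where fg: "homeomorphism A {0<..<1::real} f g" using A homeomorphic_def by blast
  have inj: "inj_on f A" using fg by (metis homeomorphism_apply1 inj_onI)
  have cf: "continuous_on A f" using fg homeomorphism_cont1 by blast
  have disj': "S j \<inter> S k \<subseteq> {p}" if "j \<noteq> k" "j < 3" "k < 3" for j k
    using disj[of j k] disj[of k j] that by (metis Int_commute nat_neq_iff)
  have conn: "connected (f ` S k)" if "k < 3" for k
    using S[OF that] cf by (meson connected_continuous_image continuous_on_subset)
  have common: "y = f p" if "y \<in> f ` S j" "y \<in> f ` S k" "j \<noteq> k" "j < 3" "k < 3" for y j k
  proof -
    from that(1,2) obtain a b where ab: "a \<in> S j" "b \<in> S k" "y = f a" "y = f b" by blast
    then have "a = b" using inj S that by (metis inj_onD subsetD)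
    then have "a \<in> S j \<inter> S k" using ab by simp
    then show ?thesis using disj' that ab by blast
  qed
  have up: False if "x \<in> f ` S j" "y \<in> f ` S k" "f p < x" "x \<le> y" "j \<noteq> k" "j < 3" "k < 3" for x y j k
  proof -
    have "f p \<in> f ` S k" using S that by blast
    then have "x \<in> f ` S k" using connected_real_contains_between[OF conn, of k "f p" y x] that by auto
    then show False using common[of x j k] that by auto
  qed
  have down: False if "x \<in> f ` S j" "y \<in> f ` S k" "x < f p" "y \<le> x" "j \<noteq> k" "j < 3" "k < 3" for x y j k
  proof -
    have "f p \<in> f ` S k" using S that by blast
    then have "x \<in> f ` S k" using connected_real_contains_between[OF conn, of k y "f p" x] that by auto
    then show False using common[of x j k] that by auto
  qed
  have "\<exists>x\<in>f ` S k. x \<noteq> f p" if "k < 3" for k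
  proof -
    from S[OF that] obtain q where "q \<in> S k" "q \<noteq> p" by blast
    then show ?thesis using inj S[OF that] by (metis imageI inj_onD subsetD)
  qed
  then obtain x where x: "\<And>k. k < 3 \<Longrightarrow> x k \<in> f ` S k \<and> x k \<noteq> f p" by metis
  have ne: "\<not> (x j > f p \<and> x k > f p)" "\<not> (x j < f p \<and> x k < f p)" if "j \<noteq> k" "j < 3" "k < 3" for j k
  proof -
    show "\<not> (x j > f p \<and> x k > f p)"
      using up[of "x j" j "x k" k] up[of "x k" k "x j" j] x[OF that(2)] x[OF that(3)] that by (metis linear)
    show "\<not> (x j < f p \<and> x k < f p)"
      using down[of "x j" j "x k" k] down[of "x k" k "x j" j] x[OF that(2)] x[OF that(3)] that by (metis linear)
  qed
  have "x 0 \<noteq> f p" "x 1 \<noteq> f p" "x 2 \<noteq> f p" using x by auto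
  then show False using ne[of 0 1] ne[of 0 2] ne[of 1 2] by (auto simp: neq_iff)
qed

lemma cis_neq_1:
  assumes "0 < \<theta>" "\<theta> \<le> pi" shows "cis \<theta> \<noteq> 1"
proof
  assume "cis \<theta> = 1"
  then have "cos \<theta> = 1" by (metis cis.sel(1) one_complex.sel(1))
  moreover have "cos \<theta> < cos 0" using assms by (intro cos_monotone_0_pi) auto
  ultimately show False by simp
qed

text \<open>At a critical point the zero set of \<open>Re F\<close> has at least four branches.\<close>

lemma level_curve_analytic_at:
  assumes F: "F holomorphic_on ball p r" and r: "r > 0" and F0: "F p = 0"
    and nc: "\<not> F constant_on ball p r"
    and A: "A homeomorphic {0<..<1::real}"
    and AF: "A \<inter> ball p r = {z\<in>ball p r. Re (F z) = 0}"
  shows "\<exists>U f a b. open U \<and> p \<in> U \<and> a < b \<and>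
        f analytic_on (complex_of_real ` {a<..<b}) \<and>
        inj_on f (complex_of_real ` {a<..<b}) \<and>
        (\<forall>t\<in>{a<..<b}. deriv f (complex_of_real t) \<noteq> 0) \<and>
        A \<inter> U = f ` complex_of_real ` {a<..<b}"
proof -
  \<comment> \<open>Here m is the order of the zero. The zero-free factor has an m-th root on a
    disc, so F is the m-th power of a local coordinate \<psi> with inverse f, and in this coordinate
    the zero set of \<open>Re F\<close> consists of rays.\<close>
  obtain g r1 m where m: "0 < m" and r1: "0 < r1" "ball p r1 \<subseteq> ball p r"
    and g: "g holomorphic_on ball p r1" and Fg: "\<And>w. w \<in> ball p r1 \<Longrightarrow> F w = (w - p) ^ m * g w"
    and g0: "\<And>w. w \<in> ball p r1 \<Longrightarrow> g w \<noteq> 0"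
    by (rule holomorphic_factor_zero_nonconstant[OF F open_ball connected_ball _ F0 nc]) (use r in auto)
  have "simply_connected (ball p r1)" by (simp add: convex_imp_simply_connected)
  then obtain l where l: "l holomorphic_on ball p r1" "\<And>w. w \<in> ball p r1 \<Longrightarrow> g w = exp (l w)"
    using simply_connected_eq_holomorphic_log[OF open_ball, of p r1] g g0 by metis
  define \<psi> where "\<psi> w = (w - p) * exp (l w / of_nat m)" for w
  have \<psi>: "\<psi> holomorphic_on ball p r1" unfolding \<psi>_def by (intro holomorphic_intros l) (use m in auto)
  have F\<psi>: "F w = \<psi> w ^ m" if "w \<in> ball p r1" for w
    using Fg[OF that] l(2)[OF that] m by (simp add: \<psi>_def power_mult_distrib exp_divide_power_eq)
  have "((\<lambda>w. (w - p) * exp (l w / of_nat m)) has_field_derivative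
      (p - p) * deriv (\<lambda>w. exp (l w / of_nat m)) p + 1 * exp (l p / of_nat m)) (at p)"
  proof (rule DERIV_mult')
    show "((\<lambda>w. w - p) has_field_derivative 1) (at p)" by (auto intro!: derivative_eq_intros)
    have "(\<lambda>w. exp (l w / of_nat m)) holomorphic_on ball p r1"
      by (intro holomorphic_intros l) (use m in auto)
    then show "((\<lambda>w. exp (l w / of_nat m)) has_field_derivative deriv (\<lambda>w. exp (l w / of_nat m)) p) (at p)"
      by (rule holomorphic_derivI[OF _ open_ball]) (use r1 in auto)
  qed
  then have "deriv \<psi> p \<noteq> 0" unfolding \<psi>_def by (subst DERIV_imp_deriv) auto
  then obtain r2 where r2: "r2 > 0" "ball p r2 \<subseteq> ball p r1" "open (\<psi> ` ball p r2)" "inj_on \<psi> (ball p r2)"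
    using has_complex_derivative_locally_invertible[OF \<psi> _ open_ball] r1 by (metis centre_in_ball)
  have \<psi>2: "\<psi> holomorphic_on ball p r2" using \<psi> r2 holomorphic_on_subset by blast
  obtain f where f: "f holomorphic_on \<psi> ` ball p r2" "\<And>z. z \<in> ball p r2 \<Longrightarrow> deriv \<psi> z * deriv f (\<psi> z) = 1"
    "\<And>z. z \<in> ball p r2 \<Longrightarrow> f (\<psi> z) = z"
    using holomorphic_has_inverse[OF \<psi>2 open_ball r2(4)] by metis
  have \<psi>p: "\<psi> p = 0" by (simp add: \<psi>_def)
  then have "0 \<in> \<psi> ` ball p r2" using r2(1) by force
  then obtain \<delta> where \<delta>: "\<delta> > 0" "ball 0 \<delta> \<subseteq> \<psi> ` ball p r2" using r2(3) open_contains_ball by blast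
  have f\<psi>: "f \<zeta> \<in> ball p r2 \<and> \<psi> (f \<zeta>) = \<zeta>" if "\<zeta> \<in> ball 0 \<delta>" for \<zeta> using that \<delta> f(3) by force
  have fA: "f \<zeta> \<in> A \<longleftrightarrow> Re (\<zeta> ^ m) = 0" if "\<zeta> \<in> ball 0 \<delta>" for \<zeta>
  proof -
    have "f \<zeta> \<in> ball p r1" "f \<zeta> \<in> ball p r" using f\<psi>[OF that] r2 r1 by blast+
    then have "f \<zeta> \<in> A \<longleftrightarrow> Re (F (f \<zeta>)) = 0" using AF by blast
    then show ?thesis using F\<psi>[OF \<open>f \<zeta> \<in> ball p r1\<close>] f\<psi>[OF that] by simp
  qed
  have fp: "f 0 = p" using f(3)[of p] \<psi>p r2(1) by simp
  have f\<delta>: "f holomorphic_on ball 0 \<delta>" using f(1) \<delta>(2) holomorphic_on_subset by blast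
  have "m = 1"
  proof (rule ccontr)
    assume "m \<noteq> 1"
    then have m2: "m \<ge> 2" using m by simp
    \<comment> \<open>Unit vectors with purely imaginary m-th power. Three consecutive ones span an
      angle \<open>2 * pi / m\<close>, at most pi for m at least 2, so they are distinct.\<close>
    define \<omega> where "\<omega> k = cis (pi * (1 + 2 * real k) / (2 * real m))" for k :: nat
    have \<omega>m: "Re ((of_real s * \<omega> k) ^ m) = 0" for s k
    proof -
      have "\<omega> k ^ m = cis (pi / 2 + k * pi)"
      proof -
        have "real m * (pi * (1 + 2 * real k) / (2 * real m)) = pi / 2 + k * pi"
          using m by (simp add: field_simps)
        then show ?thesis unfolding \<omega>_def Complex.DeMoivre by simp
      qed
      also have "Re \<dots> = 0" by (simp add: cos_add)
      finally have "Re (\<omega> k ^ m) = 0" .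
      then show ?thesis by (simp add: power_mult_distrib flip: of_real_power)
    qed
    have \<omega>ne: "\<omega> j \<noteq> \<omega> k" if "j < k" "k < 3" for j k
    proof
      assume eq: "\<omega> j = \<omega> k"
      define \<theta> where "\<theta> = pi * (real k - real j) / real m"
      have "\<omega> k = \<omega> j * cis \<theta>" 
      proof -
        have "pi * (1 + 2 * real k) / (2 * real m) = pi * (1 + 2 * real j) / (2 * real m) + \<theta>"
          using m by (simp add: \<theta>_def field_simps)
        then show ?thesis unfolding \<omega>_def cis_mult by simp
      qed
      then have "cis \<theta> = 1" using eq by (simp add: \<omega>_def)
      moreover have "0 < \<theta>" using that m by (simp add: \<theta>_def)
      moreover have "\<theta> \<le> pi"
      proof -
        have "real k - real j \<le> real m" using that m2 by linarith
        then show ?thesis using m by (simp add: \<theta>_def divide_le_eq)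
      qed
      ultimately show False using cis_neq_1 by blast
    qed
    define S where "S k = (\<lambda>s. f (of_real s * \<omega> k)) ` {0..\<delta> / 2}" for k
    have inb: "of_real s * \<omega> k \<in> ball 0 \<delta>" if "s \<in> {0..\<delta> / 2}" for s k
      using that \<delta> by (simp add: norm_mult \<omega>_def)
    show False
    proof (rule open_arc_no_three_branches[OF A, of S p])
      fix k :: nat assume k: "k < 3"
      have "continuous_on {0..\<delta> / 2} (\<lambda>s. f (of_real s * \<omega> k))"
        by (rule continuous_on_compose2[OF holomorphic_on_imp_continuous_on[OF f\<delta>]])
          (use inb in \<open>auto intro!: continuous_intros\<close>)
      then have "connected (S k)" unfolding S_def by (intro connected_continuous_image) auto
      moreover have "S k \<subseteq> A"
        unfolding S_def using fA[OF inb] \<omega>m by blast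
      moreover have "p \<in> S k"
        unfolding S_def using fp \<delta> by (intro image_eqI[of _ _ 0]) auto
      moreover have "f (of_real (\<delta> / 2) * \<omega> k) \<noteq> p"
      proof
        assume "f (of_real (\<delta> / 2) * \<omega> k) = p"
        then have "of_real (\<delta> / 2) * \<omega> k = 0"
          using f\<psi>[OF inb, of "\<delta> / 2" k] \<delta> \<psi>p by simp
        then show False using \<delta> by (simp add: \<omega>_def)
      qed
      moreover have "f (of_real (\<delta> / 2) * \<omega> k) \<in> S k" unfolding S_def using \<delta> by (intro imageI) auto
      ultimately show "connected (S k) \<and> S k \<subseteq> A \<and> p \<in> S k \<and> S k \<noteq> {p}" by blast
    next
      fix j k :: nat assume jk: "j < k" "k < 3"
      show "S j \<inter> S k \<subseteq> {p}"
      proof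
        fix x assume "x \<in> S j \<inter> S k"
        then obtain s s' where s: "s \<in> {0..\<delta> / 2}" "x = f (of_real s * \<omega> j)"
          and s': "s' \<in> {0..\<delta> / 2}" "x = f (of_real s' * \<omega> k)" unfolding S_def by blast
        have eq: "of_real s * \<omega> j = of_real s' * \<omega> k"
          using f\<psi>[OF inb[OF s(1), of j]] f\<psi>[OF inb[OF s'(1), of k]] s s' by metis
        then have "cmod (of_real s * \<omega> j) = cmod (of_real s' * \<omega> k)" by simp
        then have "s = s'" using s s' by (simp add: norm_mult \<omega>_def)
        then have "s = 0" using eq \<omega>ne[OF jk] by simp
        then show "x \<in> {p}" using s fp by simp
      qed
    qed
  qed
  \<comment> \<open>For m = 1 the zero set is the image of a piece of the imaginary axis under f;
    the factor \<open>\<i>\<close> makes the parameter real.\<close>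
  define h where "h \<zeta> = f (\<i> * \<zeta>)" for \<zeta>
  define U where "U = ball p r2 \<inter> \<psi> -` ball 0 \<delta>"
  have iball: "\<i> * complex_of_real t \<in> ball 0 \<delta>" if "t \<in> {-\<delta><..<\<delta>}" for t
    using that by (auto simp: norm_mult abs_less_iff)
  have "open U" unfolding U_def
    by (intro continuous_open_preimage holomorphic_on_imp_continuous_on \<psi>2 open_ball)
  moreover have "p \<in> U" using r2 \<delta> \<psi>p by (simp add: U_def)
  moreover have "- \<delta> < \<delta>" using \<delta> by simp
  moreover have hol: "h holomorphic_on ball 0 \<delta>"
    unfolding h_def by (rule holomorphic_on_compose_gen[OF _ f\<delta>, unfolded o_def])
      (auto intro!: holomorphic_intros simp: norm_mult)
  have "h analytic_on complex_of_real ` {-\<delta><..<\<delta>}"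
    by (rule analytic_on_subset[of _ "ball 0 \<delta>"]) (use hol in \<open>auto simp: analytic_on_open abs_less_iff\<close>)
  moreover have "inj_on h (complex_of_real ` {-\<delta><..<\<delta>})"
  proof (rule inj_onI)
    fix x y assume x: "x \<in> complex_of_real ` {-\<delta><..<\<delta>}" and y: "y \<in> complex_of_real ` {-\<delta><..<\<delta>}" and eq: "h x = h y"
    have "\<i> * x \<in> ball 0 \<delta>" "\<i> * y \<in> ball 0 \<delta>" using x y iball by blast+
    then have "\<i> * x = \<i> * y" using f\<psi> eq unfolding h_def by metis
    then show "x = y" by simp
  qed
  moreover have "deriv h (complex_of_real t) \<noteq> 0" if t: "t \<in> {-\<delta><..<\<delta>}" for t
  proof -
    let ?\<zeta> = "\<i> * complex_of_real t"
    have \<zeta>: "?\<zeta> \<in> ball 0 \<delta>" using iball[OF t] .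
    have "(f has_field_derivative deriv f ?\<zeta>) (at ?\<zeta>)"
      by (rule holomorphic_derivI[OF f\<delta> open_ball \<zeta>])
    then have "((\<lambda>x. f (\<i> * x)) has_field_derivative deriv f ?\<zeta> * \<i>) (at (complex_of_real t))"
      by (rule DERIV_chain2) (auto intro!: derivative_eq_intros)
    then have "deriv h (complex_of_real t) = deriv f ?\<zeta> * \<i>" unfolding h_def by (rule DERIV_imp_deriv)
    moreover have "deriv f ?\<zeta> \<noteq> 0"
      using f(2)[of "f ?\<zeta>"] f\<psi>[OF \<zeta>] by auto
    ultimately show ?thesis by simp
  qed
  moreover have "A \<inter> U = h ` complex_of_real ` {-\<delta><..<\<delta>}"
  proof (intro equalityI subsetI)
    fix x assume x: "x \<in> A \<inter> U"
    then have x1: "x \<in> ball p r2" "\<psi> x \<in> ball 0 \<delta>" by (auto simp: U_def)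
    have "Re (\<psi> x) = 0" using fA[OF x1(2)] f(3)[OF x1(1)] x \<open>m = 1\<close> by simp
    then have eq: "\<psi> x = \<i> * complex_of_real (Im (\<psi> x))" by (simp add: complex_eq_iff)
    have "cmod (\<psi> x) < \<delta>" using x1 by simp
    then have "\<bar>Im (\<psi> x)\<bar> < \<delta>" using abs_Im_le_cmod[of "\<psi> x"] by linarith
    moreover have "x = h (complex_of_real (Im (\<psi> x)))" unfolding h_def using eq f(3)[OF x1(1)] by metis
    ultimately show "x \<in> h ` complex_of_real ` {-\<delta><..<\<delta>}" by (auto simp: abs_less_iff)
  next
    fix x assume "x \<in> h ` complex_of_real ` {-\<delta><..<\<delta>}"
    then obtain t where t: "t \<in> {-\<delta><..<\<delta>}" "x = f (\<i> * complex_of_real t)" by (auto simp: h_def)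
    have "x \<in> A" using fA[OF iball[OF t(1)]] t \<open>m = 1\<close> by simp
    then show "x \<in> A \<inter> U" using f\<psi>[OF iball[OF t(1)]] iball[OF t(1)] t(2) by (simp add: U_def)
  qed
  ultimately show ?thesis by blast
qed

section \<open>Continuation of the Green's function across the boundary\<close>

lemma norm_prod_mset: "norm (\<Prod>x\<in>#M. f x :: 'a::{comm_semiring_1,real_normed_div_algebra}) = (\<Prod>x\<in>#M. norm (f x))"
  by (induction M) (auto simp: norm_mult)

lemma prod_mset_mono_nonneg:
  fixes f g :: "'a \<Rightarrow> real"
  assumes "\<And>x. x \<in># M \<Longrightarrow> 0 \<le> f x \<and> f x \<le> g x"
  shows "0 \<le> (\<Prod>x\<in>#M. f x) \<and> (\<Prod>x\<in>#M. f x) \<le> (\<Prod>x\<in>#M. g x)"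
  using assms
proof (induction M)
  case (add x M)
  have x: "0 \<le> f x" "f x \<le> g x" "0 \<le> g x" using add.prems[of x] by auto
  have "0 \<le> (\<Prod>x\<in>#M. f x) \<and> (\<Prod>x\<in>#M. f x) \<le> (\<Prod>x\<in>#M. g x)"
    by (rule add.IH) (use add.prems in auto)
  then show ?case using x by (simp add: mult_mono)
qed simp

lemma holomorphic_on_prod_mset:
  "(\<And>x. x \<in># M \<Longrightarrow> (\<lambda>z. f z x) holomorphic_on S) \<Longrightarrow> (\<lambda>z. \<Prod>x\<in>#M. f z x) holomorphic_on S"
  by (induction M) (auto intro!: holomorphic_intros)

lemma poly_eq_prod_proots:
  fixes P :: "complex poly"
  assumes "lead_coeff P = 1"
  shows "poly P z = (\<Prod>x\<in>#proots P. z - x)"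
proof -
  have "P = (\<Prod>x\<in>#proots P. [:- x, 1:])"
    using complex_poly_decompose_multiset[of P] assms by simp
  then have "poly P z = poly (\<Prod>x\<in>#proots P. [:- x, 1:]) z" by simp
  also have "\<dots> = (\<Prod>x\<in>#proots P. z - x)" by (simp add: poly_prod_mset image_mset.compositionality o_def)
  finally show ?thesis .
qed

definition zeros_in :: "complex set \<Rightarrow> complex poly \<Rightarrow> complex multiset" where
  "zeros_in D P = filter_mset (\<lambda>z. z \<in> D) (proots P)"

text \<open>For monic P this is P divided by the linear factors of its zeros in D, written as the
  product of the other factors so that it is entire and visibly zero-free on D.\<close>

definition cofactor :: "complex set \<Rightarrow> complex poly \<Rightarrow> complex \<Rightarrow> complex" where
  "cofactor D P z = (\<Prod>x\<in>#filter_mset (\<lambda>z. z \<notin> D) (proots P). z - x)"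

lemma poly_eq_cofactor:
  assumes "lead_coeff P = 1"
  shows "poly P z = (\<Prod>x\<in>#zeros_in D P. z - x) * cofactor D P z"
  unfolding poly_eq_prod_proots[OF assms] zeros_in_def cofactor_def
  by (metis (no_types) image_mset_union multiset_partition prod_mset.union)

lemma cofactor_nonzero: "z \<in> D \<Longrightarrow> cofactor D P z \<noteq> 0"
  unfolding cofactor_def by (auto simp: prod_mset_zero_iff)

lemma cofactor_holomorphic: "cofactor D P holomorphic_on S"
  unfolding cofactor_def[abs_def] by (intro holomorphic_on_prod_mset holomorphic_intros)

text \<open>Each zero in the disc is reflected in the circle (a Blaschke factor), which keeps the modulus
  on the circle and makes the factor at the centre at least \<open>\<rho>\<close>.\<close>

lemma cofactor_bound:
  fixes P :: "complex poly"
  assumes lc: "lead_coeff P = 1" and \<rho>: "\<rho> > 0"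
    and M: "\<And>z. dist z0 z = \<rho> \<Longrightarrow> cmod (poly P z) \<le> M"
  shows "cmod (cofactor D P z0) * \<rho> ^ size (zeros_in D P) \<le> M"
proof -
  \<comment> \<open>A zero in D may lie outside the circle of radius \<rho>; its factor is kept,
    having modulus at least \<rho> at the centre anyway. The reflected factors have modulus exactly
    \<rho> there.\<close>
  define b where "b z x = (if dist z0 x < \<rho> then (of_real (\<rho>\<^sup>2) - cnj (x - z0) * (z - z0)) / of_real \<rho> else z - x)" for z x
  have b_circle: "cmod (b z x) = cmod (z - x)" if z: "dist z0 z = \<rho>" for z x
  proof (cases "dist z0 x < \<rho>")
    case True
    define u v where "u = z - z0" and "v = x - z0"
    have u: "cmod u = \<rho>" using z by (simp add: u_def dist_norm norm_minus_commute)
    have "of_real (\<rho>\<^sup>2) = cnj u * u" using u by (metis complex_norm_square mult.commute)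
    then have "of_real (\<rho>\<^sup>2) - cnj v * u = cnj (u - v) * u" by (simp add: algebra_simps)
    then have "cmod (of_real (\<rho>\<^sup>2) - cnj v * u) = cmod (u - v) * \<rho>" using u by (simp add: norm_mult del: complex_cnj_diff)
    then have "cmod (b z x) = cmod (u - v)" using True \<rho> by (simp add: b_def u_def v_def norm_divide)
    then show ?thesis by (simp add: u_def v_def)
  qed (simp add: b_def)
  have b_centre: "\<rho> \<le> cmod (b z0 x)" for x
    using \<rho> by (auto simp: b_def norm_divide power2_eq_square dist_norm)
  define B where "B z = (\<Prod>x\<in>#zeros_in D P. b z x) * cofactor D P z" for z
  have holB: "B holomorphic_on UNIV"
    unfolding B_def
  proof (intro holomorphic_intros holomorphic_on_prod_mset cofactor_holomorphic)
    fix x show "(\<lambda>z. b z x) holomorphic_on UNIV"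
      unfolding b_def by (cases "dist z0 x < \<rho>") (auto intro!: holomorphic_intros)
  qed
  have "cmod (B z0) \<le> M"
  proof (rule maximum_modulus_frontier[of B "cball z0 \<rho>" M z0])
    show "B holomorphic_on interior (cball z0 \<rho>)" using holB holomorphic_on_subset by blast
    show "continuous_on (closure (cball z0 \<rho>)) B"
      using holB holomorphic_on_imp_continuous_on continuous_on_subset by blast
    fix z assume "z \<in> frontier (cball z0 \<rho>)"
    then have z: "dist z0 z = \<rho>" using \<rho> by (simp add: frontier_cball)
    have "cmod (B z) = cmod (poly P z)"
      unfolding B_def poly_eq_cofactor[OF lc, of z D] by (simp add: norm_mult norm_prod_mset b_circle[OF z])
    then show "cmod (B z) \<le> M" using M[OF z] by simp
  qed (use \<rho> in auto)
  moreover have "\<rho> ^ size (zeros_in D P) \<le> (\<Prod>x\<in>#zeros_in D P. cmod (b z0 x))"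
    using prod_mset_mono_nonneg[of "zeros_in D P" "\<lambda>_. \<rho>" "\<lambda>x. cmod (b z0 x)"] \<rho> b_centre by simp
  then have "\<rho> ^ size (zeros_in D P) * cmod (cofactor D P z0) \<le> cmod (B z0)"
    unfolding B_def norm_mult norm_prod_mset by (intro mult_right_mono) auto
  ultimately show ?thesis by (simp add: mult.commute)
qed

context regular_green
begin

text \<open>Near E the boundary limit keeps G below 1, so the part of the disc where G is at least 1
  is compact inside the complement of E.\<close>

lemma G_bounded:
  obtains A where "A \<ge> 0" "\<And>z. z \<in> cball p r \<Longrightarrow> z \<notin> E \<Longrightarrow> G z \<le> A"
proof -
  define \<phi> where "\<phi> z = min (G z - 1) (r - dist p z)" for z
  have "compact {z\<in>- E. \<phi> z \<ge> 0}"
  proof (rule compact_superlevel)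
    show "continuous_on (- E) \<phi>" unfolding \<phi>_def by (intro continuous_intros G_continuous)
    show "\<forall>\<^sub>F z in at \<zeta> within - E. \<phi> z < 0" if \<zeta>: "\<zeta> \<in> closure (- E)" "\<zeta> \<notin> - E" for \<zeta>
      using order_tendstoD(2)[OF bdry_closure[OF \<zeta>] zero_less_one] by eventually_elim (auto simp: \<phi>_def)
    show "\<forall>\<^sub>F z in at_infinity. z \<in> - E \<longrightarrow> \<phi> z < 0"
      unfolding eventually_at_infinity
    proof (intro exI[of _ "cmod p + r + 1"] allI impI)
      fix z assume "cmod p + r + 1 \<le> cmod z"
      then have "dist p z > r" using norm_triangle_ineq2[of z p] by (simp add: dist_norm norm_minus_commute)
      then show "\<phi> z < 0" by (simp add: \<phi>_def)
    qed
  qed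
  moreover have "continuous_on {z\<in>- E. \<phi> z \<ge> 0} G" by (rule continuous_on_subset[OF G_continuous]) auto
  ultimately have "bounded (G ` {z\<in>- E. \<phi> z \<ge> 0})"
    by (intro compact_imp_bounded compact_continuous_image)
  then obtain A where A: "\<And>z. z \<in> {z\<in>- E. \<phi> z \<ge> 0} \<Longrightarrow> \<bar>G z\<bar> \<le> A"
    unfolding bounded_iff by auto
  show ?thesis
  proof (rule that[of "max A 1"])
    fix z assume z: "z \<in> cball p r" "z \<notin> E"
    show "G z \<le> max A 1"
    proof (cases "G z \<ge> 1")
      case True
      then have "\<bar>G z\<bar> \<le> A" using z by (intro A) (auto simp: \<phi>_def)
      then show ?thesis by simp
    qed simp
  qed auto
qed

end

context asymptotically_extremal
begin

section \<open>Roots of the cofactors and their limit\<close>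

lemma T_zeros_size_le: "size (zeros_in D (T n)) \<le> n"
proof -
  have "size (zeros_in D (T n)) \<le> size (proots (T n))"
    unfolding zeros_in_def by (intro size_mset_mono) auto
  then show ?thesis using size_proots_complex[of "T n"] T_deg by simp
qed

text \<open>The cofactor has no zeros on the disc, hence a holomorphic logarithm there. Only the
  modulus of the root is recorded, since any branch serves.\<close>

lemma cofactor_root_exists:
  assumes "n > 0"
  shows "\<exists>g. g holomorphic_on ball p r \<and> (\<forall>z\<in>ball p r. cmod (g z) ^ n * t n = cmod (cofactor (ball p r) (T n) z))"
proof -
  have "simply_connected (ball p r)" by (simp add: convex_imp_simply_connected)
  then obtain l where l: "l holomorphic_on ball p r" "\<And>z. z \<in> ball p r \<Longrightarrow> cofactor (ball p r) (T n) z = exp (l z)"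
    using simply_connected_eq_holomorphic_log[OF open_ball, of p r] cofactor_holomorphic cofactor_nonzero by metis
  define g where "g z = exp ((l z - of_real (ln (t n))) / of_nat n)" for z
  have "g z ^ n = exp (l z) / of_real (t n)" for z
  proof -
    have "g z ^ n = exp (l z - of_real (ln (t n)))"
      unfolding g_def using assms by (simp flip: exp_of_nat_mult)
    then show ?thesis using t_pos[of n] by (simp add: exp_diff exp_of_real)
  qed
  then have "cmod (g z) ^ n * t n = cmod (exp (l z))" for z
    using t_pos[of n] by (simp add: norm_divide flip: norm_power)
  moreover have "g holomorphic_on ball p r"
    unfolding g_def by (intro holomorphic_intros l) (use assms in auto)
  ultimately show ?thesis using l(2) by (intro exI[of _ g]) simp
qed

definition cofactor_root :: "complex \<Rightarrow> real \<Rightarrow> nat \<Rightarrow> complex \<Rightarrow> complex" where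
  "cofactor_root p r n = (SOME g. g holomorphic_on ball p r \<and>
     (\<forall>z\<in>ball p r. cmod (g z) ^ n * t n = cmod (cofactor (ball p r) (T n) z)))"

lemma cofactor_root:
  assumes "n > 0"
  shows "cofactor_root p r n holomorphic_on ball p r"
    "z \<in> ball p r \<Longrightarrow> cmod (cofactor_root p r n z) ^ n * t n = cmod (cofactor (ball p r) (T n) z)"
  using someI_ex[OF cofactor_root_exists[OF assms, of p r]] unfolding cofactor_root_def by blast+

text \<open>The n-th root turns the power of \<rho> in \<open>cofactor_bound\<close> from the number
  of zeros into their proportion, which is harmless once that proportion tends to 0.\<close>

lemma cofactor_root_upper:
  assumes n: "n > 0" and z0: "z0 \<in> ball p r" and \<rho>: "0 < \<rho>"
    and L: "\<And>z. dist z0 z = \<rho> \<Longrightarrow> cmod (poly (T n) z) \<le> t n * exp (n * L)"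
  shows "cmod (cofactor_root p r n z0) \<le> exp L * \<rho> powr (- (size (zeros_in (ball p r) (T n)) / n))"
proof -
  let ?m = "size (zeros_in (ball p r) (T n))" and ?g = "cmod (cofactor_root p r n z0)"
  have "?g ^ n * t n * \<rho> ^ ?m \<le> t n * exp (n * L)"
    unfolding cofactor_root(2)[OF n z0] by (rule cofactor_bound[OF T_monic \<rho> L])
  then have "t n * (?g ^ n * \<rho> ^ ?m) \<le> t n * exp (n * L)" by (simp add: mult_ac)
  then have "?g ^ n * \<rho> ^ ?m \<le> exp (n * L)" using t_pos[of n] by simp
  also have "\<dots> = exp L ^ n" by (simp add: exp_of_nat_mult)
  also have "\<rho> ^ ?m = (\<rho> powr (?m / n)) ^ n" using n \<rho> by (simp add: powr_realpow[symmetric] powr_powr)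
  finally have "(?g * \<rho> powr (?m / n)) ^ n \<le> exp L ^ n" by (simp add: power_mult_distrib)
  then have "?g * \<rho> powr (?m / n) \<le> exp L" using n by (simp add: power_mono_iff)
  then show ?thesis using \<rho> by (simp add: powr_minus_divide field_simps)
qed

text \<open>Two points of a disc of radius at most 1 / 2 are at distance at most 1, so the linear
  factors that were divided out have modulus at most 1 on it.\<close>

lemma T_le_cofactor_root:
  assumes n: "n > 0" and r: "r \<le> 1 / 2" and z: "z \<in> ball p r"
  shows "cmod (poly (T n) z) \<le> t n * cmod (cofactor_root p r n z) ^ n"
proof -
  have "(\<Prod>x\<in>#zeros_in (ball p r) (T n). cmod (z - x)) \<le> (\<Prod>x\<in>#zeros_in (ball p r) (T n). 1)"
  proof (rule conjunct2[OF prod_mset_mono_nonneg], intro conjI)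
    fix x assume "x \<in># zeros_in (ball p r) (T n)"
    then have "dist p x < r" by (simp add: zeros_in_def)
    then show "cmod (z - x) \<le> 1"
      using z r dist_triangle[of z x p] by (simp add: dist_norm norm_minus_commute)
  qed simp
  then have "cmod (poly (T n) z) \<le> 1 * cmod (cofactor (ball p r) (T n) z)"
    unfolding poly_eq_cofactor[OF T_monic, where D = "ball p r"] norm_mult norm_prod_mset
    by (intro mult_right_mono) auto
  then show ?thesis using cofactor_root(2)[OF n z] by (simp add: mult.commute)
qed

lemma T_Bernstein_Walsh:
  assumes "z \<notin> E" shows "cmod (poly (T n) z) \<le> t n * exp (n * G z)"
  by (rule Bernstein_Walsh[OF _ t_pos T_le assms]) (auto simp: T_deg)

text \<open>The upper bounds for g come from \<open>cofactor_root_upper\<close> on small circles,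
  where the powers of \<rho> disappear in the limit; the lower bound off E comes from near
  maximality. The limit is holomorphic on the entire disc, so its modulus continues
  \<open>exp G\<close> across the boundary of E.\<close>

theorem green_extends:
  assumes r: "0 < r" "r \<le> 1 / 2" and s: "strict_mono s"
    and m: "(\<lambda>j. size (zeros_in (ball p r) (T (s j))) / s j) \<longlonglongrightarrow> 0"
  obtains g where "g holomorphic_on ball p r"
    "\<And>z. z \<in> ball p r \<Longrightarrow> z \<notin> E \<Longrightarrow> cmod (g z) = exp (G z)"
    "\<And>z. z \<in> ball p r \<Longrightarrow> z \<in> interior E \<Longrightarrow> cmod (g z) \<le> 1"
proof -
  let ?D = "ball p r"
  \<comment> \<open>The shift keeps the order of the root positive.\<close>
  define \<F> where "\<F> j = cofactor_root p r (s (Suc j))" for j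
  have spos: "s (Suc j) > 0" for j using s by (metis le_0_eq not_gr_zero seq_suble Suc_neq_Zero)
  obtain A where A: "A \<ge> 0" "\<And>z. z \<in> cball p r \<Longrightarrow> z \<notin> E \<Longrightarrow> G z \<le> A" using G_bounded by blast
  have TA: "cmod (poly (T n) z) \<le> t n * exp (n * A)" if "z \<in> cball p r" for n z
  proof (cases "z \<in> E")
    case True
    have "t n * 1 \<le> t n * exp (n * A)" using t_pos[of n] A(1) by (intro mult_left_mono) auto
    then show ?thesis using T_le[OF True, of n] by simp
  next
    case False
    have "t n * exp (n * G z) \<le> t n * exp (n * A)"
      using t_pos[of n] A(2)[OF that False] by (simp add: mult_left_mono)
    then show ?thesis using T_Bernstein_Walsh[OF False, of n] by simp
  qed
  obtain g k where g: "g holomorphic_on ?D" and k: "strict_mono (k :: nat \<Rightarrow> nat)"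
    and lim: "\<And>x. x \<in> ?D \<Longrightarrow> ((\<lambda>n. \<F> (k n) x) \<longlongrightarrow> g x) sequentially"
    and unif: "\<And>K. \<lbrakk>compact K; K \<subseteq> ?D\<rbrakk> \<Longrightarrow> uniform_limit K (\<F> \<circ> k) g sequentially"
  proof (rule Montel[of ?D "range \<F>" \<F>])
    show "h holomorphic_on ?D" if "h \<in> range \<F>" for h
      using that cofactor_root(1)[OF spos] by (auto simp: \<F>_def)
    fix K assume K: "compact K" "K \<subseteq> ?D"
    obtain e where e: "e > 0" "(\<Union>x\<in>K. ball x e) \<subseteq> ?D"
      by (rule compact_subset_open_imp_ball_epsilon_subset[OF K(1) open_ball K(2)])
    \<comment> \<open>\<rho> < e keeps the circles inside the disc; since \<rho> and the proportion
      of zeros are at most 1, the bound is independent of j.\<close>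
    define \<rho> where "\<rho> = min (e / 2) 1"
    have \<rho>: "0 < \<rho>" "\<rho> < e" "\<rho> \<le> 1" using e by (auto simp: \<rho>_def)
    have "cmod (\<F> j z) \<le> exp A / \<rho>" if z: "z \<in> K" for j z
    proof -
      let ?n = "s (Suc j)"
      let ?m = "size (zeros_in ?D (T ?n))"
      have "cmod (\<F> j z) \<le> exp A * \<rho> powr (- (?m / ?n))"
        unfolding \<F>_def
      proof (rule cofactor_root_upper[OF spos _ \<rho>(1)])
        show "z \<in> ?D" using z K by blast
        fix w assume "dist z w = \<rho>"
        then have "w \<in> ball z e" using \<rho> by simp
        then have "w \<in> ?D" using e(2) z by blast
        then show "cmod (poly (T ?n) w) \<le> t ?n * exp (?n * A)" by (intro TA) auto
      qed
      also have "\<rho> powr (- (?m / ?n)) \<le> \<rho> powr (- 1)"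
        using \<rho> T_zeros_size_le[of ?D ?n] spos[of j] by (intro powr_mono') (auto simp: divide_le_eq)
      finally show ?thesis using \<rho> by (simp add: powr_minus_divide)
    qed
    then show "\<exists>B. \<forall>h\<in>range \<F>. \<forall>z\<in>K. cmod (h z) \<le> B" by blast
  qed auto
  define q where "q j = s (Suc (k j))" for j
  have q: "strict_mono q" using s k by (simp add: q_def strict_mono_def)
  have qpos: "q j > 0" for j unfolding q_def by (rule spos)
  have "strict_mono (\<lambda>j. Suc (k j))" using k by (simp add: strict_mono_def)
  from LIMSEQ_subseq_LIMSEQ[OF m this]
  have mq: "(\<lambda>j. size (zeros_in ?D (T (q j))) / q j) \<longlonglongrightarrow> 0" by (simp add: q_def o_def)
  have lim': "(\<lambda>j. cofactor_root p r (q j) z) \<longlonglongrightarrow> g z" if "z \<in> ?D" for z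
    using lim[OF that] by (simp add: \<F>_def q_def)
  have upper: "cmod (g z0) \<le> exp L"
    if z0: "z0 \<in> ?D" and \<rho>: "\<rho> > 0" and L: "\<And>n z. dist z0 z = \<rho> \<Longrightarrow> cmod (poly (T n) z) \<le> t n * exp (n * L)" for z0 \<rho> L
  proof -
    have 1: "(\<lambda>j. exp L * \<rho> powr (- (size (zeros_in ?D (T (q j))) / q j))) \<longlonglongrightarrow> exp L * \<rho> powr (- 0)"
      using \<rho> by (intro tendsto_intros mq) auto
    have 2: "(\<lambda>j. cmod (cofactor_root p r (q j) z0)) \<longlonglongrightarrow> cmod (g z0)"
      by (intro tendsto_norm lim' z0)
    have "cmod (g z0) \<le> exp L * \<rho> powr (- 0)"
      using cofactor_root_upper[OF qpos z0 \<rho> L] by (intro LIMSEQ_le[OF 2 1]) auto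
    then show ?thesis using \<rho> by simp
  qed
  show ?thesis
  proof (rule that[OF g])
    fix z0 assume z0: "z0 \<in> ?D" "z0 \<in> interior E"
    then obtain e where e: "e > 0" "cball z0 e \<subseteq> E" using mem_interior_cball by blast
    have "cmod (g z0) \<le> exp 0"
    proof (rule upper[OF z0(1) e(1)])
      fix n z assume "dist z0 z = e"
      then have "z \<in> cball z0 e" by simp
      then have "z \<in> E" using e(2) by blast
      then show "cmod (poly (T n) z) \<le> t n * exp (n * 0)" using T_le by simp
    qed
    then show "cmod (g z0) \<le> 1" by simp
  next
    fix z0 assume z0: "z0 \<in> ?D" "z0 \<notin> E"
    have contG: "isCont G z0" using z0(2) by (rule G_isCont)
    have up: "cmod (g z0) \<le> exp (G z0)"
    proof (rule le_if_mult_powr_le[of "exp (- 1)"])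
      fix \<eta> :: real assume \<eta>: "\<eta> > 0"
      have "eventually (\<lambda>z. G z < G z0 + \<eta>) (nhds z0)"
        using contG \<eta> by (intro order_tendstoD(2)[of G "G z0"]) (auto simp: isCont_def tendsto_at_iff_tendsto_nhds)
      moreover have "eventually (\<lambda>z. z \<in> - E) (nhds z0)"
        using open_compl z0 by (intro eventually_nhds_in_open) auto
      ultimately have "eventually (\<lambda>z. z \<notin> E \<and> G z < G z0 + \<eta>) (nhds z0)" by eventually_elim auto
      then obtain e where e: "e > 0" "\<And>z. dist z z0 < e \<Longrightarrow> z \<notin> E \<and> G z < G z0 + \<eta>"
        unfolding eventually_nhds_metric by blast
      have "cmod (g z0) \<le> exp (G z0 + \<eta>)"
      proof (rule upper[OF z0(1), of "e / 2"])
        fix n z assume "dist z0 z = e / 2"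
        then have z: "z \<notin> E" "G z < G z0 + \<eta>" using e(1) e(2)[of z] by (auto simp: dist_commute)
        have "t n * exp (n * G z) \<le> t n * exp (n * (G z0 + \<eta>))"
          using t_pos[of n] z(2) by (simp add: mult_left_mono)
        then show "cmod (poly (T n) z) \<le> t n * exp (n * (G z0 + \<eta>))" using T_Bernstein_Walsh[OF z(1), of n] by simp
      qed (use e in simp)
      then have "cmod (g z0) * exp (- \<eta>) \<le> exp (G z0 + \<eta>) * exp (- \<eta>)" by (rule mult_right_mono) simp
      moreover have "exp (- 1) powr \<eta> = exp (- \<eta>)" by (simp add: powr_def)
      ultimately show "cmod (g z0) * exp (- 1) powr \<eta> \<le> exp (G z0)" by (simp flip: exp_add)
    qed simp
    moreover have "exp (G z0) \<le> cmod (g z0)"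
    \<comment> \<open>A strict inequality at z0 persists on a ball with a factor c < 1. Uniform
      convergence carries it over to the roots with the factor c + \<tau> < 1, and
      \<open>T_le_cofactor_root\<close> then yields a gap on the ball, which contradicts near
      maximality.\<close>
    proof (rule ccontr)
      assume "\<not> exp (G z0) \<le> cmod (g z0)"
      then have less: "cmod (g z0) * exp (- G z0) < 1" by (simp add: exp_minus field_simps)
      define c where "c = (1 + cmod (g z0) * exp (- G z0)) / 2"
      have c: "cmod (g z0) * exp (- G z0) < c" "c < 1" "c > 0" using less
        by (auto simp: c_def add_pos_nonneg)
      have "isCont g z0" using g z0(1) by (metis holomorphic_on_imp_continuous_on continuous_on_eq_continuous_at open_ball)
      then have "isCont (\<lambda>z. cmod (g z) * exp (- G z)) z0" using contG by (intro continuous_intros)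
      then have "((\<lambda>z. cmod (g z) * exp (- G z)) \<longlongrightarrow> cmod (g z0) * exp (- G z0)) (nhds z0)"
        unfolding isCont_def by (rule iffD1[OF tendsto_at_iff_tendsto_nhds])
      then have "eventually (\<lambda>z. cmod (g z) * exp (- G z) < c) (nhds z0)"
        using c(1) by (rule order_tendstoD(2))
      moreover have "eventually (\<lambda>z. z \<in> ?D - E) (nhds z0)"
        using open_compl z0 by (intro eventually_nhds_in_open) (auto intro: open_Diff compact_imp_closed compact_E)
      ultimately have "eventually (\<lambda>z. z \<in> ?D - E \<and> cmod (g z) * exp (- G z) < c) (nhds z0)" by eventually_elim auto
      then obtain e where e: "e > 0" "\<And>z. dist z z0 < e \<Longrightarrow> z \<in> ?D - E \<and> cmod (g z) * exp (- G z) < c"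
        unfolding eventually_nhds_metric by blast
      define \<tau> where "\<tau> = (1 - c) / 2"
      have \<tau>: "\<tau> > 0" using c by (simp add: \<tau>_def)
      have sub: "cball z0 (e / 2) \<subseteq> ?D"
      proof
        fix z assume "z \<in> cball z0 (e / 2)"
        then have "dist z z0 < e" using e(1) by (simp add: dist_commute)
        then show "z \<in> ?D" using e(2) by blast
      qed
      have "\<forall>\<^sub>F n in sequentially. \<forall>z\<in>cball z0 (e / 2). dist ((\<F> \<circ> k) n z) (g z) < \<tau>"
        using unif[OF compact_cball sub] \<tau> unfolding uniform_limit_iff by blast
      then have ev1: "\<forall>\<^sub>F j in sequentially. \<forall>z\<in>cball z0 (e / 2). dist (cofactor_root p r (q j) z) (g z) < \<tau>"
        by (simp add: \<F>_def q_def)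
      define \<epsilon> where "\<epsilon> = min (e / 2) (- ln (c + \<tau>))"
      have c\<tau>: "0 < c + \<tau>" "c + \<tau> < 1" using c by (auto simp: \<tau>_def field_simps)
      have \<epsilon>: "\<epsilon> > 0" "\<epsilon> \<le> e / 2" "\<epsilon> \<le> - ln (c + \<tau>)" using e c\<tau> by (auto simp: \<epsilon>_def)
      have "\<forall>\<^sub>F n in sequentially. \<exists>y\<in>ball z0 \<epsilon>. cmod (poly (T n) y) > t n * exp (n * (G y - \<epsilon>))"
        using near_maximal_outside[OF z0(2)] \<epsilon>(1) unfolding near_maximal_def by blast
      then have ev2: "\<forall>\<^sub>F j in sequentially. \<exists>y\<in>ball z0 \<epsilon>. cmod (poly (T (q j)) y) > t (q j) * exp (q j * (G y - \<epsilon>))"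
        using eventually_subseq[OF q] by blast
      obtain j y where close: "\<And>z. z \<in> cball z0 (e / 2) \<Longrightarrow> dist (cofactor_root p r (q j) z) (g z) < \<tau>"
        and y: "y \<in> ball z0 \<epsilon>" "cmod (poly (T (q j)) y) > t (q j) * exp (q j * (G y - \<epsilon>))"
        using eventually_happens'[OF sequentially_bot eventually_conj[OF ev1 ev2]] by blast
      let ?n = "q j"
      have y1: "y \<in> cball z0 (e / 2)" "dist y z0 < e" using y(1) \<epsilon>(2) e(1) by (auto simp: dist_commute)
      then have y2: "y \<in> ?D" "y \<notin> E" "cmod (g y) * exp (- G y) < c" using e(2) by blast+
      have "cmod (cofactor_root p r ?n y) \<le> cmod (g y) + dist (cofactor_root p r ?n y) (g y)"
        by (simp add: dist_norm norm_triangle_sub)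
      also have "\<dots> \<le> c * exp (G y) + \<tau> * exp (G y)"
      proof (intro add_mono)
        show "cmod (g y) \<le> c * exp (G y)" using y2(3) by (simp add: exp_minus field_simps)
        \<comment> \<open>Nonnegativity of G makes the additive error relative to
          \<open>exp (G y)\<close>.\<close>
        have "\<tau> * 1 \<le> \<tau> * exp (G y)" using \<tau> G_nonneg[OF y2(2)] by (intro mult_left_mono) auto
        then show "dist (cofactor_root p r ?n y) (g y) \<le> \<tau> * exp (G y)" using close[OF y1(1)] by simp
      qed
      also have "\<dots> = exp (ln (c + \<tau>)) * exp (G y)" using c\<tau> by (simp add: algebra_simps)
      also have "\<dots> \<le> exp (- \<epsilon>) * exp (G y)" using \<epsilon>(3) by (intro mult_right_mono) auto
      also have "\<dots> = exp (G y - \<epsilon>)" by (simp flip: exp_add)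
      finally have "cmod (cofactor_root p r ?n y) ^ ?n \<le> exp (G y - \<epsilon>) ^ ?n" by (intro power_mono) auto
      then have "t ?n * cmod (cofactor_root p r ?n y) ^ ?n \<le> t ?n * exp (?n * (G y - \<epsilon>))"
        using t_pos[of ?n] by (simp add: exp_of_nat_mult)
      then show False using T_le_cofactor_root[OF qpos r(2) y2(1)] y(2) by (meson le_less_trans less_le_trans not_le)
    qed
    ultimately show "cmod (g z0) = exp (G z0)" by simp
  qed
qed

end

text \<open>Analyticity is local, so it suffices to continue G across the boundary on small discs
  inside N, which contain at most as many zeros as N does.\<close>

theorem (in asymptotically_extremal) analytic_arc_if_few_zeros:
  assumes N: "open N" and arc: "open_arc (N \<inter> frontier E)"
    and s: "strict_mono s"
    and m: "(\<lambda>j. size (zeros_in N (T (s j))) / s j) \<longlonglongrightarrow> 0"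
  shows "analytic_arc (N \<inter> frontier E)"
  unfolding analytic_arc_def
proof
  fix p assume p: "p \<in> N \<inter> frontier E"
  obtain r0 where r0: "r0 > 0" "ball p r0 \<subseteq> N" using N p open_contains_ball by blast
  define r where "r = min r0 (1 / 2)"
  have r: "0 < r" "r \<le> 1 / 2" "ball p r \<subseteq> N" using r0 by (auto simp: r_def)
  let ?D = "ball p r"
  have "(\<lambda>j. size (zeros_in ?D (T (s j))) / s j) \<longlonglongrightarrow> 0"
  proof (rule tendsto_sandwich[OF _ _ tendsto_const m])
    have "size (zeros_in ?D (T n)) \<le> size (zeros_in N (T n))" for n
      unfolding zeros_in_def using r(3) by (intro size_mset_mono mset_subset_eqI) auto
    then show "\<forall>\<^sub>F j in sequentially. size (zeros_in ?D (T (s j))) / s j \<le> size (zeros_in N (T (s j))) / s j"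
      by (intro always_eventually allI divide_right_mono) auto
  qed (auto intro: always_eventually)
  then obtain g where g: "g holomorphic_on ?D"
    and g_out: "\<And>z. z \<in> ?D \<Longrightarrow> z \<notin> E \<Longrightarrow> cmod (g z) = exp (G z)"
    and g_int: "\<And>z. z \<in> ?D \<Longrightarrow> z \<in> interior E \<Longrightarrow> cmod (g z) \<le> 1"
    using green_extends[OF r(1,2) s] by blast
  have g_cont: "isCont g z" if "z \<in> ?D" for z
    using g that by (metis holomorphic_on_imp_continuous_on continuous_on_eq_continuous_at open_ball)
  \<comment> \<open>By continuity the value is the limit of \<open>cmod (g w) = exp (G w)\<close>
    from the complement of E, and regularity makes that limit 1.\<close>
  have g_bd: "cmod (g z) = 1" if z: "z \<in> ?D" "z \<in> frontier E" for z
  proof -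
    have zE: "z \<in> E" using z(2) compact_E compact_imp_closed frontier_subset_closed by blast
    have "z \<in> closure (- E)" using z(2) by (simp add: frontier_closures)
    then have nb: "at z within - E \<noteq> bot" using zE by (simp add: trivial_limit_within islimpt_in_closure)
    have "((\<lambda>w. cmod (g w)) \<longlongrightarrow> cmod (g z)) (at z within - E)"
      using g_cont[OF z(1)] by (intro tendsto_norm) (meson continuous_at_imp_continuous_at_within continuous_within)
    moreover have "\<forall>\<^sub>F w in at z within - E. cmod (g w) = exp (G w)"
    proof -
      have "\<forall>\<^sub>F w in at z within - E. w \<in> ?D" 
        unfolding eventually_at_topological using z(1) by blast
      moreover have "\<forall>\<^sub>F w in at z within - E. w \<in> - E" by (simp add: eventually_at_filter)
      ultimately show ?thesis by eventually_elim (use g_out in auto)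
    qed
    ultimately have "((\<lambda>w. exp (G w)) \<longlongrightarrow> cmod (g z)) (at z within - E)" by (rule Lim_transform_eventually)
    moreover have "((\<lambda>w. exp (G w)) \<longlongrightarrow> exp 0) (at z within - E)" by (intro tendsto_exp bdry z(2))
    ultimately show ?thesis using tendsto_unique[OF nb] by fastforce
  qed
  have out_near: "\<exists>w\<in>ball p e. w \<notin> E" if "e > 0" for e
  proof -
    have "p \<in> closure (- E)" using p by (simp add: frontier_closures)
    then show ?thesis using that unfolding closure_approachable by (metis ComplD dist_commute mem_ball)
  qed
  have g_nonconst: "cmod (g w) > 1" if "w \<in> ?D" "w \<notin> E" for w using g_out[OF that] G_pos[OF that(2)] by simp
  \<comment> \<open>Equality at an interior point would make g constant on the whole disc by the
    maximum modulus principle, but the disc also contains points off E, where the modulus exceeds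
    1.\<close>
  have g_int': "cmod (g z) < 1" if z: "z \<in> ?D" "z \<in> interior E" for z
  proof (rule ccontr)
    assume "\<not> cmod (g z) < 1"
    then have 1: "cmod (g z) = 1" using g_int[OF z] by simp
    have "g constant_on ?D"
      by (rule maximum_modulus_principle[OF g open_ball connected_ball, of "?D \<inter> interior E" z])
        (use z g_int 1 in auto)
    then obtain c where c: "\<And>w. w \<in> ?D \<Longrightarrow> g w = c" unfolding constant_on_def by blast
    obtain w where "w \<in> ?D" "w \<notin> E" using out_near[OF r(1)] by blast
    then show False using g_nonconst[of w] c[of w] c[of z] z(1) 1 by simp
  qed
  have level: "z \<in> frontier E \<longleftrightarrow> cmod (g z) = 1" if z: "z \<in> ?D" for z
  proof -
    have "z \<in> interior E \<or> z \<in> frontier E \<or> z \<notin> E" using closure_subset[of E] by (auto simp: frontier_def)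
    moreover have "frontier E \<subseteq> E" using compact_E by (simp add: compact_imp_closed frontier_subset_closed)
    moreover have "interior E \<inter> frontier E = {}" by (auto simp: frontier_def)
    ultimately show ?thesis using g_bd[OF z] g_int'[OF z] g_nonconst[OF z] by fastforce
  qed
  have gp: "cmod (g p) = 1" using g_bd[of p] p r by simp
  have "eventually (\<lambda>z. g z \<noteq> 0) (nhds p)"
    using g_cont[of p] gp r by (intro tendsto_imp_eventually_ne[of g "g p"]) (auto simp: isCont_def tendsto_at_iff_tendsto_nhds)
  then obtain r1 where r1: "r1 > 0" "\<And>z. dist z p < r1 \<Longrightarrow> g z \<noteq> 0" unfolding eventually_nhds_metric by blast
  define r2 where "r2 = min r r1"
  have r2: "r2 > 0" "ball p r2 \<subseteq> ?D" "\<And>z. z \<in> ball p r2 \<Longrightarrow> g z \<noteq> 0"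
    using r r1 by (auto simp: r2_def dist_commute)
  have "simply_connected (ball p r2)" by (simp add: convex_imp_simply_connected)
  moreover have "g holomorphic_on ball p r2" using g r2 holomorphic_on_subset by blast
  ultimately obtain l where l: "l holomorphic_on ball p r2" "\<And>z. z \<in> ball p r2 \<Longrightarrow> g z = exp (l z)"
    using simply_connected_eq_holomorphic_log[OF open_ball, of p r2] r2(3) by metis
  \<comment> \<open>A logarithm of g normalized at p; as g has modulus 1 there, the real part of F
    is still \<open>ln (cmod (g z))\<close>.\<close>
  define F where "F z = l z - l p" for z
  have norm_g: "cmod (g z) = exp (Re (F z))" if "z \<in> ball p r2" for z
  proof -
    have "cmod (g z) = exp (Re (l z))" using l(2)[OF that] by simp
    moreover have "exp (Re (l p)) = 1" using gp l(2)[of p] r2(1) by simp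
    ultimately show ?thesis by (simp add: F_def exp_diff)
  qed
  show "\<exists>U f a b. open U \<and> p \<in> U \<and> a < b \<and>
        f analytic_on (complex_of_real ` {a<..<b}) \<and>
        inj_on f (complex_of_real ` {a<..<b}) \<and>
        (\<forall>t\<in>{a<..<b}. deriv f (complex_of_real t) \<noteq> 0) \<and>
        (N \<inter> frontier E) \<inter> U = f ` complex_of_real ` {a<..<b}"
  proof (rule level_curve_analytic_at[of F p r2])
    show "F holomorphic_on ball p r2" unfolding F_def by (intro holomorphic_intros l)
    show "F p = 0" by (simp add: F_def)
    show "N \<inter> frontier E homeomorphic {0<..<1::real}" using arc by (simp add: open_arc_def)
    show "\<not> F constant_on ball p r2"
    proof
      assume "F constant_on ball p r2"
      then obtain c where c: "\<And>w. w \<in> ball p r2 \<Longrightarrow> F w = c" unfolding constant_on_def by blast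
      then have "c = 0" using r2(1) by (metis F_def centre_in_ball diff_self)
      moreover obtain w where "w \<in> ball p r2" "w \<notin> E" using out_near[OF r2(1)] by blast
      ultimately show False using g_nonconst[of w] norm_g[of w] c[of w] r2(2) by auto
    qed
    show "N \<inter> frontier E \<inter> ball p r2 = {z \<in> ball p r2. Re (F z) = 0}"
    proof -
      have "z \<in> N \<inter> frontier E \<longleftrightarrow> Re (F z) = 0" if z: "z \<in> ball p r2" for z
      proof -
        have "z \<in> ?D" "z \<in> N" using z r2(2) r(3) by auto
        then show ?thesis using level[of z] norm_g[OF z] by auto
      qed
      then show ?thesis by blast
    qed
  qed (rule r2(1))
qed

text \<open>The Chebyshev norm is compared with the norms of the monic polynomials from
  \<open>small_monic_polys\<close>, whose constant C contributes only
  \<open>ln C / n\<close>.\<close>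

lemma (in regular_green) chebyshev_asymptotically_extremal:
  obtains \<kappa> where "asymptotically_extremal E G (chebyshev_poly E) (\<lambda>n. sup_norm_on E (poly (chebyshev_poly E n))) \<kappa>"
proof -
  define T where "T = chebyshev_poly E"
  define t where "t n = sup_norm_on E (poly (T n))" for n
  have T: "is_chebyshev_poly E n (T n)" for n
    unfolding T_def by (rule is_chebyshev_poly_chebyshev_poly[OF compact_E infinite_E])
  then have deg: "degree (T n) = n" "lead_coeff (T n) = 1" for n unfolding is_chebyshev_poly_def by blast+
  have le: "cmod (poly (T n) z) \<le> t n" if "z \<in> E" for n z
    unfolding t_def by (intro sup_norm_on_upper compact_E that continuous_intros)
  have tpos: "t n > 0" for n
  proof (rule ccontr)
    assume "\<not> t n > 0"
    then have "cmod (poly (T n) z) \<le> 0" if "z \<in> E" for z using le[OF that, of n] by linarith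
    then have "E \<subseteq> {z. poly (T n) z = 0}" by auto
    moreover have "T n \<noteq> 0" using deg(2)[of n] by auto
    ultimately show False using infinite_E poly_roots_finite finite_subset by blast
  qed
  obtain \<kappa> where \<kappa>: "\<And>\<eta>. \<eta> > 0 \<Longrightarrow> \<forall>\<^sub>F z in at_infinity. \<kappa> - \<eta> < ln (cmod z) - G z"
    "\<And>\<eta>. \<eta> > 0 \<Longrightarrow> \<exists>\<^sub>F z in at_infinity. ln (cmod z) - G z < \<kappa> + \<eta>"
    using log_capacity_constant_exists by blast
  have "\<forall>\<^sub>F n in sequentially. ln (t n) / n < \<kappa> + \<eta>" if \<eta>: "\<eta> > 0" for \<eta>
  proof -
    \<comment> \<open>Four times \<eta> / 8 uses up half of \<eta>; the other half is left for
      \<open>ln C / n\<close>.\<close>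
    have "\<eta> / 8 > 0" using \<eta> by simp
    then obtain C and r :: "nat \<Rightarrow> complex" where C: "C > 0"
      and r: "\<And>n z. z \<in> E \<Longrightarrow> (\<Prod>i<n. cmod (z - r i)) \<le> C * exp (n * (\<kappa> + 4 * (\<eta> / 8)))"
    proof (rule small_monic_polys[of "\<eta> / 8" \<kappa>])
      show "\<exists>\<^sub>F z in at_infinity. ln (cmod z) - G z < \<kappa> + \<epsilon>" if "\<epsilon> > 0" for \<epsilon>
        using that by (rule \<kappa>(2))
    qed (rule that)
    have tC: "t n \<le> C * exp (n * (\<kappa> + \<eta> / 2))" for n
    proof -
      define P where "P = (\<Prod>i<n. [:- r i, 1:])"
      have "t n \<le> sup_norm_on E (poly P)"
        using T[of n] prod_linear_degree[of r n] unfolding is_chebyshev_poly_def t_def P_def by blast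
      also have "\<dots> \<le> C * exp (n * (\<kappa> + \<eta> / 2))"
      proof (rule sup_norm_on_least)
        show "E \<noteq> {}" using infinite_E by auto
        fix z assume "z \<in> E"
        then show "cmod (poly P z) \<le> C * exp (n * (\<kappa> + \<eta> / 2))"
          using r[of z n] by (simp add: P_def poly_prod prod_norm)
      qed
      finally show ?thesis .
    qed
    have "(\<lambda>n. ln C / real n) \<longlonglongrightarrow> 0" by (rule lim_const_over_n)
    then have "\<forall>\<^sub>F n in sequentially. ln C / real n < \<eta> / 2" using \<eta> by (intro order_tendstoD(2)) auto
    with eventually_gt_at_top[of 0] show ?thesis
    proof eventually_elim
      case (elim n)
      have "ln (t n) \<le> ln (C * exp (n * (\<kappa> + \<eta> / 2)))" using tC[of n] tpos[of n] by (intro ln_mono)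
      also have "\<dots> = ln C + n * (\<kappa> + \<eta> / 2)" using C by (simp add: ln_mult)
      finally have "ln (t n) / n \<le> (ln C + n * (\<kappa> + \<eta> / 2)) / n" by (intro divide_right_mono) auto
      also have "\<dots> = ln C / n + (\<kappa> + \<eta> / 2)" using elim(1) by (simp add: add_divide_distrib)
      finally show ?case using elim(2) by linarith
    qed
  qed
  then have "asymptotically_extremal E G T t \<kappa>"
    by unfold_locales (use deg tpos le \<kappa>(1) in auto)
  then show ?thesis using that unfolding T_def t_def by blast
qed

section \<open>From potential regularity to the theorem\<close>

lemma regular_green_if_potential_regular:
  assumes E: "compact E" "connected (- E)" "infinite E" and reg: "potential_regular E"
  obtains G where "regular_green E G"
proof -
  \<comment> \<open>The complement of E is connected and unbounded, so it is its own only component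
    and coincides with \<open>outside E\<close>.\<close>
  have "\<not> bounded (- E)" using E(1) by (intro cobounded_imp_unbounded) (simp add: compact_imp_bounded)
  moreover have "connected_component_set (- E) x = - E" if "x \<notin> E" for x
    using that E(2) by (simp add: connected_component_eq_self)
  moreover have "connected_component_set (- E) x = {}" if "x \<in> E" for x
    using that by (subst connected_component_eq_empty) simp
  ultimately have out: "outside E = - E" unfolding outside_def by force
  obtain G where G: "is_green_function E G" "\<And>\<zeta>. \<zeta> \<in> frontier (outside E) \<Longrightarrow> (G \<longlongrightarrow> 0) (at \<zeta> within outside E)"
    using reg unfolding potential_regular_def by blast
  have "regular_green E G"
    using E G unfolding regular_green_def is_green_function_def out by (auto simp: frontier_complement)
  then show ?thesis by (rule that)
qed

theorem theorem1p1:
  fixes \<e> N :: "complex set"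
  assumes "compact \<e>" and "connected (- \<e>)"
    and "potential_regular \<e>"
    and "open N" and "connected N" and "simply_connected N"
    and "open_arc (N \<inter> frontier \<e>)"
    and "components (N - frontier \<e>) = {interior \<e> \<inter> N, (- \<e>) \<inter> N}"
  shows "liminf (\<lambda>n. ereal (real (num_chebyshev_zeros \<e> N n) / real n)) > 0
         \<or> analytic_arc (N \<inter> frontier \<e>)"
proof (subst disj_commute, rule disjCI)
  let ?f = "\<lambda>n. real (num_chebyshev_zeros \<e> N n) / real n"
  assume "\<not> liminf (\<lambda>n. ereal (?f n)) > 0"
  moreover have "0 \<le> liminf (\<lambda>n. ereal (?f n))" by (intro Liminf_bounded always_eventually) simp
  ultimately have lim0: "liminf (\<lambda>n. ereal (?f n)) = 0" by simp
  \<comment> \<open>A vanishing lower limit is attained along a subsequence; the proportion of zeros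
    in N is controlled only on these indices.\<close>
  obtain s :: "nat \<Rightarrow> nat" where s: "strict_mono s" "((\<lambda>n. ereal (?f n)) \<circ> s) \<longlonglongrightarrow> liminf (\<lambda>n. ereal (?f n))"
    using liminf_subseq_lim by blast
  then have "(\<lambda>j. ereal (?f (s j))) \<longlonglongrightarrow> ereal 0" by (simp add: lim0 o_def zero_ereal_def)
  then have few: "(\<lambda>j. size (zeros_in N (chebyshev_poly \<e> (s j))) / s j) \<longlonglongrightarrow> 0"
    by (simp add: num_chebyshev_zeros_def zeros_in_def)
  \<comment> \<open>The definite description in \<open>chebyshev_poly\<close> calls for an infinite
    set, and the arc supplies infinitely many points of it.\<close>
  have "infinite (N \<inter> frontier \<e>)"
  proof
    assume fin: "finite (N \<inter> frontier \<e>)"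
    have "{0<..<1::real} homeomorphic N \<inter> frontier \<e>"
      using assms(7) homeomorphic_sym unfolding open_arc_def by blast
    then have "finite {0<..<1::real}" unfolding homeomorphic_finite[OF fin] by blast
    then show False by (simp add: infinite_Ioo)
  qed
  moreover have "frontier \<e> \<subseteq> \<e>" using assms(1) by (simp add: compact_imp_closed frontier_subset_closed)
  ultimately have "infinite \<e>" by (meson finite_subset inf.coboundedI2)
  then obtain G where "regular_green \<e> G"
    using regular_green_if_potential_regular assms(1-3) by blast
  then obtain \<kappa> where "asymptotically_extremal \<e> G (chebyshev_poly \<e>) (\<lambda>n. sup_norm_on \<e> (poly (chebyshev_poly \<e> n))) \<kappa>"
    using regular_green.chebyshev_asymptotically_extremal by blast
  then show "analytic_arc (N \<inter> frontier \<e>)"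
    by (rule asymptotically_extremal.analytic_arc_if_few_zeros[OF _ assms(4,7) s(1) few])
qed

end
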